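(* Let $N\ge 5$ be an integer, $\alpha>-4$, $0\le\beta\le\frac{N-4}{2}$, $p>1$, and suppose that $$4+\beta+\frac{8+2\alpha+2\beta}{p-1}<N<N_{\alpha,\beta}(p).$$ Assume that $u\in W^{2,2}_{loc}(\mathbb{R}^N\setminus\{0\})$ is a homogeneous, stable solution of the system $-\Delta u=|x|^{\beta}v$, $-\Delta v=|x|^{\alpha}|u|^{p-1}u$ in $\mathbb{R}^N\setminus\{0\}$, with $|x|^{\alpha}|u|^{p+1}\in L^1_{loc}(\mathbb{R}^N\setminus\{0\})$ and $|x|^{-\beta}|\Delta u|^2\in L^1_{loc}(\mathbb{R}^N\setminus\{0\})$. Then $u\equiv 0$.
   Context: Put $\lambda:=\frac{4+\alpha+\beta}{p-1}$. Solution and stability: the system is equivalent to the equation $\Delta(|x|^{-\beta}\Delta u)=|x|^{\alpha}|u|^{p-1}u$ (with $v=-|x|^{-\beta}\Delta u$). The function $u$ is a (weak) solution in an open set $\Omega$, i.e. a critical point of $\mathcal{E}(u)=\int_\Omega\left[\frac12\frac{|\Delta u|^2}{|x|^\beta}-\frac1{p+1}|x|^\alpha|u|^{p+1}\right]dx$, if $$\int_{\Omega}\frac{\Delta u\,\Delta\zeta}{|x|^{\beta}}\,dx=\int_{\Omega}|x|^{\alpha}|u|^{p-1}u\,\zeta\,dx\quad\text{for all }\zeta\in C_0^2(\Omega).$$ It is stable in $\Omega$ if moreover $$p\int_{\Omega}|x|^{\alpha}|u|^{p-1}\zeta^2\,dx\le\int_{\Omega}\frac{|\Delta\zeta|^2}{|x|^{\beta}}\,dx\quad\text{for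 all }\zeta\in C_0^2(\Omega).$$ Here $C_0^2(\Omega)$ denotes $C^2$ functions with compact support in $\Omega$. Homogeneous: $u(\mu x)=\mu^{-\lambda}u(x)$ for all $\mu\in(0,1]$ and $x\in\mathbb{R}^N\setminus\{0\}$. The number $N_{\alpha,\beta}(p)$: for real $y$ define $$\mathfrak{f}(y)=p\lambda\left(\tfrac{4+\alpha+\beta p}{p-1}+2\right)(y-2-\lambda)\left(y-4-\tfrac{4+\alpha+\beta p}{p-1}\right),\qquad \mathfrak{F}(y)=\frac{(y+\beta)^2(y-4-\beta)^2}{16}.$$ Then $\mathfrak{f}-\mathfrak{F}$ is positive at $y=4+\beta+2\lambda$ and negative at $y=4+\beta+(4p+1)\lambda$, and $N_{\alpha,\beta}(p)$ is the least real root of $\mathfrak{f}(y)=\mathfrak{F}(y)$ in the interval between $4+\beta+2\lambda$ and $4+\beta+(4p+1)\lambda$. *)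

theory Defs
  imports "HOL-Analysis.Analysis"
begin

section \<open>Test functions\<close>

definition partial :: "'a::euclidean_space \<Rightarrow> ('a \<Rightarrow> real) \<Rightarrow> 'a \<Rightarrow> real" where
  "partial b f x = frechet_derivative f (at x) b"

primrec C_k :: "nat \<Rightarrow> ('a::euclidean_space \<Rightarrow> real) \<Rightarrow> bool" where
  "C_k 0 f \<longleftrightarrow> continuous_on UNIV f"
| "C_k (Suc k) f \<longleftrightarrow> (\<forall>x. f differentiable (at x)) \<and> (\<forall>b\<in>Basis. C_k k (partial b f))"

definition compact_support_in :: "'a::euclidean_space set \<Rightarrow> ('a \<Rightarrow> real) \<Rightarrow> bool" where
  "compact_support_in \<Omega> f \<longleftrightarrow>
     compact (closure {x. f x \<noteq> 0}) \<and> closure {x. f x \<noteq> 0} \<subseteq> \<Omega>"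

text \<open>Elements of \<open>C\<^sub>0\<^sup>k(\<Omega>)\<close> are identified with their extensions by zero to the whole space.\<close>

definition C0 :: "nat \<Rightarrow> 'a::euclidean_space set \<Rightarrow> ('a \<Rightarrow> real) set" where
  "C0 k \<Omega> = {f. C_k k f \<and> compact_support_in \<Omega> f}"

definition C0_infinity :: "'a::euclidean_space set \<Rightarrow> ('a \<Rightarrow> real) set" where
  "C0_infinity \<Omega> = (\<Inter>k. C0 k \<Omega>)"

definition laplacian :: "('a::euclidean_space \<Rightarrow> real) \<Rightarrow> 'a \<Rightarrow> real" where
  "laplacian f x = (\<Sum>b\<in>Basis. partial b (partial b f) x)"

section \<open>Weak derivatives and local function spaces\<close>

definition L1_loc :: "'a::euclidean_space set \<Rightarrow> ('a \<Rightarrow> real) set" where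
  "L1_loc \<Omega> = {f. \<forall>K. compact K \<longrightarrow> K \<subseteq> \<Omega> \<longrightarrow> f absolutely_integrable_on K}"

definition L2_loc :: "'a::euclidean_space set \<Rightarrow> ('a \<Rightarrow> real) set" where
  "L2_loc \<Omega> = {f. f \<in> borel_measurable (lebesgue_on \<Omega>) \<and>
     (\<forall>K. compact K \<longrightarrow> K \<subseteq> \<Omega> \<longrightarrow> (\<lambda>x. (f x)\<^sup>2) absolutely_integrable_on K)}"

definition has_weak_partial ::
    "'a::euclidean_space set \<Rightarrow> 'a \<Rightarrow> ('a \<Rightarrow> real) \<Rightarrow> ('a \<Rightarrow> real) \<Rightarrow> bool" where
  "has_weak_partial \<Omega> b f g \<longleftrightarrow> f \<in> L1_loc \<Omega> \<and> g \<in> L1_loc \<Omega> \<and>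
     (\<forall>\<phi>\<in>C0_infinity \<Omega>.
        (LINT x:\<Omega>|lebesgue. f x * partial b \<phi> x) = - (LINT x:\<Omega>|lebesgue. g x * \<phi> x))"

text \<open>For open \<open>\<Omega>\<close> a weak derivative is determined only up to a null set; the operator below picks
  an arbitrary representative and is meaningful only where a weak derivative exists. It is used
  only under integrals and in integrability conditions, where the choice is immaterial.\<close>

definition weak_partial ::
    "'a::euclidean_space set \<Rightarrow> 'a \<Rightarrow> ('a \<Rightarrow> real) \<Rightarrow> 'a \<Rightarrow> real" where
  "weak_partial \<Omega> b f = (SOME g. has_weak_partial \<Omega> b f g)"

definition weak_laplacian :: "'a::euclidean_space set \<Rightarrow> ('a \<Rightarrow> real) \<Rightarrow> 'a \<Rightarrow> real" where
  "weak_laplacian \<Omega> u x = (\<Sum>b\<in>Basis. weak_partial \<Omega> b (weak_partial \<Omega> b u) x)"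

definition W22_loc :: "'a::euclidean_space set \<Rightarrow> ('a \<Rightarrow> real) set" where
  "W22_loc \<Omega> = {u. u \<in> L2_loc \<Omega> \<and>
     (\<forall>b\<in>Basis. \<exists>g\<in>L2_loc \<Omega>. has_weak_partial \<Omega> b u g \<and>
        (\<forall>c\<in>Basis. \<exists>h\<in>L2_loc \<Omega>. has_weak_partial \<Omega> c g h))}"

section \<open>Solutions, stability, homogeneity\<close>

text \<open>The system \<open>- \<Delta> u = |x|\<^sup>\<beta> v\<close>, \<open>- \<Delta> v = |x|\<^sup>\<alpha> |u|\<^sup>p\<^sup>-\<^sup>1 u\<close> is understood as the single equation
  \<open>\<Delta> (|x|\<^sup>-\<^sup>\<beta> \<Delta> u) = |x|\<^sup>\<alpha> |u|\<^sup>p\<^sup>-\<^sup>1 u\<close> with \<open>v = - |x|\<^sup>-\<^sup>\<beta> \<Delta> u\<close>, in the weak sense.\<close>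

definition weak_solution ::
    "real \<Rightarrow> real \<Rightarrow> real \<Rightarrow> 'a::euclidean_space set \<Rightarrow> ('a \<Rightarrow> real) \<Rightarrow> bool" where
  "weak_solution \<alpha> \<beta> p \<Omega> u \<longleftrightarrow>
     (\<forall>\<zeta>\<in>C0 2 \<Omega>.
        (LINT x:\<Omega>|lebesgue. weak_laplacian \<Omega> u x * laplacian \<zeta> x / norm x powr \<beta>) =
        (LINT x:\<Omega>|lebesgue. norm x powr \<alpha> * \<bar>u x\<bar> powr (p - 1) * u x * \<zeta> x))"

definition stable_solution ::
    "real \<Rightarrow> real \<Rightarrow> real \<Rightarrow> 'a::euclidean_space set \<Rightarrow> ('a \<Rightarrow> real) \<Rightarrow> bool" where
  "stable_solution \<alpha> \<beta> p \<Omega> u \<longleftrightarrow> weak_solution \<alpha> \<beta> p \<Omega> u \<and>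
     (\<forall>\<zeta>\<in>C0 2 \<Omega>.
        p * (LINT x:\<Omega>|lebesgue. norm x powr \<alpha> * \<bar>u x\<bar> powr (p - 1) * (\<zeta> x)\<^sup>2)
        \<le> (LINT x:\<Omega>|lebesgue. \<bar>laplacian \<zeta> x\<bar>\<^sup>2 / norm x powr \<beta>))"

definition lam :: "real \<Rightarrow> real \<Rightarrow> real \<Rightarrow> real" where
  "lam \<alpha> \<beta> p = (4 + \<alpha> + \<beta>) / (p - 1)"

definition homogeneous :: "real \<Rightarrow> real \<Rightarrow> real \<Rightarrow> ('a::euclidean_space \<Rightarrow> real) \<Rightarrow> bool" where
  "homogeneous \<alpha> \<beta> p u \<longleftrightarrow>
     (\<forall>\<mu>\<in>{0<..1}. \<forall>x\<in>-{0}. u (\<mu> *\<^sub>R x) = \<mu> powr (- lam \<alpha> \<beta> p) * u x)"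

section \<open>The critical dimension\<close>

definition ff :: "real \<Rightarrow> real \<Rightarrow> real \<Rightarrow> real \<Rightarrow> real" where
  "ff \<alpha> \<beta> p y = p * lam \<alpha> \<beta> p * ((4 + \<alpha> + \<beta> * p) / (p - 1) + 2) *
     (y - 2 - lam \<alpha> \<beta> p) * (y - 4 - (4 + \<alpha> + \<beta> * p) / (p - 1))"

definition FF :: "real \<Rightarrow> real \<Rightarrow> real" where
  "FF \<beta> y = (y + \<beta>)\<^sup>2 * (y - 4 - \<beta>)\<^sup>2 / 16"

text \<open>For \<open>\<alpha> > -4\<close>, \<open>\<beta> \<ge> 0\<close>, \<open>p > 1\<close> the difference \<open>ff - FF\<close> is a quartic polynomial that is positive
  at the left and negative at the right end of the interval, so the least root exists.\<close>

definition N_crit :: "real \<Rightarrow> real \<Rightarrow> real \<Rightarrow> real" where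
  "N_crit \<alpha> \<beta> p = (LEAST y. y \<in> {4 + \<beta> + 2 * lam \<alpha> \<beta> p <..< 4 + \<beta> + (4 * p + 1) * lam \<alpha> \<beta> p} \<and>
     ff \<alpha> \<beta> p y = FF \<beta> y)"

end

theory Submission
  imports Defs "HOL-Computational_Algebra.Polynomial"
begin

text \<open>Let \<open>l = \<lambda>\<close>, let \<open>f\<close> be the weak Laplacian of \<open>u\<close>, and let \<open>s = l - (N - 4 - \<beta>) / 2\<close>. The weak equation is tested
  with \<open>u |x|\<^sup>2\<^sup>s G(ln |x|)\<^sup>2\<close> and the stability inequality with \<open>u |x|\<^sup>s G(ln |x|)\<close>. By homogeneity
  \<open>x \<cdot> \<nabla>u = - l u\<close>, so the Laplacians of these functions involve only \<open>u\<close>, \<open>f\<close> and radial factors, and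
  every integrand is a function of \<open>ln |x|\<close> times one of the three functions \<open>f\<^sup>2 |x|\<^sup>2\<^sup>s\<^sup>-\<^sup>\<beta>\<close>,
  \<open>u f |x|\<^sup>2\<^sup>s\<^sup>-\<^sup>2\<^sup>-\<^sup>\<beta>\<close>, \<open>u\<^sup>2 |x|\<^sup>2\<^sup>s\<^sup>-\<^sup>4\<^sup>-\<^sup>\<beta>\<close>, which are homogeneous of degree \<open>- N\<close>. Taking
  \<open>G(\<tau>) = h(\<epsilon> \<tau>)\<close> with \<open>\<epsilon> \<rightarrow> 0\<close> removes the derivatives of \<open>G\<close> and leaves a linear inequality between three
  numbers \<open>A\<close>, \<open>B\<close>, \<open>D\<close>, the integrals of these functions over a shell. A weighted Hardy-Rellich inequality
  supplies the sign of the gradient term without using the gradient of \<open>u\<close>, and \<open>N < N\<^sub>\<alpha>\<^sub>,\<^sub>\<beta>(p)\<close> makes the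
  coefficient of \<open>D\<close> positive; hence \<open>D = 0\<close>.

  The test functions are reached by mollification in \<open>L\<^sup>2\<close>. No density in \<open>L\<^sup>p\<^sup>+\<^sup>1\<close> is needed: applied to
  differences of approximations, stability itself controls the weighted norm with weight \<open>|x|\<^sup>\<alpha> |u|\<^sup>p\<^sup>-\<^sup>1\<close> by
  the \<open>L\<^sup>2\<close> norm of the Laplacian.\<close>

section \<open>Functions of class \<open>C\<^sup>k\<close>\<close>

text \<open>The model is a computation on the sphere. Writing u = |x|^(-l) \<psi>, the Laplacian
  acts on \<psi> as Lap \<psi> - \<mu> \<psi> with \<mu> = l (N - 2 - l). The same expression q (N -
  2 - q) gives \<kappa> at q = l + 2 + \<beta>, the exponent of |x|^(-\<beta>) times the Laplacian
  of u, and \<nu> at q = \<sigma>, the exponent of u |x|^s. Equation and stability combine to: p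
  times the integral of (Lap \<psi> - \<mu> \<psi>)(Lap \<psi> - \<kappa> \<psi>) is at most that of
  (Lap \<psi> - \<nu> \<psi>)^2. After integration by parts the decisive coefficient is p \<mu>
  \<kappa> - \<nu>^2, which is \<open>ff - FF\<close> at N. No sphere occurs in the proof. Degree -N
  is the one for which the integral over a shell a < |x| < b depends only on ln (b / a), so one
  shell can replace the sphere. With G(\<tau>) = h(\<epsilon> \<tau>) every integral carries the
  common factor 1 / \<epsilon>, and each derivative of G costs a further \<epsilon>. The constant in
  the weighted inequality is \<nu> itself: the radial factor of the test function contributes the
  same amount, it cancels, and B + \<mu> D \<le> 0 is left.\<close>

lemma partial_eqI: "(f has_derivative D) (at x) \<Longrightarrow> partial b f x = D b"
  unfolding partial_def using frechet_derivative_at by metis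

lemma has_derivative_partial:
  fixes f :: "'a::euclidean_space \<Rightarrow> real"
  assumes "f differentiable (at x)"
  shows "(f has_derivative (\<lambda>h. \<Sum>b\<in>Basis. (h \<bullet> b) * partial b f x)) (at x)"
proof -
  let ?D = "frechet_derivative f (at x)"
  have D: "(f has_derivative ?D) (at x)" using assms by (simp add: frechet_derivative_works)
  then have lin: "linear ?D" by (rule has_derivative_linear)
  have "?D = (\<lambda>h. \<Sum>b\<in>Basis. (h \<bullet> b) * partial b f x)"
  proof
    fix h
    have "?D h = ?D (\<Sum>b\<in>Basis. (h \<bullet> b) *\<^sub>R b)" by (simp add: euclidean_representation)
    also have "\<dots> = (\<Sum>b\<in>Basis. (h \<bullet> b) * partial b f x)"
      unfolding partial_def using lin by (simp add: linear_sum linear_cmul)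
    finally show "?D h = (\<Sum>b\<in>Basis. (h \<bullet> b) * partial b f x)" .
  qed
  with D show ?thesis by simp
qed

lemma has_field_derivative_partial:
  fixes f :: "real \<Rightarrow> real"
  assumes "f differentiable (at x)"
  shows "(f has_real_derivative partial 1 f x) (at x)"
proof -
  have "(f has_derivative (\<lambda>h. h * partial 1 f x)) (at x)"
    using has_derivative_partial[OF assms] by simp
  then show ?thesis by (rule has_derivative_imp_has_field_derivative) simp
qed

lemma C_k_0D: "C_k 0 f \<Longrightarrow> continuous_on UNIV f"
  by simp

lemma C_k_SucD:
  assumes "C_k (Suc k) f"
  shows "f differentiable (at x)" and "b \<in> Basis \<Longrightarrow> C_k k (partial b f)"
  using assms by auto

lemma C_k_Suc_lower: "C_k (Suc k) f \<Longrightarrow> C_k k f"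
proof (induction k arbitrary: f)
  case 0
  then show ?case
    by (auto intro!: continuous_at_imp_continuous_on differentiable_imp_continuous_within)
next
  case (Suc k)
  from Suc.prems have "\<forall>b\<in>Basis. C_k (Suc k) (partial b f)" by (metis C_k.simps(2))
  with Suc.IH have "\<forall>b\<in>Basis. C_k k (partial b f)" by blast
  then show ?case using Suc.prems by (metis C_k.simps(2))
qed

lemma C_k_lower: "C_k m f \<Longrightarrow> k \<le> m \<Longrightarrow> C_k k f"
  by (induction m) (auto simp del: C_k.simps simp: le_Suc_eq dest: C_k_Suc_lower)

lemma C_k_continuous: "C_k k f \<Longrightarrow> continuous_on UNIV f"
  using C_k_lower[of k f 0] by simp

lemma partial_add:
  "f differentiable (at x) \<Longrightarrow> g differentiable (at x) \<Longrightarrow>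
    partial b (\<lambda>x. f x + g x) x = partial b f x + partial b g x"
  unfolding frechet_derivative_works
  by (subst partial_eqI[OF has_derivative_add]) (auto simp: partial_def)

lemma partial_mult:
  "f differentiable (at x) \<Longrightarrow> g differentiable (at x) \<Longrightarrow>
    partial b (\<lambda>x. f x * g x) x = partial b f x * g x + f x * partial b g x"
  unfolding frechet_derivative_works
  by (subst partial_eqI[OF has_derivative_mult]) (auto simp: partial_def)

lemma partial_const [simp]: "partial b (\<lambda>x. c) = (\<lambda>x. 0)"
  by (rule ext, rule partial_eqI[OF has_derivative_const])

lemma partial_inner [simp]: "partial b (\<lambda>x. x \<bullet> c) = (\<lambda>x. b \<bullet> c)"
  by (rule ext, rule partial_eqI, auto intro!: derivative_eq_intros)

lemma C_k_const: "C_k k (\<lambda>x. c)"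
  by (induction k arbitrary: c) auto

lemma C_k_inner: "C_k k (\<lambda>x. x \<bullet> c)"
  by (cases k) (auto intro!: continuous_intros derivative_intros C_k_const)

lemma C_k_add: "C_k k f \<Longrightarrow> C_k k g \<Longrightarrow> C_k k (\<lambda>x. f x + g x)"
proof (induction k arbitrary: f g)
  case (Suc k)
  have "partial b (\<lambda>x. f x + g x) = (\<lambda>x. partial b f x + partial b g x)" for b
    using Suc.prems by (auto simp: partial_add)
  with Suc show ?case by auto
qed (auto intro!: continuous_intros)

lemma C_k_mult: "C_k k f \<Longrightarrow> C_k k g \<Longrightarrow> C_k k (\<lambda>x. f x * g x)"
proof (induction k arbitrary: f g)
  case (Suc k)
  have "partial b (\<lambda>x. f x * g x) = (\<lambda>x. partial b f x * g x + f x * partial b g x)" for b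
    using Suc.prems by (auto simp: partial_mult)
  moreover have "C_k k f" "C_k k g" using Suc.prems C_k_Suc_lower by blast+
  ultimately show ?case using Suc by (auto intro!: C_k_add)
qed (auto intro!: continuous_intros)

lemma C_k_cmult: "C_k k f \<Longrightarrow> C_k k (\<lambda>x. c * f x)"
  by (rule C_k_mult[OF C_k_const])

lemma C_k_diff: "C_k k f \<Longrightarrow> C_k k g \<Longrightarrow> C_k k (\<lambda>x. f x - g x)"
  using C_k_add[OF _ C_k_cmult[of k g "-1"]] by simp

lemma partial_cmult: "f differentiable (at x) \<Longrightarrow> partial b (\<lambda>x. c * f x) x = c * partial b f x"
  by (subst partial_mult) auto

lemma partial_diff:
  "f differentiable (at x) \<Longrightarrow> g differentiable (at x) \<Longrightarrow>
    partial b (\<lambda>x. f x - g x) x = partial b f x - partial b g x"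
  unfolding frechet_derivative_works
  by (subst partial_eqI[OF has_derivative_diff]) (auto simp: partial_def)

lemma partial_affine:
  fixes f :: "'a::euclidean_space \<Rightarrow> real"
  assumes "\<And>x. f differentiable (at x)"
  shows "partial b (\<lambda>x. f (a + c *\<^sub>R x)) x = c * partial b f (a + c *\<^sub>R x)"
    and "(\<lambda>x. f (a + c *\<^sub>R x)) differentiable (at x)"
proof -
  have f: "(f has_derivative frechet_derivative f (at y)) (at y)" for y
    using assms by (simp add: frechet_derivative_works)
  have g: "((\<lambda>x. a + c *\<^sub>R x) has_derivative (\<lambda>h. c *\<^sub>R h)) (at x)"
    by (auto intro!: derivative_eq_intros)
  have h: "((\<lambda>x. f (a + c *\<^sub>R x)) has_derivative
      (\<lambda>h. frechet_derivative f (at (a + c *\<^sub>R x)) (c *\<^sub>R h))) (at x)"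
    using has_derivative_compose[OF g f] .
  show "(\<lambda>x. f (a + c *\<^sub>R x)) differentiable (at x)" using h differentiableI by blast
  show "partial b (\<lambda>x. f (a + c *\<^sub>R x)) x = c * partial b f (a + c *\<^sub>R x)"
    using partial_eqI[OF h, of b] linear_cmul[OF has_derivative_linear[OF f], of _ c b]
    by (simp add: partial_def)
qed

lemma C_k_affine:
  fixes f :: "'a::euclidean_space \<Rightarrow> real"
  shows "C_k k f \<Longrightarrow> C_k k (\<lambda>x. f (a + c *\<^sub>R x))"
proof (induction k arbitrary: f)
  case 0
  then show ?case
    by (auto intro!: continuous_intros elim!: continuous_on_compose2)
next
  case (Suc k)
  have "partial b (\<lambda>x. f (a + c *\<^sub>R x)) = (\<lambda>x. c * partial b f (a + c *\<^sub>R x))" for b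
    using Suc.prems by (auto simp: partial_affine)
  with Suc show ?case by (auto intro!: C_k_cmult partial_affine(2))
qed

lemma has_derivative_zero_open:
  assumes "open S" "x \<in> S" "\<And>y. y \<in> S \<Longrightarrow> f y = 0"
  shows "(f has_derivative (\<lambda>h. 0)) (at x)"
  by (rule has_derivative_transform_within_open[OF has_derivative_const[of 0]])
     (use assms in auto)

lemma partial_zero_open:
  assumes "open S" "x \<in> S" "\<And>y. y \<in> S \<Longrightarrow> f y = 0"
  shows "partial b f x = 0"
  using partial_eqI[OF has_derivative_zero_open[OF assms]] by simp

lemma partial_zero_outside:
  assumes "closed K" "\<And>y. y \<notin> K \<Longrightarrow> f y = 0" "x \<notin> K"
  shows "partial b f x = 0"
  by (rule partial_zero_open[of "-K"]) (use assms in auto)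

lemma C_k_exp: "C_k k (\<lambda>t::real. exp (s * t))"
proof (induction k)
  case (Suc k)
  have d: "((\<lambda>t. exp (s * t)) has_derivative (\<lambda>h. s * exp (s * t) * h)) (at t)" for t
    by (auto intro!: derivative_eq_intros)
  have "partial 1 (\<lambda>t. exp (s * t)) = (\<lambda>t. s * exp (s * t))"
    by (rule ext) (subst partial_eqI[OF d], simp)
  then show ?case using Suc d by (auto intro!: C_k_cmult differentiableI)
qed (auto intro!: continuous_intros)

section \<open>Smooth bump functions\<close>

text \<open>Carrying an arbitrary polynomial in 1/t makes the family closed under differentiation,
  so that smoothness of exp(-1/t), extended by zero, becomes one induction over the order with
  \<open>P\<close> kept free.\<close>

definition flat :: "real poly \<Rightarrow> real \<Rightarrow> real" where
  "flat P t = (if t > 0 then poly P (1 / t) * exp (- (1 / t)) else 0)"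

lemma poly_times_exp_tendsto_0: "((\<lambda>s::real. poly P s * exp (- s)) \<longlongrightarrow> 0) at_top"
proof -
  have "((\<lambda>s::real. \<Sum>i\<le>degree P. coeff P i * (s ^ i / exp s)) \<longlongrightarrow> (\<Sum>i\<le>degree P. coeff P i * 0)) at_top"
    by (intro tendsto_intros tendsto_power_div_exp_0)
  moreover have "(\<Sum>i\<le>degree P. coeff P i * (s ^ i / exp s)) = poly P s * exp (- s)" for s
    by (simp add: poly_altdef sum_distrib_right exp_minus divide_inverse mult.assoc)
  ultimately show ?thesis by simp
qed

text \<open>The polynomial \<open>[:0, 0, 1:]\<close> is X^2: the chain rule applied to P(1/t)
  exp(-1/t) produces the factor 1/t^2 and the polynomial P - P'. Only t = 0 needs an argument, a
  limit of difference quotients from each side.\<close>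

lemma flat_has_derivative:
  "(flat P has_real_derivative flat ([:0, 0, 1:] * (P - pderiv P)) t) (at t)"
proof -
  consider "t > 0" | "t < 0" | "t = 0" by linarith
  then show ?thesis
  proof cases
    case 1
    have "((\<lambda>t. poly P (1 / t) * exp (- (1 / t))) has_real_derivative
            poly (pderiv P) (1 / t) * (- (1 / t\<^sup>2)) * exp (- (1 / t))
            + exp (- (1 / t)) * (1 / t\<^sup>2) * poly P (1 / t)) (at t)"
      using 1 by (auto intro!: derivative_eq_intros DERIV_chain2[OF poly_DERIV]
          simp: power2_eq_square divide_inverse)
    then have "((\<lambda>t. poly P (1 / t) * exp (- (1 / t))) has_real_derivative
            flat ([:0, 0, 1:] * (P - pderiv P)) t) (at t)"
      by (rule has_field_derivative_cong_eventually[THEN iffD1, rotated 2, OF DERIV_cong])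
         (use 1 in \<open>auto simp: flat_def field_simps power2_eq_square\<close>)
    then show ?thesis
      by (rule has_field_derivative_transform_within_open[where S="{0<..}"])
         (use 1 in \<open>auto simp: flat_def\<close>)
  next
    case 2
    have "((\<lambda>t. 0) has_real_derivative 0) (at t)" by simp
    then have "(flat P has_real_derivative 0) (at t)"
      by (rule has_field_derivative_transform_within_open[where S="{..<0}"])
         (use 2 in \<open>auto simp: flat_def\<close>)
    then show ?thesis using 2 by (simp add: flat_def)
  next
    case 3
    \<comment> \<open>Dividing by h multiplies by 1/h, that is, replaces P by X P; the exponential
      still beats this polynomial.\<close>
    have "((\<lambda>h. poly (pCons 0 P) (inverse h) * exp (- inverse h)) \<longlongrightarrow> 0) (at_right 0)"
      by (rule filterlim_compose[OF poly_times_exp_tendsto_0 filterlim_inverse_at_top_right])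
    then have r: "((\<lambda>h. flat P h / h) \<longlongrightarrow> 0) (at_right 0)"
      by (rule Lim_transform_eventually)
         (auto simp: eventually_at_right_field flat_def field_simps intro!: exI[of _ 1])
    have l: "((\<lambda>h. flat P h / h) \<longlongrightarrow> 0) (at_left 0)"
      by (rule Lim_transform_eventually[OF tendsto_const])
         (auto simp: eventually_at_left_field flat_def intro!: exI[of _ "-1"])
    show ?thesis using 3 filterlim_split_at[OF l r] by (simp add: DERIV_def flat_def)
  qed
qed

text \<open>The argument c - |x|^2 in place of c - |x| keeps the function smooth at the origin. For
  c > 0 and \<open>P = 1\<close> it is positive exactly on the open ball of radius sqrt c.\<close>

definition bump :: "real poly \<Rightarrow> real \<Rightarrow> 'a::euclidean_space \<Rightarrow> real" where
  "bump P c x = flat P (c - x \<bullet> x)"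

lemma bump_has_derivative:
  "(bump P c has_derivative
     (\<lambda>h. -2 * (h \<bullet> x) * bump ([:0, 0, 1:] * (P - pderiv P)) c x)) (at x)"
proof -
  have "((\<lambda>x. c - x \<bullet> x) has_derivative (\<lambda>h. - (2 * (h \<bullet> x)))) (at x)"
    by (auto intro!: derivative_eq_intros simp: inner_commute)
  from DERIV_compose_FDERIV[OF flat_has_derivative this]
  show ?thesis unfolding bump_def[abs_def] by (simp add: mult_ac)
qed

lemma C_k_bump: "C_k k (bump P c)"
proof (induction k arbitrary: P)
  case 0
  show ?case
    by (auto intro!: continuous_at_imp_continuous_on has_derivative_continuous[OF bump_has_derivative])
next
  case (Suc k)
  let ?Q = "[:0, 0, 1:] * (P - pderiv P)"
  have "partial b (bump P c) = (\<lambda>x. -2 * ((x \<bullet> b) * bump ?Q c x))" for b :: 'a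
    by (rule ext) (subst partial_eqI[OF bump_has_derivative], simp add: inner_commute)
  moreover have "C_k k (\<lambda>x::'a. -2 * ((x \<bullet> b) * bump ?Q c x))" for b
    by (intro C_k_cmult C_k_mult C_k_inner Suc)
  ultimately show ?case by (metis C_k.simps(2) differentiableI[OF bump_has_derivative])
qed

lemma bump_pos: "x \<bullet> x < c \<Longrightarrow> bump 1 c x > 0"
  by (simp add: bump_def flat_def)

lemma bump_nonneg: "bump 1 c x \<ge> 0"
  by (simp add: bump_def flat_def)

lemma bump_zero: "x \<bullet> x \<ge> c \<Longrightarrow> bump P c x = 0"
  by (simp add: bump_def flat_def)

section \<open>Compact supports\<close>

lemma compact_support_inI:
  assumes "compact K" "K \<subseteq> \<Omega>" "\<And>x. x \<notin> K \<Longrightarrow> f x = 0"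
  shows "compact_support_in \<Omega> f"
proof -
  have "closure {x. f x \<noteq> 0} \<subseteq> K"
    using assms by (intro closure_minimal) (auto intro: compact_imp_closed)
  then show ?thesis
    using assms unfolding compact_support_in_def
    by (meson bounded_subset closed_closure compact_eq_bounded_closed subset_trans)
qed

lemma compact_support_inE:
  assumes "compact_support_in \<Omega> f"
  obtains K where "compact K" "K \<subseteq> \<Omega>" "\<And>x. x \<notin> K \<Longrightarrow> f x = 0"
  using assms closure_subset[of "{x. f x \<noteq> 0}"] unfolding compact_support_in_def by blast

lemma C0I:
  assumes "C_k k f" "compact K" "K \<subseteq> \<Omega>" "\<And>x. x \<notin> K \<Longrightarrow> f x = 0"
  shows "f \<in> C0 k \<Omega>"
  using assms by (auto simp: C0_def intro: compact_support_inI)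

lemma C0E:
  assumes "f \<in> C0 k \<Omega>"
  obtains K where "C_k k f" "compact K" "K \<subseteq> \<Omega>" "\<And>x. x \<notin> K \<Longrightarrow> f x = 0"
  using assms unfolding C0_def mem_Collect_eq by (meson compact_support_inE)

lemma C0_infinityI:
  assumes "\<And>k. C_k k f" "compact K" "K \<subseteq> \<Omega>" "\<And>x. x \<notin> K \<Longrightarrow> f x = 0"
  shows "f \<in> C0_infinity \<Omega>"
  using assms by (auto simp: C0_infinity_def intro: C0I)

lemma C0_infinity_partial:
  assumes "f \<in> C0_infinity \<Omega>" "b \<in> Basis"
  shows "partial b f \<in> C0_infinity \<Omega>"
proof -
  have k: "C_k k f" for k using assms unfolding C0_infinity_def C0_def by auto
  have "f \<in> C0 0 \<Omega>" using assms unfolding C0_infinity_def by blast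
  then obtain K where K: "compact K" "K \<subseteq> \<Omega>" "\<And>x. x \<notin> K \<Longrightarrow> f x = 0"
    by (rule C0E) blast
  show ?thesis
  proof (rule C0_infinityI[OF _ K(1,2)])
    show "C_k k (partial b f)" for k using k[of "Suc k"] assms by auto
    show "partial b f x = 0" if "x \<notin> K" for x
      using partial_zero_outside[OF compact_imp_closed[OF K(1)] K(3) that] by auto
  qed
qed

section \<open>Powers of the norm and radial cut-offs\<close>

lemma norm_powr_has_derivative:
  fixes x :: "'a::euclidean_space"
  assumes "x \<noteq> 0"
  shows "((\<lambda>x. norm x powr t) has_derivative (\<lambda>h. t * (h \<bullet> x) * norm x powr (t - 2))) (at x)"
proof -
  have "((\<lambda>x. norm x powr t) has_derivative (\<lambda>h. t * norm x powr (t - 1) * (h \<bullet> sgn x))) (at x)"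
    using assms
    using DERIV_compose_FDERIV[OF has_real_derivative_powr has_derivative_norm, of x t] by (simp add: mult_ac)
  moreover have "t * norm x powr (t - 1) * (h \<bullet> sgn x) = t * (h \<bullet> x) * norm x powr (t - 2)" for h
  proof -
    have "norm x powr (t - 1) / norm x = norm x powr (t - 2)"
      using assms powr_diff[of "norm x" "t-1" 1] by simp
    then show ?thesis by (simp add: sgn_div_norm divide_inverse mult_ac)
  qed
  ultimately show ?thesis by simp
qed

text \<open>The power of the norm is singular only at the origin, and the closed set
  \<open>K\<close> keeps the support of \<open>f\<close> away from it, so the product rule survives
  there trivially.\<close>

lemma mult_norm_powr_has_derivative:
  fixes f :: "'a::euclidean_space \<Rightarrow> real"
  assumes "f differentiable (at x)" "closed K" "0 \<notin> K" "\<And>x. x \<notin> K \<Longrightarrow> f x = 0"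
  shows "((\<lambda>x. f x * norm x powr t) has_derivative
     (\<lambda>h. frechet_derivative f (at x) h * norm x powr t + t * (h \<bullet> x) * f x * norm x powr (t - 2))) (at x)"
\<comment> \<open>In HOL \<open>0 powr t\<close> is 0 for every \<open>t\<close>, so at the origin
  the claimed derivative is the zero map, as it should be for a function vanishing nearby.\<close>
proof (cases "x = 0")
  case True
  have z: "f y * norm y powr t = 0" if "y \<in> -K" for y using assms(4) that by auto
  have "((\<lambda>x. f x * norm x powr t) has_derivative (\<lambda>h. 0)) (at x)"
    by (rule has_derivative_zero_open[of "-K"]) (use assms z True in auto)
  then show ?thesis using True by simp
next
  case False
  from assms have "(f has_derivative frechet_derivative f (at x)) (at x)"
    by (simp add: frechet_derivative_works)
  from has_derivative_mult[OF this norm_powr_has_derivative[OF False, of t]]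
  show ?thesis by (simp add: add.commute mult_ac)
qed

lemma partial_mult_norm_powr:
  fixes f :: "'a::euclidean_space \<Rightarrow> real"
  assumes "f differentiable (at x)" "closed K" "0 \<notin> K" "\<And>x. x \<notin> K \<Longrightarrow> f x = 0"
  shows "partial b (\<lambda>x. f x * norm x powr t) x =
     partial b f x * norm x powr t + t * ((x \<bullet> b) * f x * norm x powr (t - 2))"
  using partial_eqI[OF mult_norm_powr_has_derivative[OF assms], of b t]
  by (simp add: partial_def inner_commute mult_ac)

text \<open>Differentiation leaves two products of the same kind, one with a partial derivative of
  \<open>f\<close>, one with x_b f and exponent t - 2; hence the induction over all \<open>f\<close>
  and \<open>t\<close> at once.\<close>

lemma C_k_mult_norm_powr:
  fixes f :: "'a::euclidean_space \<Rightarrow> real"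
  assumes "C_k k f" "closed K" "0 \<notin> K" "\<And>x. x \<notin> K \<Longrightarrow> f x = 0"
  shows "C_k k (\<lambda>x. f x * norm x powr t)"
  using assms(1,4)
proof (induction k arbitrary: f t)
  case 0
  have "continuous_on (-{0}) (\<lambda>x. f x * norm x powr t)"
    using 0 by (auto intro!: continuous_intros elim: continuous_on_subset)
  moreover have "continuous_on (-K) (\<lambda>x. f x * norm x powr t)"
    using 0 by (intro continuous_on_eq[OF continuous_on_const[of _ 0]]) auto
  ultimately have "continuous_on (-{0} \<union> -K) (\<lambda>x. f x * norm x powr t)"
    using assms by (intro continuous_on_open_Un) auto
  moreover have "-{0} \<union> -K = UNIV" using assms by auto
  ultimately show ?case by simp
next
  case (Suc k)
  have "partial b (\<lambda>x. f x * norm x powr t) = (\<lambda>x. partial b f x * norm x powr t +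
          t * (((x \<bullet> b) * f x) * norm x powr (t - 2)))" for b
    using partial_mult_norm_powr[OF _ assms(2,3)] Suc.prems by (intro ext) auto
  moreover have "C_k k (\<lambda>x. partial b f x * norm x powr t)" if "b \<in> Basis" for b
    using Suc.prems that partial_zero_outside[OF assms(2)] by (intro Suc.IH) auto
  moreover have "C_k k (\<lambda>x. ((x \<bullet> b) * f x) * norm x powr (t - 2))" for b
    using Suc.prems C_k_Suc_lower[OF Suc.prems(1)] by (intro Suc.IH C_k_mult C_k_inner) auto
  moreover have "(\<lambda>x. f x * norm x powr t) differentiable (at x)" for x
    by (rule differentiableI, rule mult_norm_powr_has_derivative[of f x K t])
       (use assms(2,3) Suc.prems in auto)
  ultimately show ?case by (simp add: C_k_add C_k_cmult)
qed

text \<open>In the variable ln |x| a dilation of space by e^a becomes the translation by a; the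
  polar formula for homogeneous functions rests on this. The origin is assigned 0 so that the
  arbitrary value \<open>ln 0\<close> never enters.\<close>

definition rad :: "(real \<Rightarrow> real) \<Rightarrow> 'a::euclidean_space \<Rightarrow> real" where
  "rad \<Phi> x = (if x = 0 then 0 else \<Phi> (ln (norm x)))"

definition annulus :: "real \<Rightarrow> 'a::euclidean_space set" where
  "annulus M = {x. exp (- M) \<le> norm x \<and> norm x \<le> exp M}"

lemma compact_annulus: "compact (annulus M)"
proof -
  have "closed (annulus M :: 'a set)"
    unfolding annulus_def by (intro closed_Collect_conj closed_Collect_le continuous_intros)
  moreover have "bounded (annulus M :: 'a set)"
    unfolding annulus_def by (auto intro: boundedI)
  ultimately show ?thesis by (simp add: compact_eq_bounded_closed)
qed

lemma zero_notin_annulus: "0 \<notin> annulus M" "annulus M \<subseteq> -{0}"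
  by (auto simp: annulus_def not_le)

lemma annulus_iff: "x \<in> annulus M \<longleftrightarrow> x \<noteq> 0 \<and> \<bar>ln (norm x)\<bar> \<le> M"
proof (cases "x = 0")
  case False
  then have "exp (- M) \<le> norm x \<longleftrightarrow> - M \<le> ln (norm x)" "norm x \<le> exp M \<longleftrightarrow> ln (norm x) \<le> M"
    using exp_le_cancel_iff[of "- M" "ln (norm x)"] exp_le_cancel_iff[of "ln (norm x)" M] by simp_all
  then show ?thesis using False by (auto simp: annulus_def)
qed (simp add: zero_notin_annulus)

lemma rad_outside: "(\<And>\<tau>. \<bar>\<tau>\<bar> > M \<Longrightarrow> \<Phi> \<tau> = 0) \<Longrightarrow> x \<notin> annulus M \<Longrightarrow> rad \<Phi> x = 0"
  by (auto simp: rad_def annulus_iff)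

text \<open>The gradient of \<Phi>(ln |x|) is \<Phi>'(ln |x|) x / |x|^2. Writing |x|^(-2) as
  \<open>exp (-2 * \<tau>)\<close> keeps the radial factor in the form \<open>rad\<close>, so the
  computation can be iterated.\<close>

lemma rad_has_derivative:
  fixes x :: "'a::euclidean_space"
  assumes "\<And>\<tau>. \<Phi> differentiable (at \<tau>)" "\<And>\<tau>. \<bar>\<tau>\<bar> > M \<Longrightarrow> \<Phi> \<tau> = 0"
  shows "(rad \<Phi> has_derivative (\<lambda>h. (h \<bullet> x) * rad (\<lambda>\<tau>. exp (-2 * \<tau>) * partial 1 \<Phi> \<tau>) x)) (at x)"
proof (cases "x = 0")
  case True
  have "(rad \<Phi> has_derivative (\<lambda>h. 0)) (at x)"
    by (rule has_derivative_zero_open[of "-annulus M"])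
       (use True rad_outside[of M \<Phi>] assms(2) zero_notin_annulus in
         \<open>auto simp: open_Compl compact_imp_closed compact_annulus\<close>)
  then show ?thesis using True by (simp add: rad_def)
next
  case False
  have n: "(norm has_derivative (\<lambda>h. h \<bullet> sgn x)) (at x)"
    using has_derivative_norm[OF False] .
  have "(ln has_real_derivative inverse (norm x)) (at (norm x))"
    using False by (intro DERIV_ln) auto
  from DERIV_compose_FDERIV[OF this n]
  have "((\<lambda>x. ln (norm x)) has_derivative (\<lambda>h. (h \<bullet> sgn x) * inverse (norm x))) (at x)"
    by (simp add: mult.commute)
  from DERIV_compose_FDERIV[OF has_field_derivative_partial[OF assms(1)] this]
  have "((\<lambda>x. \<Phi> (ln (norm x))) has_derivative
     (\<lambda>h. ((h \<bullet> sgn x) * inverse (norm x)) * partial 1 \<Phi> (ln (norm x)))) (at x)"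
    .
  moreover have "((h \<bullet> sgn x) * inverse (norm x)) = (h \<bullet> x) * exp (-2 * ln (norm x))" for h
  proof -
    have "exp (2 * ln (norm x)) = (norm x)\<^sup>2"
      using False by (metis exp_double exp_ln zero_less_norm_iff)
    then show ?thesis
      using False by (simp add: exp_minus sgn_div_norm power2_eq_square divide_inverse)
  qed
  ultimately have "((\<lambda>x. \<Phi> (ln (norm x))) has_derivative
     (\<lambda>h. (h \<bullet> x) * rad (\<lambda>\<tau>. exp (-2 * \<tau>) * partial 1 \<Phi> \<tau>) x)) (at x)"
    using False by (simp only: rad_def if_False mult.assoc)
  then show ?thesis
    by (rule has_derivative_transform_within_open[where s="-{0}"]) (use False in \<open>auto simp: rad_def\<close>)
qed

lemma partial_vanish:
  assumes "\<And>\<tau>::real. \<bar>\<tau>\<bar> > M \<Longrightarrow> \<Phi> \<tau> = 0" "\<bar>\<tau>\<bar> > M"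
  shows "partial b \<Phi> \<tau> = 0"
  by (rule partial_zero_outside[of "{-M..M}"]) (use assms in auto)

lemma partial_rad:
  assumes "\<And>\<tau>. \<Phi> differentiable (at \<tau>)" "\<And>\<tau>. \<bar>\<tau>\<bar> > M \<Longrightarrow> \<Phi> \<tau> = 0"
  shows "partial b (rad \<Phi>) = (\<lambda>x. (x \<bullet> b) * rad (\<lambda>\<tau>. exp (-2 * \<tau>) * partial 1 \<Phi> \<tau>) x)"
  by (rule ext) (subst partial_eqI[OF rad_has_derivative[OF assms]], auto simp: inner_commute)

text \<open>Smoothness of every order and the vanishing beyond \<open>M\<close> pass unchanged from
  \<open>\<Phi>\<close> to the radial factor of its gradient, which closes the induction.\<close>

lemma C_k_rad:
  assumes "\<And>k. C_k k \<Phi>" "\<And>\<tau>. \<bar>\<tau>\<bar> > M \<Longrightarrow> \<Phi> \<tau> = 0"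
  shows "C_k k (rad \<Phi>)"
  using assms
proof (induction k arbitrary: \<Phi>)
  case 0
  have "\<Phi> differentiable (at \<tau>)" for \<tau> using 0(1)[of 1] by simp
  from rad_has_derivative[OF this 0(2)] show ?case
    by (auto intro!: continuous_at_imp_continuous_on has_derivative_continuous)
next
  case (Suc k)
  have d: "\<Phi> differentiable (at \<tau>)" for \<tau> using Suc(2)[of 1] by simp
  let ?\<Psi> = "\<lambda>\<tau>. exp (-2 * \<tau>) * partial 1 \<Phi> \<tau>"
  have "C_k j (partial 1 \<Phi>)" for j using Suc.prems(1)[of "Suc j"] by simp
  then have "C_k j ?\<Psi>" for j by (intro C_k_mult C_k_exp)
  moreover have "?\<Psi> \<tau> = 0" if "\<bar>\<tau>\<bar> > M" for \<tau>
    using partial_vanish[OF Suc.prems(2) that] by simp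
  ultimately have "C_k k (rad ?\<Psi> :: 'a \<Rightarrow> real)" by (rule Suc.IH)
  moreover have "(rad \<Phi> :: 'a \<Rightarrow> real) differentiable (at x)" for x
    using rad_has_derivative[OF d Suc.prems(2)] by (rule differentiableI)
  ultimately show ?case
    by (simp add: partial_rad[OF d Suc.prems(2)] C_k_mult C_k_inner)
qed

section \<open>Lebesgue integrals\<close>

lemma continuous_measurable_lebesgue:
  fixes f :: "'a::euclidean_space \<Rightarrow> real"
  assumes "continuous_on UNIV f" shows "f \<in> borel_measurable lebesgue"
  using borel_measurable_continuous_onI[OF assms] by (simp add: measurable_completion)

lemma compact_integrable_indicator:
  "compact K \<Longrightarrow> integrable lebesgue (indicat_real (K :: 'a::euclidean_space set))"
  using lmeasurable_compact[of K] by (simp add: lmeasurable_iff_integrable)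

lemma integrable_continuous_compact:
  fixes f :: "'a::euclidean_space \<Rightarrow> real"
  assumes "continuous_on UNIV f" "compact K" "\<And>x. x \<notin> K \<Longrightarrow> f x = 0"
  shows "integrable lebesgue f"
proof -
  have "integrable lborel (\<lambda>x. indicator K x *\<^sub>R f x)"
    using assms by (intro borel_integrable_compact) (auto elim: continuous_on_subset)
  moreover have "(\<lambda>x. indicator K x *\<^sub>R f x) = f" using assms(3) by (auto simp: indicator_def fun_eq_iff)
  ultimately have "integrable lborel f" by simp
  then show ?thesis
    using borel_measurable_integrable[of lborel f] by (simp add: integrable_completion)
qed

lemma continuous_compact_bounded:
  fixes f :: "'a::euclidean_space \<Rightarrow> real"
  assumes "continuous_on K f" "compact K" "\<And>x. x \<notin> K \<Longrightarrow> f x = 0"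
  obtains B where "B > 0" "\<And>x. \<bar>f x\<bar> \<le> B"
proof -
  have "bounded (f ` K)" using assms by (intro compact_imp_bounded compact_continuous_image)
  then obtain B where B: "B > 0" "\<And>y. y \<in> f ` K \<Longrightarrow> norm y \<le> B" unfolding bounded_pos by auto
  have "\<bar>f x\<bar> \<le> B" for x using B assms(3)[of x] by (cases "x \<in> K") auto
  with B(1) show thesis by (rule that)
qed

lemma integrable_bounded_mult:
  fixes f g :: "'a \<Rightarrow> real"
  assumes f: "integrable M f" and g: "g \<in> borel_measurable M" "\<And>x. \<bar>g x\<bar> \<le> B"
  shows "integrable M (\<lambda>x. f x * g x)"
proof (rule Bochner_Integration.integrable_bound[of M "\<lambda>x. B * f x"])
  have "\<bar>f x\<bar> * \<bar>g x\<bar> \<le> \<bar>B\<bar> * \<bar>f x\<bar>" for x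
    using g(2)[of x] by (subst mult.commute[of "\<bar>B\<bar>"], intro mult_left_mono) auto
  then show "AE x in M. norm (f x * g x) \<le> norm (B * f x)"
    by (simp add: abs_mult)
qed (use f g in auto)

lemma integrable_L1_loc_mult:
  fixes f \<phi> :: "'a::euclidean_space \<Rightarrow> real"
  assumes f: "f \<in> L1_loc \<Omega>" and K: "compact K" "K \<subseteq> \<Omega>"
    and \<phi>: "continuous_on K \<phi>" "\<And>x. x \<notin> K \<Longrightarrow> \<phi> x = 0"
  shows "integrable lebesgue (\<lambda>x. f x * \<phi> x)"
proof -
  obtain B where B: "B > 0" "\<And>x. \<bar>\<phi> x\<bar> \<le> B"
    using continuous_compact_bounded[OF \<phi>(1) K(1) \<phi>(2)] by blast
  have "integrable lebesgue (\<lambda>x. indicator K x *\<^sub>R f x)"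
    using f K unfolding L1_loc_def set_integrable_def by blast
  moreover have "(\<lambda>x. indicator K x *\<^sub>R \<phi> x) \<in> borel_measurable borel"
    using \<phi>(1) K(1) borel_measurable_continuous_on_indicator[of K \<phi>] by (simp add: compact_imp_closed borel_closed)
  then have "\<phi> \<in> borel_measurable borel"
    by (rule measurable_cong[THEN iffD1, rotated]) (use \<phi>(2) in \<open>auto simp: indicator_def\<close>)
  then have "\<phi> \<in> borel_measurable lebesgue" by (simp add: measurable_completion)
  ultimately have "integrable lebesgue (\<lambda>x. (indicator K x *\<^sub>R f x) * \<phi> x)"
    using B by (intro integrable_bounded_mult) auto
  moreover have "(\<lambda>x. (indicator K x *\<^sub>R f x) * \<phi> x) = (\<lambda>x. f x * \<phi> x)"
    using \<phi>(2) by (auto simp: indicator_def fun_eq_iff)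
  ultimately show ?thesis by simp
qed

lemma lebesgue_scale_measurable: "c \<noteq> 0 \<Longrightarrow> (\<lambda>x::'a::euclidean_space. t + c *\<^sub>R x) \<in> lebesgue \<rightarrow>\<^sub>M lebesgue"
  using lebesgue_affine_measurable[of "\<lambda>_. c" t]
  unfolding scaleR_scaleR[symmetric] scaleR_sum_right[symmetric] euclidean_representation by simp

lemma lebesgue_scale:
  "c \<noteq> 0 \<Longrightarrow> (lebesgue :: 'a::euclidean_space measure) =
     density (distr lebesgue lebesgue (\<lambda>x. t + c *\<^sub>R x)) (\<lambda>_. \<bar>c\<bar> ^ DIM('a))"
  using lebesgue_affine_euclidean[of "\<lambda>_. c" t]
  unfolding scaleR_scaleR[symmetric] scaleR_sum_right[symmetric] euclidean_representation prod_constant by simp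

lemma lebesgue_integral_affine:
  fixes f :: "'a::euclidean_space \<Rightarrow> real"
  assumes c: "c \<noteq> 0" and f: "f \<in> borel_measurable lebesgue"
  shows "integral\<^sup>L lebesgue f = \<bar>c\<bar> ^ DIM('a) * (\<integral>x. f (t + c *\<^sub>R x) \<partial>lebesgue)"
    and "integrable lebesgue (\<lambda>x. f (t + c *\<^sub>R x)) \<longleftrightarrow> integrable lebesgue f"
proof -
  note m [measurable] = lebesgue_scale_measurable[OF c, of t]
  note [measurable] = f
  have fm: "f \<in> borel_measurable (distr lebesgue lebesgue (\<lambda>x. t + c *\<^sub>R x))" by simp
  have "integral\<^sup>L lebesgue f = (\<integral>x. f x \<partial>density (distr lebesgue lebesgue (\<lambda>x. t + c *\<^sub>R x)) (\<lambda>_. \<bar>c\<bar> ^ DIM('a)))"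
    using lebesgue_scale[OF c, of t] by simp
  also have "\<dots> = (\<integral>x. \<bar>c\<bar> ^ DIM('a) *\<^sub>R f x \<partial>distr lebesgue lebesgue (\<lambda>x. t + c *\<^sub>R x))"
    using fm by (intro integral_density) auto
  also have "\<dots> = (\<integral>x. \<bar>c\<bar> ^ DIM('a) *\<^sub>R f (t + c *\<^sub>R x) \<partial>lebesgue)"
    by (intro integral_distr) auto
  finally show "integral\<^sup>L lebesgue f = \<bar>c\<bar> ^ DIM('a) * (\<integral>x. f (t + c *\<^sub>R x) \<partial>lebesgue)" by simp
  have "integrable lebesgue f \<longleftrightarrow> integrable (density (distr lebesgue lebesgue (\<lambda>x. t + c *\<^sub>R x)) (\<lambda>_. \<bar>c\<bar> ^ DIM('a))) f"
    using lebesgue_scale[OF c, of t] by simp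
  also have "\<dots> \<longleftrightarrow> integrable (distr lebesgue lebesgue (\<lambda>x. t + c *\<^sub>R x)) (\<lambda>x. \<bar>c\<bar> ^ DIM('a) *\<^sub>R f x)"
    using fm by (intro integrable_density) auto
  also have "\<dots> \<longleftrightarrow> integrable lebesgue (\<lambda>x. \<bar>c\<bar> ^ DIM('a) *\<^sub>R f (t + c *\<^sub>R x))"
    by (intro integrable_distr_eq) auto
  finally show "integrable lebesgue (\<lambda>x. f (t + c *\<^sub>R x)) \<longleftrightarrow> integrable lebesgue f"
    using c by simp
qed

lemma sigma_finite_lebesgue: "sigma_finite_measure lebesgue"
proof
  obtain A :: "'a set set" where A: "countable A" "A \<subseteq> sets lborel" "\<Union>A = space lborel"
    "\<forall>a\<in>A. emeasure lborel a \<noteq> \<infinity>"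
    using sigma_finite_measure.sigma_finite_countable[OF sigma_finite_lborel] by blast
  then show "\<exists>A. countable A \<and> A \<subseteq> sets lebesgue \<and> \<Union> A = space lebesgue \<and>
      (\<forall>a\<in>A. emeasure (lebesgue :: 'a measure) a \<noteq> \<infinity>)"
    by (intro exI[of _ A]) (auto simp: subset_iff)
qed

interpretation lebesgue: sigma_finite_measure "lebesgue :: 'a::euclidean_space measure"
  by (rule sigma_finite_lebesgue)

interpretation lebesgue_pair: pair_sigma_finite "lebesgue :: 'a::euclidean_space measure"
    "lebesgue :: 'b::euclidean_space measure"
  ..

lemma set_integral_minus_zero:
  fixes g :: "'a::euclidean_space \<Rightarrow> real"
  assumes "g 0 = 0"
  shows "(LINT x:-{0}|lebesgue. g x) = integral\<^sup>L lebesgue g"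
  unfolding set_lebesgue_integral_def
  by (rule Bochner_Integration.integral_cong) (use assms in \<open>auto simp: indicator_def\<close>)

section \<open>Integration by parts\<close>

text \<open>The uniform constant \<open>L\<close> supplies the dominating functions whenever
  difference quotients of test functions are integrated below.\<close>

lemma C_k_1_Lipschitz:
  fixes g :: "'a::euclidean_space \<Rightarrow> real"
  assumes g: "C_k 1 g" and K: "compact K" "\<And>x. x \<notin> K \<Longrightarrow> g x = 0"
  obtains L where "L > 0" "\<And>x y. \<bar>g x - g y\<bar> \<le> L * norm (x - y)"
    "\<And>x b. b \<in> Basis \<Longrightarrow> \<bar>partial b g x\<bar> \<le> L"
proof -
  have d: "g differentiable (at x)" for x using g by simp
  have "\<exists>B>0. \<forall>x. \<bar>partial b g x\<bar> \<le> B" if "b \<in> Basis" for b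
  proof -
    have "continuous_on K (partial b g)" using g that continuous_on_subset[of UNIV] by auto
    moreover have "partial b g x = 0" if "x \<notin> K" for x
      using partial_zero_outside[OF compact_imp_closed[OF K(1)] K(2) that] by simp
    ultimately show ?thesis using continuous_compact_bounded[of K "partial b g"] K(1) by blast
  qed
  then obtain B where B: "\<And>b. b \<in> Basis \<Longrightarrow> B b > 0" "\<And>b x. b \<in> Basis \<Longrightarrow> \<bar>partial b g x\<bar> \<le> B b"
    by metis
  define L where "L = (\<Sum>b\<in>(Basis::'a set). B b)"
  have BL: "B b \<le> L" if "b \<in> Basis" for b
    unfolding L_def using B(1) that by (intro member_le_sum) (auto simp: less_imp_le)
  have L: "L > 0" unfolding L_def using B(1) by (intro sum_pos) auto
  have on: "onorm (\<lambda>h. \<Sum>b\<in>Basis. (h \<bullet> b) * partial b g x) \<le> L" for x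
  proof (rule onorm_le)
    fix h :: 'a
    have "\<bar>\<Sum>b\<in>Basis. (h \<bullet> b) * partial b g x\<bar> \<le> (\<Sum>b\<in>Basis. norm h * B b)"
    proof (rule order_trans[OF sum_abs], rule sum_mono)
      fix b :: 'a assume "b \<in> Basis"
      then show "\<bar>(h \<bullet> b) * partial b g x\<bar> \<le> norm h * B b"
        unfolding abs_mult using B Basis_le_norm by (intro mult_mono) auto
    qed
    then show "norm (\<Sum>b\<in>Basis. (h \<bullet> b) * partial b g x) \<le> L * norm h"
      by (simp add: L_def sum_distrib_left mult.commute)
  qed
  have "\<bar>g x - g y\<bar> \<le> L * norm (x - y)" for x y
    using differentiable_bound[of UNIV g "\<lambda>x h. \<Sum>b\<in>Basis. (h \<bullet> b) * partial b g x" L x y]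
      has_derivative_partial[OF d] on by (simp add: has_derivative_at_withinI)
  moreover have "\<bar>partial b g x\<bar> \<le> L" if "b \<in> Basis" for b x
    using B(2)[OF that, of x] BL[OF that] by simp
  ultimately show thesis using L that by blast
qed

text \<open>By translation invariance every difference quotient of \<open>g\<close> has integral
  zero, and dominated convergence carries this over to the derivative.\<close>

lemma integral_partial_eq_0:
  fixes g :: "'a::euclidean_space \<Rightarrow> real"
  assumes g: "C_k 1 g" and K: "compact K" "\<And>x. x \<notin> K \<Longrightarrow> g x = 0" and b: "b \<in> Basis"
  shows "(\<integral>x. partial b g x \<partial>lebesgue) = 0"
proof -
  obtain L where L: "L > 0" "\<And>x y. \<bar>g x - g y\<bar> \<le> L * norm (x - y)"
    using C_k_1_Lipschitz[OF g K] by metis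
  \<comment> \<open>The increments 1 / (n + 1) are at most 1, so the closed unit neighbourhood of
    \<open>K\<close> contains the supports of all difference quotients.\<close>
  define K' where "K' = {x + y |x y. x \<in> K \<and> y \<in> cball (0::'a) 1}"
  have K': "compact K'" unfolding K'_def by (intro compact_sums K compact_cball)
  have cont: "continuous_on UNIV g" using g C_k_continuous by blast
  have int: "integrable lebesgue g" using integrable_continuous_compact[OF cont K] .
  define s where "s n x = (g (x + (1 / real (Suc n)) *\<^sub>R b) - g x) * real (Suc n)" for n x
  have meas: "(\<lambda>x. g (x + c)) \<in> borel_measurable lebesgue" for c
    by (intro continuous_measurable_lebesgue continuous_on_compose2[OF cont] continuous_intros) auto
  have tr: "integrable lebesgue (\<lambda>x. g (x + c))" "(\<integral>x. g (x + c) \<partial>lebesgue) = integral\<^sup>L lebesgue g" for c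
    using lebesgue_integral_affine[of 1 g c] int continuous_measurable_lebesgue[OF cont]
    by (simp_all add: add.commute)
  have "(\<integral>x. s n x \<partial>lebesgue) = 0" for n
    unfolding s_def using tr int by simp
  moreover have "(\<lambda>n. \<integral>x. s n x \<partial>lebesgue) \<longlonglongrightarrow> (\<integral>x. partial b g x \<partial>lebesgue)"
  proof (rule integral_dominated_convergence[where w = "\<lambda>x. L * indicator K' x"])
    show "partial b g \<in> borel_measurable lebesgue"
      using g b by (intro continuous_measurable_lebesgue) auto
    show "s n \<in> borel_measurable lebesgue" for n
      unfolding s_def using meas[of 0] meas by (intro borel_measurable_times borel_measurable_diff) auto
    show "integrable lebesgue (\<lambda>x. L * indicator K' x)"
      using compact_integrable_indicator[OF K'] by simp
    show "AE x in lebesgue. (\<lambda>n. s n x) \<longlonglongrightarrow> partial b g x"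
    proof (rule AE_I2)
      fix x
      have der: "((\<lambda>t. g (x + t *\<^sub>R b)) has_real_derivative partial b g x) (at 0)"
      proof -
        have 1: "(g has_derivative frechet_derivative g (at x)) (at (x + 0 *\<^sub>R b))"
          using g by (simp add: frechet_derivative_works)
        have 2: "((\<lambda>t. x + t *\<^sub>R b) has_derivative (\<lambda>t. t *\<^sub>R b)) (at 0)"
          by (auto intro!: derivative_eq_intros)
        show ?thesis
          using has_derivative_compose[OF 2 1] linear_cmul[OF has_derivative_linear[OF 1]]
          by (intro has_derivative_imp_has_field_derivative) (auto simp: partial_def)
      qed
      then have "((\<lambda>t. (g (x + t *\<^sub>R b) - g x) / t) \<longlongrightarrow> partial b g x) (at 0)"
        by (simp add: DERIV_def)
      moreover have "filterlim (\<lambda>n. 1 / real (Suc n)) (at 0) sequentially"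
        using LIMSEQ_inverse_real_of_nat by (auto simp: filterlim_at inverse_eq_divide)
      ultimately have "(\<lambda>n. (g (x + (1 / real (Suc n)) *\<^sub>R b) - g x) / (1 / real (Suc n))) \<longlonglongrightarrow> partial b g x"
        by (rule filterlim_compose)
      then show "(\<lambda>n. s n x) \<longlonglongrightarrow> partial b g x" by (simp add: s_def)
    qed
    show "AE x in lebesgue. norm (s n x) \<le> L * indicator K' x" for n
    proof (rule AE_I2)
      fix x
      let ?d = "(1 / real (Suc n)) *\<^sub>R b"
      have nd: "norm ?d = 1 / real (Suc n)" using b by simp
      show "norm (s n x) \<le> L * indicator K' x"
      proof (cases "x \<in> K'")
        case True
        have "\<bar>g (x + ?d) - g x\<bar> \<le> L * (1 / real (Suc n))" using L(2)[of "x + ?d" x] nd by simp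
        then have "\<bar>g (x + ?d) - g x\<bar> * real (Suc n) \<le> L" by (simp add: field_simps)
        then show ?thesis using True by (simp add: s_def abs_mult)
      next
        case False
        have "x \<notin> K"
          using False by (auto simp: K'_def intro: exI[of _ x] exI[of _ "0::'a"])
        moreover have "x + ?d \<notin> K"
        proof
          assume "x + ?d \<in> K"
          moreover have "- ?d \<in> cball 0 1" using nd by simp
          moreover have "x = (x + ?d) + - ?d" by simp
          ultimately have "x \<in> K'" unfolding K'_def by blast
          then show False using False by simp
        qed
        ultimately show ?thesis using K(2) L(1) by (simp add: s_def)
      qed
    qed
  qed
  ultimately show ?thesis by (simp add: LIMSEQ_const_iff)
qed

lemma C0_2_laplacian:
  assumes "\<zeta> \<in> C0 2 \<Omega>"
  shows "continuous_on UNIV \<zeta>" and "continuous_on UNIV (laplacian \<zeta>)"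
    and "\<And>K x. closed K \<Longrightarrow> (\<And>x. x \<notin> K \<Longrightarrow> \<zeta> x = 0) \<Longrightarrow> x \<notin> K \<Longrightarrow> laplacian \<zeta> x = 0"
proof -
  have k: "C_k (Suc (Suc 0)) \<zeta>" using assms by (simp add: C0_def numeral_2_eq_2)
  show "continuous_on UNIV \<zeta>" using C_k_continuous[OF k] .
  have "continuous_on UNIV (partial b (partial b \<zeta>))" if "b \<in> Basis" for b
    using C_k_0D[OF C_k_SucD(2)[OF C_k_SucD(2)[OF k that] that]] .
  then show "continuous_on UNIV (laplacian \<zeta>)"
    unfolding laplacian_def[abs_def] by (intro continuous_on_sum) auto
  show "laplacian \<zeta> x = 0" if "closed K" "\<And>x. x \<notin> K \<Longrightarrow> \<zeta> x = 0" "x \<notin> K" for K x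
    unfolding laplacian_def
    using that by (intro sum.neutral ballI partial_zero_outside[of K]) (auto intro: partial_zero_outside[of K])
qed

text \<open>Integrate the divergence of \<open>|x|\<^sup>t \<zeta> \<nabla>\<zeta> + c |x|\<^sup>t\<^sup>-\<^sup>2 \<zeta>\<^sup>2 x\<close> with \<open>t = - 2 - \<beta>\<close>; the constant \<open>c\<close> is
  the one for which bounding \<open>|\<nabla>\<zeta>|\<close> from below by the radial derivative completes the square
  \<open>(x \<cdot> \<nabla>\<zeta> + \<sigma> \<zeta>)\<^sup>2\<close>.\<close>

lemma weighted_laplacian_inequality:
  fixes \<zeta> :: "'a::euclidean_space \<Rightarrow> real"
  assumes \<zeta>: "\<zeta> \<in> C0 2 (-{0})" and \<sigma>: "\<sigma> = (real DIM('a) - 4 - \<beta>) / 2"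
  shows "\<sigma> * (\<sigma> + 2 + \<beta>) * (\<integral>x. (\<zeta> x)\<^sup>2 * norm x powr (-4 - \<beta>) \<partial>lebesgue)
    \<le> - (\<integral>x. \<zeta> x * laplacian \<zeta> x * norm x powr (-2 - \<beta>) \<partial>lebesgue)"
proof -
  obtain K where k: "C_k 2 \<zeta>" and K: "compact K" "K \<subseteq> -{0}" "\<And>x. x \<notin> K \<Longrightarrow> \<zeta> x = 0"
    using \<zeta> by (rule C0E) blast
  have cK: "closed K" and zK: "0 \<notin> K" using K by (auto intro: compact_imp_closed)
  define t where "t = -2 - \<beta>"
  define c where "c = \<sigma> + 1 + \<beta> / 2"
  have k2: "C_k (Suc 1) \<zeta>" using k by (simp add: numeral_2_eq_2)
  have kp: "C_k 1 (partial b \<zeta>)" if "b \<in> Basis" for b using C_k_SucD(2)[OF k2 that] .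
  have k1: "C_k 1 \<zeta>" using C_k_Suc_lower[OF k2] .
  have d: "\<zeta> differentiable (at x)" for x using k1 by simp
  have dp: "partial b \<zeta> differentiable (at x)" if "b \<in> Basis" for b x using kp[OF that] by simp
  have pK: "partial b \<zeta> x = 0" if "x \<notin> K" for b x using partial_zero_outside[OF cK K(3) that] .
  define f1 where "f1 b x = \<zeta> x * partial b \<zeta> x" for b x
  define f2 where "f2 b x = (x \<bullet> b) * (\<zeta> x * \<zeta> x)" for b x
  have f1: "C_k 1 (f1 b)" if "b \<in> Basis" for b
    unfolding f1_def[abs_def] using k1 kp[OF that] by (rule C_k_mult)
  have f2: "C_k 1 (f2 b)" for b
    unfolding f2_def[abs_def] by (intro C_k_mult C_k_inner k1)
  have f1K: "f1 b x = 0" and f2K: "f2 b x = 0" if "x \<notin> K" for b x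
    using K(3)[OF that] by (simp_all add: f1_def f2_def)
  define g where "g b x = f1 b x * norm x powr t + c * (f2 b x * norm x powr (t - 2))" for b x
  have g: "C_k 1 (g b)" if "b \<in> Basis" for b
    unfolding g_def[abs_def]
    by (intro C_k_add C_k_cmult C_k_mult_norm_powr[OF f1 cK zK f1K] C_k_mult_norm_powr[OF f2 cK zK f2K] that)
  have gK: "g b x = 0" if "x \<notin> K" for b x using f1K[OF that] f2K[OF that] by (simp add: g_def)
  let ?R = "\<lambda>x. \<zeta> x * laplacian \<zeta> x * norm x powr t + \<sigma> * (\<sigma> + 2 + \<beta>) * ((\<zeta> x)\<^sup>2 * norm x powr (t - 2))"
  have le: "?R x \<le> (\<Sum>b\<in>Basis. partial b (g b) x)" for x
  proof (cases "x = 0")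
    case True
    have "0 \<le> (\<Sum>b\<in>Basis. partial b (g b) x)"
      using partial_zero_outside[OF cK gK] zK True by simp
    then show ?thesis using True by simp
  next
    case False
    define r where "r = norm x powr (t - 2)"
    have r: "r \<ge> 0" by (simp add: r_def)
    have n2: "norm x powr 2 = x \<bullet> x"
      using False powr_numeral[of "norm x"] by (simp add: power2_norm_eq_inner)
    have rt: "norm x powr t = r * (x \<bullet> x)"
    proof -
      have "norm x powr t = norm x powr (t - 2) * norm x powr 2"
        by (subst powr_add[symmetric]) simp
      then show ?thesis by (simp add: r_def n2)
    qed
    have rt4: "norm x powr (t - 2 - 2) * (x \<bullet> x) = r"
    proof -
      have "norm x powr (t - 2) = norm x powr (t - 2 - 2) * norm x powr 2"
        by (subst powr_add[symmetric]) simp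
      then show ?thesis by (simp add: r_def n2)
    qed
    define y where "y = (\<Sum>b\<in>Basis. (x \<bullet> b) * partial b \<zeta> x)"
    define Q where "Q = (\<Sum>b\<in>Basis. (partial b \<zeta> x)\<^sup>2)"
    have pg: "partial b (g b) x = (partial b \<zeta> x)\<^sup>2 * norm x powr t + \<zeta> x * norm x powr t * partial b (partial b \<zeta>) x
        + (t + 2 * c) * \<zeta> x * r * ((x \<bullet> b) * partial b \<zeta> x) + c * r * (\<zeta> x)\<^sup>2
        + c * (t - 2) * (\<zeta> x)\<^sup>2 * norm x powr (t - 2 - 2) * (x \<bullet> b)\<^sup>2" if b: "b \<in> Basis" for b
    proof -
      have p1: "partial b (f1 b) x = (partial b \<zeta> x)\<^sup>2 + \<zeta> x * partial b (partial b \<zeta>) x"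
        unfolding f1_def[abs_def] using partial_mult[OF d dp[OF b]] by (simp add: power2_eq_square)
      have dd: "(\<lambda>x. \<zeta> x * \<zeta> x) differentiable (at x)" using d by (intro differentiable_mult)
      have p2: "partial b (f2 b) x = (\<zeta> x)\<^sup>2 + 2 * (x \<bullet> b) * \<zeta> x * partial b \<zeta> x"
        unfolding f2_def[abs_def]
        by (subst partial_mult[OF _ dd], simp, subst partial_mult[OF d d])
           (use b in \<open>simp add: power2_eq_square algebra_simps\<close>)
      have d1: "(\<lambda>x. f1 b x * norm x powr t) differentiable (at x)"
        using C_k_mult_norm_powr[OF f1[OF b] cK zK f1K, of t] by simp
      have d2: "(\<lambda>x. f2 b x * norm x powr (t - 2)) differentiable (at x)"
        using C_k_mult_norm_powr[OF f2 cK zK f2K, of b "t - 2"] by simp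
      have f1d: "f1 b differentiable (at x)" and f2d: "f2 b differentiable (at x)"
        using f1[OF b] f2[of b] by simp_all
      have "partial b (g b) x = partial b (\<lambda>x. f1 b x * norm x powr t) x
            + c * partial b (\<lambda>x. f2 b x * norm x powr (t - 2)) x"
        unfolding g_def[abs_def]
        by (subst partial_add[OF d1]) (use d2 in \<open>auto simp: partial_cmult\<close>)
      also have "\<dots> = (partial b (f1 b) x * norm x powr t + t * ((x \<bullet> b) * f1 b x * norm x powr (t - 2)))
            + c * (partial b (f2 b) x * norm x powr (t - 2) + (t - 2) * ((x \<bullet> b) * f2 b x * norm x powr (t - 2 - 2)))"
        using partial_mult_norm_powr[OF f1d cK zK f1K] partial_mult_norm_powr[OF f2d cK zK f2K] by simp
      finally show ?thesis
        unfolding p1 p2 r_def[symmetric] f1_def f2_def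
        by (simp add: algebra_simps power2_eq_square)
    qed
    have xx: "(\<Sum>b\<in>Basis. (x \<bullet> b)\<^sup>2) = x \<bullet> x"
      by (simp add: euclidean_inner[of x x] power2_eq_square)
    have "(\<Sum>b\<in>Basis. partial b (g b) x) = Q * norm x powr t + \<zeta> x * norm x powr t * laplacian \<zeta> x
        + (t + 2 * c) * \<zeta> x * r * y + c * r * (\<zeta> x)\<^sup>2 * real DIM('a)
        + c * (t - 2) * (\<zeta> x)\<^sup>2 * norm x powr (t - 2 - 2) * (x \<bullet> x)"
      by (simp add: pg sum.distrib Q_def y_def laplacian_def xx flip: sum_distrib_left sum_distrib_right)
    also have "\<dots> = \<zeta> x * laplacian \<zeta> x * norm x powr t
        + r * (Q * (x \<bullet> x) + (t + 2 * c) * \<zeta> x * y + c * (real DIM('a) + t - 2) * (\<zeta> x)\<^sup>2)"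
      unfolding mult.assoc[of _ _ "x \<bullet> x"] rt4 by (simp add: rt algebra_simps)
    also have "\<dots> \<ge> ?R x"
    proof -
      define v where "v = (\<Sum>b\<in>Basis. partial b \<zeta> x *\<^sub>R b)"
      have vb: "v \<bullet> b = partial b \<zeta> x" if "b \<in> Basis" for b
        unfolding v_def using that by simp
      have "x \<bullet> v = y" "v \<bullet> v = Q"
        by (simp_all add: euclidean_inner[of x v] euclidean_inner[of v v] vb y_def Q_def power2_eq_square)
      then have cs: "y\<^sup>2 \<le> Q * (x \<bullet> x)" using Cauchy_Schwarz_ineq[of x v] by (simp add: mult.commute)
      have N: "real DIM('a) = 2 * \<sigma> + 4 + \<beta>" using \<sigma> by simp
      \<comment> \<open>Both t + 2 c and N + t - 2 equal 2 \<sigma>, so the left side is y^2 + 2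
        \<sigma> \<zeta> y + 2 c \<sigma> \<zeta>^2, and 2 c \<sigma> = \<sigma>^2 + \<sigma>
        (\<sigma> + 2 + \<beta>).\<close>
      have "y\<^sup>2 + (t + 2 * c) * \<zeta> x * y + c * (real DIM('a) + t - 2) * (\<zeta> x)\<^sup>2
          = (y + \<sigma> * \<zeta> x)\<^sup>2 + \<sigma> * (\<sigma> + 2 + \<beta>) * (\<zeta> x)\<^sup>2"
        unfolding N t_def c_def by (simp add: algebra_simps power2_eq_square)
      moreover have "0 \<le> (y + \<sigma> * \<zeta> x)\<^sup>2" by simp
      ultimately have "\<sigma> * (\<sigma> + 2 + \<beta>) * (\<zeta> x)\<^sup>2
          \<le> Q * (x \<bullet> x) + (t + 2 * c) * \<zeta> x * y + c * (real DIM('a) + t - 2) * (\<zeta> x)\<^sup>2"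
        using cs by linarith
      from mult_left_mono[OF this r] show ?thesis by (simp add: r_def[symmetric] mult_ac)
    qed
    finally show ?thesis .
  qed
  have cl: "continuous_on UNIV (\<lambda>x. f x * norm x powr s)" if "continuous_on UNIV f" "\<And>x. x \<notin> K \<Longrightarrow> f x = 0" for f s
    using C_k_mult_norm_powr[of 0 f K s] that cK zK by auto
  note L = C0_2_laplacian[OF \<zeta>]
  have i1: "integrable lebesgue (\<lambda>x. (\<zeta> x * laplacian \<zeta> x) * norm x powr t)"
    using L K by (intro integrable_continuous_compact[OF cl K(1)] continuous_intros) auto
  have i2: "integrable lebesgue (\<lambda>x. (\<zeta> x)\<^sup>2 * norm x powr (t - 2))"
    using L K by (intro integrable_continuous_compact[OF cl K(1)] continuous_intros) auto
  have i3: "integrable lebesgue (partial b (g b))" if "b \<in> Basis" for b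
    using g[OF that] that partial_zero_outside[OF cK gK]
    by (intro integrable_continuous_compact[OF _ K(1)]) auto
  have "(\<integral>x. \<zeta> x * laplacian \<zeta> x * norm x powr t \<partial>lebesgue) + \<sigma> * (\<sigma> + 2 + \<beta>) * (\<integral>x. (\<zeta> x)\<^sup>2 * norm x powr (t - 2) \<partial>lebesgue)
      = (\<integral>x. ?R x \<partial>lebesgue)"
    using i1 i2 by simp
  also have "\<dots> \<le> (\<integral>x. (\<Sum>b\<in>Basis. partial b (g b) x) \<partial>lebesgue)"
    using i1 i2 i3 le by (intro integral_mono) auto
  also have "\<dots> = 0"
    using i3 integral_partial_eq_0[OF g K(1) gK] by simp
  finally show ?thesis by (simp add: t_def)
qed

section \<open>Mollification\<close>

definition conv :: "('a::euclidean_space \<Rightarrow> real) \<Rightarrow> ('a \<Rightarrow> real) \<Rightarrow> 'a \<Rightarrow> real" where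
  "conv w \<rho> x = (\<integral>y. w y * \<rho> (x - y) \<partial>lebesgue)"

lemma integrable_conv:
  fixes w :: "'a::euclidean_space \<Rightarrow> real"
  assumes w: "integrable lebesgue w" and \<rho>: "continuous_on UNIV \<rho>" "compact K" "\<And>x. x \<notin> K \<Longrightarrow> \<rho> x = 0"
  shows "integrable lebesgue (\<lambda>y. w y * \<rho> (x - y))"
proof -
  obtain B where B: "B > 0" "\<And>x. \<bar>\<rho> x\<bar> \<le> B"
    by (rule continuous_compact_bounded[OF continuous_on_subset[OF \<rho>(1)] \<rho>(2,3)]) auto
  have "(\<lambda>y. \<rho> (x - y)) \<in> borel_measurable lebesgue"
    by (intro continuous_measurable_lebesgue continuous_on_compose2[OF \<rho>(1)] continuous_intros) auto
  then show ?thesis using w B by (intro integrable_bounded_mult) auto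
qed

lemma continuous_on_conv:
  fixes w :: "'a::euclidean_space \<Rightarrow> real"
  assumes w: "integrable lebesgue w" and \<rho>: "continuous_on UNIV \<rho>" "compact K" "\<And>x. x \<notin> K \<Longrightarrow> \<rho> x = 0"
  shows "continuous_on UNIV (conv w \<rho>)"
  unfolding continuous_on_sequentially
proof (intro allI ballI impI, elim conjE)
  fix X :: "nat \<Rightarrow> 'a" and x assume X: "X \<longlonglongrightarrow> x"
  obtain B where B: "B > 0" "\<And>x. \<bar>\<rho> x\<bar> \<le> B"
    by (rule continuous_compact_bounded[OF continuous_on_subset[OF \<rho>(1)] \<rho>(2,3)]) auto
  note i = integrable_conv[OF w \<rho>]
  show "(conv w \<rho> \<circ> X) \<longlonglongrightarrow> conv w \<rho> x"
    unfolding conv_def comp_def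
  proof (rule integral_dominated_convergence[where w = "\<lambda>y. \<bar>w y\<bar> * B"])
    show "integrable lebesgue (\<lambda>y. \<bar>w y\<bar> * B)" using w by simp
    show "AE y in lebesgue. (\<lambda>n. w y * \<rho> (X n - y)) \<longlonglongrightarrow> w y * \<rho> (x - y)"
      by (intro AE_I2 tendsto_intros continuous_on_tendsto_compose[OF \<rho>(1)] X) auto
    show "AE y in lebesgue. norm (w y * \<rho> (X n - y)) \<le> \<bar>w y\<bar> * B" for n
      using B(2) by (auto simp: abs_mult intro!: mult_left_mono)
  qed (use i in auto)
qed

text \<open>The first-order remainder of \<open>\<rho>\<close>, divided by the length of the
  increment, is bounded uniformly in the base point by the Lipschitz constant and the bound on the
  partial derivatives. A constant times |w| therefore dominates the integrands.\<close>

lemma conv_has_derivative: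
  fixes w :: "'a::euclidean_space \<Rightarrow> real"
  assumes w: "integrable lebesgue w" and \<rho>: "C_k 1 \<rho>" and K: "compact K" "\<And>x. x \<notin> K \<Longrightarrow> \<rho> x = 0"
  shows "(conv w \<rho> has_derivative (\<lambda>h. \<Sum>b\<in>Basis. (h \<bullet> b) * conv w (partial b \<rho>) x)) (at x)"
proof -
  obtain L where L: "L > 0" "\<And>x y. \<bar>\<rho> x - \<rho> y\<bar> \<le> L * norm (x - y)"
      "\<And>x b. b \<in> Basis \<Longrightarrow> \<bar>partial b \<rho> x\<bar> \<le> L"
    using C_k_1_Lipschitz[OF \<rho> K] by metis
  have c: "continuous_on UNIV \<rho>" using C_k_continuous[OF \<rho>] .
  have cp: "continuous_on UNIV (partial b \<rho>)" if "b \<in> Basis" for b using \<rho> that by auto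
  have pK: "partial b \<rho> x = 0" if "x \<notin> K" for b x
    using partial_zero_outside[OF compact_imp_closed[OF K(1)] K(2) that] by simp
  note i = integrable_conv[OF w c K]
  have ip: "integrable lebesgue (\<lambda>y. w y * partial b \<rho> (x - y))" if "b \<in> Basis" for b x
    using integrable_conv[OF w cp[OF that] K(1) pK] .
  let ?D = "\<lambda>z h. \<Sum>b\<in>Basis. (h \<bullet> b) * partial b \<rho> z"
  let ?D' = "\<lambda>h. \<Sum>b\<in>Basis. (h \<bullet> b) * conv w (partial b \<rho>) x"
  have D': "?D' h = (\<integral>y. w y * ?D (x - y) h \<partial>lebesgue)" and iD: "integrable lebesgue (\<lambda>y. w y * ?D (x - y) h)" for h
  proof -
    have eq: "w y * ?D (x - y) h = (\<Sum>b\<in>Basis. (h \<bullet> b) * (w y * partial b \<rho> (x - y)))" for y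
      by (simp add: sum_distrib_left mult_ac)
    show "integrable lebesgue (\<lambda>y. w y * ?D (x - y) h)"
      unfolding eq using ip by auto
    show "?D' h = (\<integral>y. w y * ?D (x - y) h \<partial>lebesgue)"
      unfolding eq conv_def using ip by (subst Bochner_Integration.integral_sum) auto
  qed
  have Db: "\<bar>?D z h\<bar> \<le> real DIM('a) * L * norm h" for z h
  proof -
    have "\<bar>?D z h\<bar> \<le> (\<Sum>b\<in>(Basis::'a set). norm h * L)"
    proof (rule order_trans[OF sum_abs], rule sum_mono)
      fix b :: 'a assume "b \<in> Basis"
      then show "\<bar>(h \<bullet> b) * partial b \<rho> z\<bar> \<le> norm h * L"
        unfolding abs_mult using L Basis_le_norm by (intro mult_mono) auto
    qed
    then show ?thesis by (simp add: mult_ac)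
  qed
  have lim: "((\<lambda>z. norm (conv w \<rho> z - conv w \<rho> x - ?D' (z - x)) / norm (z - x)) \<longlongrightarrow> 0) (at x)"
    unfolding tendsto_at_iff_sequentially
  proof (intro allI impI)
    fix X :: "nat \<Rightarrow> 'a" assume X: "\<forall>i. X i \<in> UNIV - {x}" "X \<longlonglongrightarrow> x"
    have nz: "norm (X n - x) > 0" for n using X(1) by simp
    define s where "s n y = w y * (\<rho> (X n - y) - \<rho> (x - y) - ?D (x - y) (X n - x)) / norm (X n - x)" for n y
    have si: "integrable lebesgue (s n)" for n
    proof -
      have "integrable lebesgue (\<lambda>y. (w y * \<rho> (X n - y) - w y * \<rho> (x - y) - w y * ?D (x - y) (X n - x)) / norm (X n - x))"
        using i iD by (intro integrable_divide Bochner_Integration.integrable_diff) auto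
      then show ?thesis unfolding s_def[abs_def] by (simp add: algebra_simps)
    qed
    have se: "(conv w \<rho> (X n) - conv w \<rho> x - ?D' (X n - x)) / norm (X n - x) = integral\<^sup>L lebesgue (s n)" for n
    proof -
      have "integral\<^sup>L lebesgue (s n) = (\<integral>y. (w y * \<rho> (X n - y) - w y * \<rho> (x - y) - w y * ?D (x - y) (X n - x)) / norm (X n - x) \<partial>lebesgue)"
        unfolding s_def[abs_def] by (simp add: algebra_simps)
      also have "\<dots> = (conv w \<rho> (X n) - conv w \<rho> x - ?D' (X n - x)) / norm (X n - x)"
        unfolding D' conv_def[of w \<rho>] using i iD by simp
      finally show ?thesis ..
    qed
    have "(\<lambda>n. integral\<^sup>L lebesgue (s n)) \<longlonglongrightarrow> (\<integral>y. 0 \<partial>(lebesgue :: 'a measure))"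
    proof (rule integral_dominated_convergence[where w = "\<lambda>y. \<bar>w y\<bar> * (L + real DIM('a) * L)"])
      show "integrable lebesgue (\<lambda>y. \<bar>w y\<bar> * (L + real DIM('a) * L))" using w by simp
      show "s n \<in> borel_measurable lebesgue" for n using si by auto
      show "AE y in lebesgue. norm (s n y) \<le> \<bar>w y\<bar> * (L + real DIM('a) * L)" for n
      proof (rule AE_I2)
        fix y
        have "\<bar>\<rho> (X n - y) - \<rho> (x - y) - ?D (x - y) (X n - x)\<bar> \<le> L * norm (X n - x) + real DIM('a) * L * norm (X n - x)"
          using L(2)[of "X n - y" "x - y"] Db[of "X n - x" "x - y"] by simp
        then have "\<bar>\<rho> (X n - y) - \<rho> (x - y) - ?D (x - y) (X n - x)\<bar> / norm (X n - x) \<le> L + real DIM('a) * L"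
          using nz[of n] by (simp add: field_simps)
        from mult_left_mono[OF this, of "\<bar>w y\<bar>"]
        show "norm (s n y) \<le> \<bar>w y\<bar> * (L + real DIM('a) * L)" by (simp add: s_def abs_mult)
      qed
      show "AE y in lebesgue. (\<lambda>n. s n y) \<longlonglongrightarrow> 0"
      proof (rule AE_I2)
        fix y
        have "(\<rho> has_derivative ?D (x - y)) (at (x - y))"
          using \<rho> by (intro has_derivative_partial) simp
        then have "((\<lambda>z. norm (\<rho> z - \<rho> (x - y) - ?D (x - y) (z - (x - y))) / norm (z - (x - y))) \<longlongrightarrow> 0) (at (x - y))"
          unfolding has_derivative_iff_norm by simp
        moreover have "filterlim (\<lambda>n. X n - y) (at (x - y)) sequentially"
          using X by (auto simp: filterlim_at intro!: tendsto_intros)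
        ultimately have "(\<lambda>n. norm (\<rho> (X n - y) - \<rho> (x - y) - ?D (x - y) (X n - y - (x - y))) / norm (X n - y - (x - y))) \<longlonglongrightarrow> 0"
          by (rule filterlim_compose)
        then have "(\<lambda>n. (\<rho> (X n - y) - \<rho> (x - y) - ?D (x - y) (X n - x)) / norm (X n - x)) \<longlonglongrightarrow> 0"
          by (subst tendsto_norm_zero_iff[symmetric]) (simp add: norm_divide)
        from tendsto_mult_right_zero[OF this, of "w y"] show "(\<lambda>n. s n y) \<longlonglongrightarrow> 0"
          by (simp add: s_def)
      qed
    qed simp
    then have "(\<lambda>n. \<bar>(conv w \<rho> (X n) - conv w \<rho> x - ?D' (X n - x)) / norm (X n - x)\<bar>) \<longlonglongrightarrow> 0"
      unfolding se by (intro tendsto_rabs_zero) simp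
    then show "((\<lambda>z. norm (conv w \<rho> z - conv w \<rho> x - ?D' (z - x)) / norm (z - x)) \<circ> X) \<longlonglongrightarrow> 0"
      by (simp add: comp_def)
  qed
  have "bounded_linear ?D'"
    by (intro bounded_linear_sum bounded_linear_mult_const bounded_linear_inner_left)
  then show ?thesis unfolding has_derivative_iff_norm using lim by simp
qed

lemma C_k_conv:
  fixes w :: "'a::euclidean_space \<Rightarrow> real"
  assumes w: "integrable lebesgue w" and K: "compact K"
  shows "C_k k \<rho> \<Longrightarrow> (\<And>x. x \<notin> K \<Longrightarrow> \<rho> x = 0) \<Longrightarrow> C_k k (conv w \<rho>)"
proof (induction k arbitrary: \<rho>)
  case 0
  then show ?case using continuous_on_conv[OF w _ K] by simp
next
  case (Suc k)
  have "C_k 1 \<rho>" using C_k_lower[OF Suc.prems(1), of 1] by simp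
  note d = conv_has_derivative[OF w this K Suc.prems(2)]
  have "partial b (conv w \<rho>) = conv w (partial b \<rho>)" if "b \<in> Basis" for b
    using that by (intro ext) (subst partial_eqI[OF d], auto simp: inner_Basis if_distrib[of "\<lambda>x. x * _"] cong: if_cong)
  moreover have "C_k k (conv w (partial b \<rho>))" if "b \<in> Basis" for b
    using C_k_SucD(2)[OF Suc.prems(1) that] partial_zero_outside[OF compact_imp_closed[OF K] Suc.prems(2)]
    by (intro Suc.IH) auto
  moreover have "conv w \<rho> differentiable (at x)" for x
    using d by (rule differentiableI)
  ultimately show ?case by simp
qed

lemma partial_conv:
  fixes w :: "'a::euclidean_space \<Rightarrow> real"
  assumes w: "integrable lebesgue w" and \<rho>: "C_k 1 \<rho>" and K: "compact K" "\<And>x. x \<notin> K \<Longrightarrow> \<rho> x = 0" and b: "b \<in> Basis"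
  shows "partial b (conv w \<rho>) = conv w (partial b \<rho>)"
  by (intro ext, subst partial_eqI[OF conv_has_derivative[OF w \<rho> K]])
     (use b in \<open>auto simp: inner_Basis if_distrib[of "\<lambda>x. x * _"] cong: if_cong\<close>)

lemma laplacian_conv:
  fixes w :: "'a::euclidean_space \<Rightarrow> real"
  assumes w: "integrable lebesgue w" and \<rho>: "C_k 2 \<rho>" and K: "compact K" "\<And>x. x \<notin> K \<Longrightarrow> \<rho> x = 0"
  shows "laplacian (conv w \<rho>) = conv w (laplacian \<rho>)"
proof
  fix x
  have \<rho>2: "C_k (Suc 1) \<rho>" using \<rho> by (simp add: numeral_2_eq_2)
  have \<rho>p: "C_k 1 (partial b \<rho>)" if "b \<in> Basis" for b using C_k_SucD(2)[OF \<rho>2 that] .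
  have pK: "partial b \<rho> x = 0" if "x \<notin> K" for b x
    using partial_zero_outside[OF compact_imp_closed[OF K(1)] K(2) that] by simp
  have ppK: "partial b (partial b \<rho>) x = 0" if "x \<notin> K" for b x
    using partial_zero_outside[OF compact_imp_closed[OF K(1)] pK that] by simp
  have i: "integrable lebesgue (\<lambda>y. w y * partial b (partial b \<rho>) (x - y))" if "b \<in> Basis" for b
    using \<rho>p[OF that] that by (intro integrable_conv[OF w _ K(1) ppK]) auto
  have "laplacian (conv w \<rho>) x = (\<Sum>b\<in>Basis. conv w (partial b (partial b \<rho>)) x)"
    unfolding laplacian_def
    using partial_conv[OF w C_k_Suc_lower[OF \<rho>2] K] partial_conv[OF w \<rho>p K(1) pK] by simp
  also have "\<dots> = conv w (laplacian \<rho>) x"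
    unfolding conv_def laplacian_def sum_distrib_left using i
    by (subst Bochner_Integration.integral_sum) auto
  finally show "laplacian (conv w \<rho>) x = conv w (laplacian \<rho>) x" .
qed

lemma conv_eq_0:
  assumes "\<And>x. x \<notin> K \<Longrightarrow> w x = 0" "\<And>x. norm x > r \<Longrightarrow> \<rho> x = 0" "x \<notin> {a + b |a b. a \<in> K \<and> b \<in> cball 0 r}"
  shows "conv w \<rho> x = 0"
proof -
  have "w y * \<rho> (x - y) = 0" for y
  proof (cases "y \<in> K")
    case True
    have "x - y \<notin> cball 0 r"
    proof
      assume "x - y \<in> cball 0 r"
      moreover have "x = y + (x - y)" by simp
      ultimately show False using True assms(3) by blast
    qed
    then show ?thesis using assms(2) by simp
  qed (use assms(1) in simp)
  then have "(\<lambda>y. w y * \<rho> (x - y)) = (\<lambda>y. 0)" by blast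
  then show ?thesis by (simp add: conv_def)
qed

definition mollifier :: "nat \<Rightarrow> 'a::euclidean_space \<Rightarrow> real" where
  "mollifier n x = bump 1 ((1 / real (Suc n))\<^sup>2) x / (\<integral>y. bump 1 ((1 / real (Suc n))\<^sup>2) (y :: 'a) \<partial>lebesgue)"

lemma bump_zero_norm: "norm x \<ge> r \<Longrightarrow> r \<ge> 0 \<Longrightarrow> bump P (r\<^sup>2) x = 0"
  by (rule bump_zero) (simp add: dot_square_norm)

lemma integrable_bump: "integrable lebesgue (bump P c :: 'a::euclidean_space \<Rightarrow> real)"
proof (rule integrable_continuous_compact)
  show "continuous_on UNIV (bump P c :: 'a \<Rightarrow> real)" using C_k_bump[of 0 P c] by simp
  show "compact (cball (0::'a) (sqrt (max 0 c)))" by simp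
  fix x :: 'a assume "x \<notin> cball 0 (sqrt (max 0 c))"
  then have "sqrt (max 0 c) < sqrt (x \<bullet> x)" by (simp only: mem_cball_0 norm_eq_sqrt_inner not_le)
  then have "max 0 c < x \<bullet> x" by (simp only: real_sqrt_less_iff)
  then show "bump P c x = 0" by (intro bump_zero) linarith
qed

text \<open>Were the integral zero, the nonnegative bump would vanish almost everywhere; its zero
  set is closed, and a closed set of full measure is the whole space, contrary to positivity at the
  origin.\<close>

lemma integral_bump_pos:
  assumes "c > 0" shows "(\<integral>y. bump 1 c (y :: 'a::euclidean_space) \<partial>lebesgue) > 0"
proof -
  have "(\<integral>y. bump 1 c (y :: 'a) \<partial>lebesgue) \<noteq> 0"
  proof
    assume "(\<integral>y. bump 1 c (y :: 'a) \<partial>lebesgue) = 0"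
    then have "AE y in lebesgue. bump 1 c (y :: 'a) = 0"
      using integral_nonneg_eq_0_iff_AE[OF integrable_bump[of 1 c, where 'a='a]] by (simp add: bump_nonneg)
    moreover have "closed {y::'a. bump 1 c y = 0}"
      using C_k_bump[of 0 1 c] by (intro closed_Collect_eq) auto
    ultimately have "(0::'a) \<in> {y. bump 1 c y = 0}"
      using mem_closed_if_AE_lebesgue[of "{y::'a. bump 1 c y = 0}"] by auto
    then show False using bump_pos[of "0::'a" c] assms by simp
  qed
  moreover have "(\<integral>y. bump 1 c (y :: 'a) \<partial>lebesgue) \<ge> 0"
    by (intro Bochner_Integration.integral_nonneg) (simp add: bump_nonneg)
  ultimately show ?thesis by linarith
qed

lemma C_k_mollifier: "C_k k (mollifier n)"
  unfolding mollifier_def[abs_def] divide_inverse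
  by (subst mult.commute, intro C_k_cmult C_k_bump)

lemma mollifier_nonneg: "mollifier n x \<ge> 0"
  unfolding mollifier_def by (intro divide_nonneg_pos integral_bump_pos bump_nonneg) auto

lemma mollifier_zero: "norm x \<ge> 1 / real (Suc n) \<Longrightarrow> mollifier n x = 0"
  unfolding mollifier_def by (subst bump_zero_norm) auto

lemma continuous_mollifier: "continuous_on UNIV (mollifier n)"
  using C_k_mollifier[of 0] by simp

lemma mollifier_integral: "(\<integral>x. mollifier n (x::'a::euclidean_space) \<partial>lebesgue) = 1"
  unfolding mollifier_def using integral_bump_pos[where 'a='a, of "(1 / real (Suc n))\<^sup>2"] by simp

lemma mollifier_integral_shift:
  fixes x y :: "'a::euclidean_space"
  shows "(\<integral>y. mollifier n (x - y) \<partial>lebesgue) = 1" "(\<integral>x. mollifier n (x - y) \<partial>lebesgue) = 1"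
    "integrable lebesgue (\<lambda>x. mollifier n (x - y))" "integrable lebesgue (\<lambda>y. mollifier n (x - y))"
proof -
  have m: "(mollifier n :: 'a \<Rightarrow> real) \<in> borel_measurable lebesgue"
    by (rule continuous_measurable_lebesgue[OF continuous_mollifier])
  have i: "integrable lebesgue (mollifier n :: 'a \<Rightarrow> real)"
    by (rule integrable_continuous_compact[OF continuous_mollifier, of "cball 0 (1 / real (Suc n))"])
       (auto intro: mollifier_zero)
  show "(\<integral>y. mollifier n (x - y) \<partial>lebesgue) = 1" "integrable lebesgue (\<lambda>y. mollifier n (x - y))"
    using lebesgue_integral_affine[of "-1", OF _ m, of x] i mollifier_integral[where 'a='a] by simp_all
  show "(\<integral>x. mollifier n (x - y) \<partial>lebesgue) = 1" "integrable lebesgue (\<lambda>x. mollifier n (x - y))"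
    using lebesgue_integral_affine[of 1, OF _ m, of "-y"] i mollifier_integral[where 'a='a]
    by (simp_all add: algebra_simps)
qed

lemma integrable_conv_mollifier:
  "integrable lebesgue w \<Longrightarrow> integrable lebesgue (\<lambda>y. w y * mollifier n (x - y))"
  by (rule integrable_conv[OF _ continuous_mollifier, of _ "cball 0 (1 / real (Suc n))"])
     (auto intro: mollifier_zero)

text \<open>Fubini applies because each translate of the mollifier is nonnegative with integral 1,
  so that the inner integral of the modulus is just |g y|.\<close>

lemma integral_conv_mollifier:
  fixes g :: "'a::euclidean_space \<Rightarrow> real"
  assumes g: "integrable lebesgue g"
  shows "integrable lebesgue (conv g (mollifier n))" "integral\<^sup>L lebesgue (conv g (mollifier n)) = integral\<^sup>L lebesgue g"
proof -
  let ?L = "lebesgue :: 'a measure"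
  have [measurable]: "g \<in> borel_measurable lebesgue" using g by simp
  have f: "fst \<in> ?L \<Otimes>\<^sub>M ?L \<rightarrow>\<^sub>M borel" "snd \<in> ?L \<Otimes>\<^sub>M ?L \<rightarrow>\<^sub>M borel"
    using measurable_compose[OF measurable_fst id_borel_measurable_lebesgue, of ?L]
      measurable_compose[OF measurable_snd id_borel_measurable_lebesgue, of ?L] by simp_all
  have "(\<lambda>p. mollifier n (snd p - fst p)) \<in> borel_measurable (?L \<Otimes>\<^sub>M ?L)"
    by (intro borel_measurable_continuous_on[OF continuous_mollifier] borel_measurable_diff f)
  then have m: "(\<lambda>p. g (fst p) * mollifier n (snd p - fst p)) \<in> borel_measurable (?L \<Otimes>\<^sub>M ?L)"
    by (intro borel_measurable_times measurable_compose[OF measurable_fst]) auto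
  have int: "integrable (?L \<Otimes>\<^sub>M ?L) (\<lambda>(y, x). g y * mollifier n (x - y))"
  proof (rule lebesgue_pair.Fubini_integrable)
    show "(\<lambda>(y, x). g y * mollifier n (x - y)) \<in> borel_measurable (?L \<Otimes>\<^sub>M ?L)"
      using m by (simp add: case_prod_beta')
    have "(\<integral>x. norm (g y * mollifier n (x - y)) \<partial>lebesgue) = \<bar>g y\<bar>" for y
      using mollifier_integral_shift(2)[of n y] by (simp add: abs_mult mollifier_nonneg)
    then show "integrable lebesgue (\<lambda>y. \<integral>x. norm (case (y, x) of (y, x) \<Rightarrow> g y * mollifier n (x - y)) \<partial>lebesgue)"
      using g by simp
    show "AE y in lebesgue. integrable lebesgue (\<lambda>x. case (y, x) of (y, x) \<Rightarrow> g y * mollifier n (x - y))"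
      using mollifier_integral_shift(3) by auto
  qed
  show "integrable lebesgue (conv g (mollifier n))"
    using lebesgue_pair.integrable_snd[OF int] unfolding conv_def[abs_def] by simp
  have "integral\<^sup>L lebesgue (conv g (mollifier n)) = (\<integral>y. \<integral>x. g y * mollifier n (x - y) \<partial>lebesgue \<partial>lebesgue)"
    using lebesgue_pair.Fubini_integral[OF int] unfolding conv_def[abs_def] by simp
  also have "\<dots> = integral\<^sup>L lebesgue g" using mollifier_integral_shift(2)[where 'a='a, of n] by simp
  finally show "integral\<^sup>L lebesgue (conv g (mollifier n)) = integral\<^sup>L lebesgue g" .
qed

section \<open>Square integrable functions and convergence of mollifications in the mean\<close>

definition L2 :: "('a::euclidean_space \<Rightarrow> real) set" where
  "L2 = {f. f \<in> borel_measurable lebesgue \<and> integrable lebesgue (\<lambda>x. (f x)\<^sup>2)}"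

lemma L2_measurable: "f \<in> L2 \<Longrightarrow> f \<in> borel_measurable lebesgue"
  and L2_square: "f \<in> L2 \<Longrightarrow> integrable lebesgue (\<lambda>x. (f x)\<^sup>2)"
  by (auto simp: L2_def)

lemma abs_mult_le_squares: "2 * \<bar>a * b\<bar> \<le> a\<^sup>2 + b\<^sup>2" for a b :: real
  using sum_squares_bound[of "\<bar>a\<bar>" "\<bar>b\<bar>"] by (simp add: abs_mult mult.assoc)

lemma L2_mult:
  assumes "f \<in> L2" "g \<in> L2" shows "integrable lebesgue (\<lambda>x. f x * g x)"
proof (rule Bochner_Integration.integrable_bound[of _ "\<lambda>x. (f x)\<^sup>2 + (g x)\<^sup>2"])
  show "AE x in lebesgue. norm (f x * g x) \<le> norm ((f x)\<^sup>2 + (g x)\<^sup>2)"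
  proof (rule AE_I2)
    fix x show "norm (f x * g x) \<le> norm ((f x)\<^sup>2 + (g x)\<^sup>2)"
      using abs_mult_le_squares[of "f x" "g x"] by simp
  qed
qed (use assms in \<open>auto simp: L2_def\<close>)

lemma L2_add:
  assumes "f \<in> L2" "g \<in> L2" shows "(\<lambda>x. f x + g x) \<in> L2"
  using assms L2_mult[OF assms] by (auto simp: L2_def power2_sum mult.assoc)

lemma L2_cmult: "f \<in> L2 \<Longrightarrow> (\<lambda>x. c * f x) \<in> L2"
  by (auto simp: L2_def power_mult_distrib)

lemma L2_diff: "f \<in> L2 \<Longrightarrow> g \<in> L2 \<Longrightarrow> (\<lambda>x. f x - g x) \<in> L2"
  using L2_add[of f "\<lambda>x. -1 * g x"] L2_cmult[of g "-1"] by simp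

lemma L2_bounded_mult:
  assumes f: "f \<in> L2" and g: "g \<in> borel_measurable lebesgue" "\<And>x. \<bar>g x\<bar> \<le> B"
  shows "(\<lambda>x. f x * g x) \<in> L2"
proof -
  have "(g x)\<^sup>2 \<le> B\<^sup>2" for x using g(2)[of x] by (metis abs_ge_zero order.trans abs_le_square_iff abs_of_nonneg)
  then have "integrable lebesgue (\<lambda>x. (f x)\<^sup>2 * (g x)\<^sup>2)"
    using f g(1) by (intro integrable_bounded_mult[where B="B\<^sup>2"]) (auto simp: L2_def)
  then show ?thesis using f g(1) by (auto simp: L2_def power_mult_distrib)
qed

lemma L2_continuous:
  assumes "continuous_on UNIV f" "compact K" "\<And>x. x \<notin> K \<Longrightarrow> f x = 0"
  shows "f \<in> L2"
  unfolding L2_def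
  using assms by (auto intro!: continuous_measurable_lebesgue integrable_continuous_compact[of _ K] continuous_intros)

lemma L2_integrable:
  assumes "f \<in> L2" "compact K" "\<And>x. x \<notin> K \<Longrightarrow> f x = 0"
  shows "integrable lebesgue f"
proof (rule Bochner_Integration.integrable_bound[of _ "\<lambda>x. (f x)\<^sup>2 + indicator K x"])
  show "integrable lebesgue (\<lambda>x. (f x)\<^sup>2 + indicator K x)"
    using L2_square[OF assms(1)] compact_integrable_indicator[OF assms(2)] by simp
  have "\<bar>f x\<bar> \<le> (f x)\<^sup>2 + 1" for x using abs_mult_le_squares[of "f x" 1] by simp
  then show "AE x in lebesgue. norm (f x) \<le> norm ((f x)\<^sup>2 + indicator K x)"
    using assms(3) by (auto simp: indicator_def)
qed (use assms in \<open>auto simp: L2_def\<close>)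

text \<open>Jensen's inequality for the probability density \<open>mollifier n (x - y)\<close>,
  obtained by expanding the nonnegative average of (f y - c)^2, where c is the mean of
  \<open>f\<close>.\<close>

lemma conv_mollifier_square_le:
  fixes f :: "'a::euclidean_space \<Rightarrow> real"
  assumes f: "f \<in> L2" "integrable lebesgue f"
  shows "(conv f (mollifier n) x)\<^sup>2 \<le> conv (\<lambda>y. (f y)\<^sup>2) (mollifier n) x"
proof -
  define c where "c = conv f (mollifier n) x"
  note i1 = integrable_conv_mollifier[OF f(2), of n x]
  note i2 = integrable_conv_mollifier[OF L2_square[OF f(1)], of n x]
  note m = mollifier_integral_shift(1,4)[of n x]
  have "0 \<le> (\<integral>y. (f y - c)\<^sup>2 * mollifier n (x - y) \<partial>lebesgue)"
    by (intro Bochner_Integration.integral_nonneg) (simp add: mollifier_nonneg)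
  also have "\<dots> = (\<integral>y. (f y)\<^sup>2 * mollifier n (x - y) - (2 * c) * (f y * mollifier n (x - y)) + c\<^sup>2 * mollifier n (x - y) \<partial>lebesgue)"
    by (rule Bochner_Integration.integral_cong) (simp_all add: power2_diff algebra_simps)
  also have "\<dots> = conv (\<lambda>y. (f y)\<^sup>2) (mollifier n) x - 2 * c * c + c\<^sup>2"
    using i1 i2 m by (simp add: conv_def c_def)
  finally show ?thesis by (simp add: c_def power2_eq_square)
qed

text \<open>Integrating the pointwise Jensen bound shows that mollification does not increase the
  norm, so approximation errors pass through it.\<close>

lemma conv_mollifier_L2:
  fixes f :: "'a::euclidean_space \<Rightarrow> real"
  assumes f: "f \<in> L2" "integrable lebesgue f"
  shows "conv f (mollifier n) \<in> L2" "(\<integral>x. (conv f (mollifier n) x)\<^sup>2 \<partial>lebesgue) \<le> (\<integral>x. (f x)\<^sup>2 \<partial>lebesgue)"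
proof -
  note I = integral_conv_mollifier[OF L2_square[OF f(1)], of n]
  have m: "conv f (mollifier n) \<in> borel_measurable lebesgue"
    using integral_conv_mollifier(1)[OF f(2)] by simp
  have le: "norm ((conv f (mollifier n) x)\<^sup>2) \<le> norm (conv (\<lambda>y. (f y)\<^sup>2) (mollifier n) x)" for x
    using conv_mollifier_square_le[OF f, of n x] by simp
  have i: "integrable lebesgue (\<lambda>x. (conv f (mollifier n) x)\<^sup>2)"
    by (rule Bochner_Integration.integrable_bound[OF I(1)]) (use m le in auto)
  then show "conv f (mollifier n) \<in> L2" using m by (simp add: L2_def)
  have "(\<integral>x. (conv f (mollifier n) x)\<^sup>2 \<partial>lebesgue) \<le> (\<integral>x. conv (\<lambda>y. (f y)\<^sup>2) (mollifier n) x \<partial>lebesgue)"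
    using i I(1) conv_mollifier_square_le[OF f] by (intro integral_mono) auto
  then show "(\<integral>x. (conv f (mollifier n) x)\<^sup>2 \<partial>lebesgue) \<le> (\<integral>x. (f x)\<^sup>2 \<partial>lebesgue)" using I(2) by simp
qed

text \<open>An average over the ball of radius 1 / (n + 1) differs from the central value by at most
  the oscillation on that ball. Continuity makes this small pointwise, and 2 B on a neighbourhood of
  the support dominates.\<close>

lemma conv_mollifier_continuous_tendsto:
  fixes c :: "'a::euclidean_space \<Rightarrow> real"
  assumes c: "continuous_on UNIV c" "compact K" "\<And>x. x \<notin> K \<Longrightarrow> c x = 0"
  shows "(\<lambda>n. \<integral>x. (conv c (mollifier n) x - c x)\<^sup>2 \<partial>lebesgue) \<longlonglongrightarrow> 0"
proof -
  obtain B where B: "B > 0" "\<And>x. \<bar>c x\<bar> \<le> B"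
    by (rule continuous_compact_bounded[OF continuous_on_subset[OF c(1)] c(2,3)]) auto
  define K' where "K' = {x + y |x y. x \<in> K \<and> y \<in> cball (0::'a) 1}"
  have K': "compact K'" unfolding K'_def by (intro compact_sums c compact_cball)
  have i: "integrable lebesgue c" using integrable_continuous_compact[OF c] .
  have "(\<lambda>n. \<integral>x. (conv c (mollifier n) x - c x)\<^sup>2 \<partial>lebesgue) \<longlonglongrightarrow> (\<integral>x. 0 \<partial>(lebesgue :: 'a measure))"
  proof (rule integral_dominated_convergence[where w = "\<lambda>x. (2 * B)\<^sup>2 * indicator K' x"])
    show "integrable lebesgue (\<lambda>x. (2 * B)\<^sup>2 * indicator K' x)"
      using compact_integrable_indicator[OF K'] by simp
    show "(\<lambda>x. (conv c (mollifier n) x - c x)\<^sup>2) \<in> borel_measurable lebesgue" for n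
      using integral_conv_mollifier(1)[OF i] i by simp
    have conv_diff: "conv c (mollifier n) x - c x = (\<integral>y. (c y - c x) * mollifier n (x - y) \<partial>lebesgue)" for n x
      using integrable_conv_mollifier[OF i] mollifier_integral_shift(1,4)[of n x]
      by (simp add: conv_def left_diff_distrib)
    have conv_diff_le: "\<bar>conv c (mollifier n) x - c x\<bar> \<le> e"
      if "\<And>y. norm (x - y) \<le> 1 / real (Suc n) \<Longrightarrow> \<bar>c y - c x\<bar> \<le> e" for n x e
    proof -
      have i1: "integrable lebesgue (\<lambda>y. (c y - c x) * mollifier n (x - y))"
        using integrable_conv_mollifier[OF i] mollifier_integral_shift(4)[of n x] by (simp add: left_diff_distrib)
      have "\<bar>conv c (mollifier n) x - c x\<bar> \<le> (\<integral>y. \<bar>(c y - c x) * mollifier n (x - y)\<bar> \<partial>lebesgue)"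
        unfolding conv_diff by (rule integral_abs_bound)
      also have "\<dots> \<le> (\<integral>y. e * mollifier n (x - y) \<partial>lebesgue)"
      proof (rule integral_mono)
        fix y show "\<bar>(c y - c x) * mollifier n (x - y)\<bar> \<le> e * mollifier n (x - y)"
        proof (cases "norm (x - y) \<le> 1 / real (Suc n)")
          case True
          then show ?thesis using that[OF True] by (simp add: abs_mult mollifier_nonneg mult_right_mono)
        next
          case False
          then show ?thesis using mollifier_zero[of n "x - y"] by simp
        qed
      qed (use i1 mollifier_integral_shift(4)[of n x] in auto)
      also have "\<dots> = e" using mollifier_integral_shift(1,4)[of n x] by simp
      finally show ?thesis .
    qed
    show "AE x in lebesgue. (\<lambda>n. (conv c (mollifier n) x - c x)\<^sup>2) \<longlonglongrightarrow> 0"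
    proof (rule AE_I2)
      fix x
      have "(\<lambda>n. conv c (mollifier n) x - c x) \<longlonglongrightarrow> 0"
      proof (rule LIMSEQ_I)
        fix e :: real assume e: "e > 0"
        have "continuous (at x) c" using c(1) by (simp add: continuous_on_eq_continuous_at)
        then obtain d where d: "d > 0" "\<And>y. dist y x < d \<Longrightarrow> dist (c y) (c x) < e / 2"
          unfolding continuous_at_eps_delta using e by (meson half_gt_zero)
        obtain M where M: "1 / real (Suc M) < d" using d(1) nat_approx_posE by blast
        have "norm (conv c (mollifier n) x - c x - 0) < e" if "n \<ge> M" for n
        proof -
          have "1 / real (Suc n) \<le> 1 / real (Suc M)" using that by (simp add: frac_le)
          then have "\<bar>conv c (mollifier n) x - c x\<bar> \<le> e / 2"
            using d(2) M by (intro conv_diff_le) (force simp: dist_norm norm_minus_commute less_imp_le)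
          then show ?thesis using e by simp
        qed
        then show "\<exists>no. \<forall>n\<ge>no. norm (conv c (mollifier n) x - c x - 0) < e" by blast
      qed
      from tendsto_power[OF this, of 2] show "(\<lambda>n. (conv c (mollifier n) x - c x)\<^sup>2) \<longlonglongrightarrow> 0" by simp
    qed
    show "AE x in lebesgue. norm ((conv c (mollifier n) x - c x)\<^sup>2) \<le> (2 * B)\<^sup>2 * indicator K' x" for n
    proof (rule AE_I2)
      fix x
      show "norm ((conv c (mollifier n) x - c x)\<^sup>2) \<le> (2 * B)\<^sup>2 * indicator K' x"
      proof (cases "x \<in> K'")
        case True
        have "\<bar>c y - c x\<bar> \<le> 2 * B" for y using B(2)[of x] B(2)[of y] by linarith
        then have "\<bar>conv c (mollifier n) x - c x\<bar> \<le> \<bar>2 * B\<bar>" using B(1) by (intro conv_diff_le) simp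
        then have "(conv c (mollifier n) x - c x)\<^sup>2 \<le> (2 * B)\<^sup>2" by (simp only: abs_le_square_iff)
        then show ?thesis using True by simp
      next
        case False
        have "x \<notin> K" using False by (auto simp: K'_def intro: exI[of _ x] exI[of _ "0::'a"])
        moreover have "conv c (mollifier n) x = 0"
        proof (rule conv_eq_0[OF c(3)])
          show "mollifier n x = 0" if "norm x > 1" for x :: 'a
            by (rule mollifier_zero, rule order_trans[of _ 1]) (use that in auto)
        qed (use False in \<open>auto simp: K'_def\<close>)
        ultimately show ?thesis using c(3) by simp
      qed
    qed
  qed simp
  then show ?thesis by simp
qed

text \<open>Truncation of the values comes first: afterwards everything is bounded and lives in a
  ball, so almost everywhere convergence of continuous functions turns into convergence in the mean
  by domination.\<close>

lemma L2_approx_continuous: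
  fixes w :: "'a::euclidean_space \<Rightarrow> real"
  assumes w: "w \<in> L2" and K: "compact K" "\<And>x. x \<notin> K \<Longrightarrow> w x = 0" and e: "e > 0"
  obtains c K' where "continuous_on UNIV c" "compact K'" "\<And>x. x \<notin> K' \<Longrightarrow> c x = 0"
    "(\<integral>x. (w x - c x)\<^sup>2 \<partial>lebesgue) < e"
proof -
  note wm [measurable] = L2_measurable[OF w]
  obtain R where R: "K \<subseteq> cball 0 R" using compact_imp_bounded[OF K(1)] unfolding bounded_iff by (auto simp: subset_eq)
  define cutoff where "cutoff x = max 0 (min 1 (R + 1 - norm x))" for x :: 'a
  have cutoff: "continuous_on UNIV cutoff" "\<And>x. norm x \<le> R \<Longrightarrow> cutoff x = 1" "\<And>x. x \<notin> cball 0 (R + 1) \<Longrightarrow> cutoff x = 0"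
      "\<And>x. 0 \<le> cutoff x" "\<And>x. cutoff x \<le> 1"
  proof -
    show "continuous_on UNIV cutoff" unfolding cutoff_def by (intro continuous_intros)
  qed (simp_all add: cutoff_def)
  define clip where "clip M t = max (- M) (min M t)" for M t :: real
  have clip_cont: "continuous_on UNIV (clip M)" for M unfolding clip_def by (intro continuous_intros)
  have "(\<lambda>n. \<integral>x. (w x - clip (real n) (w x))\<^sup>2 \<partial>lebesgue) \<longlonglongrightarrow> (\<integral>x. 0 \<partial>(lebesgue::'a measure))"
  proof (rule integral_dominated_convergence[where w = "\<lambda>x. (w x)\<^sup>2"])
    show "integrable lebesgue (\<lambda>x. (w x)\<^sup>2)" using L2_square[OF w] .
    show "(\<lambda>x. (w x - clip (real n) (w x))\<^sup>2) \<in> borel_measurable lebesgue" for n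
      unfolding clip_def by measurable
    show "AE x in lebesgue. norm ((w x - clip (real n) (w x))\<^sup>2) \<le> (w x)\<^sup>2" for n
    proof (rule AE_I2)
      fix x
      have "\<bar>w x - clip (real n) (w x)\<bar> \<le> \<bar>w x\<bar>" unfolding clip_def by (auto simp: max_def min_def)
      then show "norm ((w x - clip (real n) (w x))\<^sup>2) \<le> (w x)\<^sup>2" by (simp add: abs_le_square_iff)
    qed
    show "AE x in lebesgue. (\<lambda>n. (w x - clip (real n) (w x))\<^sup>2) \<longlonglongrightarrow> 0"
    proof (rule AE_I2)
      fix x
      obtain n0 :: nat where n0: "\<bar>w x\<bar> \<le> real n0" using real_arch_simple by blast
      have "eventually (\<lambda>n. (w x - clip (real n) (w x))\<^sup>2 = 0) sequentially"
        unfolding eventually_sequentially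
      proof (intro exI[of _ n0] allI impI)
        fix n assume "n0 \<le> n"
        then have "\<bar>w x\<bar> \<le> real n" using n0 by linarith
        then show "(w x - clip (real n) (w x))\<^sup>2 = 0" unfolding clip_def by (auto simp: max_def min_def)
      qed
      then show "(\<lambda>n. (w x - clip (real n) (w x))\<^sup>2) \<longlonglongrightarrow> 0" by (rule tendsto_eventually)
    qed
  qed simp
  then have "eventually (\<lambda>n. (\<integral>x. (w x - clip (real n) (w x))\<^sup>2 \<partial>lebesgue) < e / 4) sequentially"
    using e by (intro order_tendstoD(2)) auto
  then obtain m :: nat where m: "(\<integral>x. (w x - clip (real m) (w x))\<^sup>2 \<partial>lebesgue) < e / 4"
    by (auto simp: eventually_sequentially)
  define v where "v x = clip (real m) (w x)" for x
  have vm [measurable]: "v \<in> borel_measurable lebesgue" unfolding v_def clip_def by measurable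
  \<comment> \<open>Unfolding \<open>measurable_on\<close> yields continuous functions converging to
    \<open>w\<close> off a negligible set; clipping them and multiplying by \<open>cutoff\<close>
    makes them bounded and compactly supported, with limit \<open>v\<close>.\<close>
  have "w measurable_on UNIV" by (rule lebesgue_measurable_imp_measurable_on) auto
  then obtain Z g where Z: "negligible Z" and g: "\<And>n. continuous_on UNIV (g n)"
    and gw: "\<And>x. x \<notin> Z \<Longrightarrow> (\<lambda>n. g n x) \<longlonglongrightarrow> w x"
    unfolding measurable_on_def by auto
  define c where "c n x = cutoff x * clip (real m) (g n x)" for n :: nat and x
  have c: "continuous_on UNIV (c n)" for n
    unfolding c_def by (intro continuous_on_mult cutoff continuous_on_compose2[OF clip_cont g]) auto
  have c0: "c n x = 0" if "x \<notin> cball 0 (R + 1)" for n x using cutoff(3)[OF that] by (simp add: c_def)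
  have v0: "v x = 0" if "x \<notin> cball 0 R" for x
  proof -
    have "w x = 0" using K(2) that R by blast
    then show ?thesis by (simp add: v_def clip_def)
  qed
  have clipb: "\<bar>clip (real m) t\<bar> \<le> real m" for t unfolding clip_def by auto
  have "(\<lambda>n. \<integral>x. (v x - c n x)\<^sup>2 \<partial>lebesgue) \<longlonglongrightarrow> (\<integral>x. 0 \<partial>(lebesgue::'a measure))"
  proof (rule integral_dominated_convergence[where w = "\<lambda>x. (2 * real m)\<^sup>2 * indicator (cball 0 (R + 1)) x"])
    show "integrable lebesgue (\<lambda>x. (2 * real m)\<^sup>2 * indicator (cball 0 (R + 1) :: 'a set) x)"
      using compact_integrable_indicator[of "cball 0 (R + 1) :: 'a set"] by simp
    show "(\<lambda>x. (v x - c n x)\<^sup>2) \<in> borel_measurable lebesgue" for n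
      using continuous_measurable_lebesgue[OF c[of n]] by measurable
    show "AE x in lebesgue. norm ((v x - c n x)\<^sup>2) \<le> (2 * real m)\<^sup>2 * indicator (cball 0 (R + 1)) x" for n
    proof (rule AE_I2)
      fix x
      show "norm ((v x - c n x)\<^sup>2) \<le> (2 * real m)\<^sup>2 * indicator (cball 0 (R + 1)) x"
      proof (cases "x \<in> cball 0 (R + 1)")
        case True
        have "\<bar>c n x\<bar> \<le> 1 * real m" unfolding c_def abs_mult
          using cutoff(4,5)[of x] clipb by (intro mult_mono) auto
        then have "\<bar>v x - c n x\<bar> \<le> \<bar>2 * real m\<bar>" using clipb[of "w x"] unfolding v_def by simp
        then have "(v x - c n x)\<^sup>2 \<le> (2 * real m)\<^sup>2" by (simp only: abs_le_square_iff)
        then show ?thesis using True by simp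
      next
        case False
        then have "v x = 0" using v0[of x] by simp
        then show ?thesis using c0[OF False] by simp
      qed
    qed
    have "AE x in lebesgue. x \<notin> Z" using Z by (simp add: negligible_iff_null_sets AE_not_in)
    then show "AE x in lebesgue. (\<lambda>n. (v x - c n x)\<^sup>2) \<longlonglongrightarrow> 0"
    proof eventually_elim
      case (elim x)
      have "(\<lambda>n. clip (real m) (g n x)) \<longlonglongrightarrow> clip (real m) (w x)"
        by (rule continuous_on_tendsto_compose[OF clip_cont gw[OF elim]]) auto
      then have "(\<lambda>n. c n x) \<longlonglongrightarrow> cutoff x * v x" unfolding c_def v_def by (intro tendsto_intros)
      moreover have "cutoff x * v x = v x" using cutoff(2)[of x] v0[of x] by (cases "norm x \<le> R") auto
      ultimately have "(\<lambda>n. (v x - c n x)\<^sup>2) \<longlonglongrightarrow> (v x - v x)\<^sup>2" by (intro tendsto_intros) simp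
      then show ?case by simp
    qed
  qed simp
  then have "eventually (\<lambda>n. (\<integral>x. (v x - c n x)\<^sup>2 \<partial>lebesgue) < e / 4) sequentially"
    using e by (intro order_tendstoD(2)) auto
  then obtain n where n: "(\<integral>x. (v x - c n x)\<^sup>2 \<partial>lebesgue) < e / 4"
    by (auto simp: eventually_sequentially)
  have vL: "v \<in> L2"
  proof -
    have "\<bar>v x\<bar> \<le> \<bar>w x\<bar>" for x unfolding v_def clip_def by (auto simp: max_def min_def)
    then have "(v x)\<^sup>2 \<le> (w x)\<^sup>2" for x by (simp add: abs_le_square_iff)
    then have "integrable lebesgue (\<lambda>x. (v x)\<^sup>2)"
      by (intro Bochner_Integration.integrable_bound[OF L2_square[OF w]]) auto
    then show ?thesis by (simp add: L2_def)
  qed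
  have cL: "c n \<in> L2" by (rule L2_continuous[OF c compact_cball c0])
  have "(\<integral>x. (w x - c n x)\<^sup>2 \<partial>lebesgue) \<le> (\<integral>x. 2 * (w x - v x)\<^sup>2 + 2 * (v x - c n x)\<^sup>2 \<partial>lebesgue)"
  proof (rule integral_mono)
    fix x
    have "0 \<le> ((w x - v x) - (v x - c n x))\<^sup>2" by simp
    then show "(w x - c n x)\<^sup>2 \<le> 2 * (w x - v x)\<^sup>2 + 2 * (v x - c n x)\<^sup>2"
      by (simp add: power2_eq_square algebra_simps)
  qed (use L2_square[OF L2_diff[OF w cL]] L2_square[OF L2_diff[OF w vL]] L2_square[OF L2_diff[OF vL cL]] in auto)
  also have "\<dots> = 2 * (\<integral>x. (w x - v x)\<^sup>2 \<partial>lebesgue) + 2 * (\<integral>x. (v x - c n x)\<^sup>2 \<partial>lebesgue)"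
    using L2_square[OF L2_diff[OF w vL]] L2_square[OF L2_diff[OF vL cL]] by simp
  also have "\<dots> < e" using m n unfolding v_def by linarith
  finally show thesis using that[OF c compact_cball c0] by blast
qed

text \<open>For a continuous \<open>c\<close> close to \<open>w\<close>, the error splits into the
  mollification of w - c, the error for c, and c - w. The first is no larger than the last by
  contraction; the square of a sum of three terms costs a factor 3, whence e / 9.\<close>

lemma conv_mollifier_tendsto:
  fixes w :: "'a::euclidean_space \<Rightarrow> real"
  assumes w: "w \<in> L2" and K: "compact K" "\<And>x. x \<notin> K \<Longrightarrow> w x = 0"
  shows "(\<lambda>n. \<integral>x. (conv w (mollifier n) x - w x)\<^sup>2 \<partial>lebesgue) \<longlonglongrightarrow> 0"
proof (rule LIMSEQ_I)
  fix e :: real assume e: "e > 0"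
  obtain c K' where c: "continuous_on UNIV c" "compact K'" "\<And>x. x \<notin> K' \<Longrightarrow> c x = 0"
    and ce: "(\<integral>x. (w x - c x)\<^sup>2 \<partial>lebesgue) < e / 9"
    using L2_approx_continuous[OF w K, of "e / 9"] e by auto
  have cL: "c \<in> L2" by (rule L2_continuous[OF c])
  have ci: "integrable lebesgue c" by (rule integrable_continuous_compact[OF c])
  have wi: "integrable lebesgue w" by (rule L2_integrable[OF w K])
  have dL: "(\<lambda>x. w x - c x) \<in> L2" by (rule L2_diff[OF w cL])
  have di: "integrable lebesgue (\<lambda>x. w x - c x)" using wi ci by simp
  have "eventually (\<lambda>n. (\<integral>x. (conv c (mollifier n) x - c x)\<^sup>2 \<partial>lebesgue) < e / 9) sequentially"
    using conv_mollifier_continuous_tendsto[OF c] e by (intro order_tendstoD(2)) auto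
  then obtain M where M: "\<And>n. n \<ge> M \<Longrightarrow> (\<integral>x. (conv c (mollifier n) x - c x)\<^sup>2 \<partial>lebesgue) < e / 9"
    by (auto simp: eventually_sequentially)
  have "norm ((\<integral>x. (conv w (mollifier n) x - w x)\<^sup>2 \<partial>lebesgue) - 0) < e" if n: "n \<ge> M" for n
  proof -
    let ?m = "mollifier n :: 'a \<Rightarrow> real"
    note cd = conv_mollifier_L2[OF dL di, of n]
    have cwL: "conv w ?m \<in> L2" and ccL: "conv c ?m \<in> L2"
      using conv_mollifier_L2(1)[OF w wi] conv_mollifier_L2(1)[OF cL ci] .
    have lin: "conv w ?m x = conv (\<lambda>x. w x - c x) ?m x + conv c ?m x" for x
      using integrable_conv_mollifier[OF wi, of n x] integrable_conv_mollifier[OF ci, of n x]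
      by (simp add: conv_def left_diff_distrib)
    have "(\<integral>x. (conv w ?m x - w x)\<^sup>2 \<partial>lebesgue)
        \<le> (\<integral>x. 3 * (conv (\<lambda>x. w x - c x) ?m x)\<^sup>2 + 3 * (conv c ?m x - c x)\<^sup>2 + 3 * (w x - c x)\<^sup>2 \<partial>lebesgue)"
    proof (rule integral_mono)
      fix x
      define p q r where "p = conv (\<lambda>x. w x - c x) ?m x" and "q = conv c ?m x - c x" and "r = w x - c x"
      have "conv w ?m x - w x = p + q - r" by (simp add: lin p_def q_def r_def)
      moreover have "0 \<le> (p - q)\<^sup>2" "0 \<le> (p + r)\<^sup>2" "0 \<le> (q + r)\<^sup>2" by simp_all
      then have "(p + q - r)\<^sup>2 \<le> 3 * p\<^sup>2 + 3 * q\<^sup>2 + 3 * r\<^sup>2"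
        by (simp add: power2_eq_square algebra_simps)
      ultimately have "(conv w ?m x - w x)\<^sup>2 \<le> 3 * p\<^sup>2 + 3 * q\<^sup>2 + 3 * r\<^sup>2" by (simp only:)
      then show "(conv w ?m x - w x)\<^sup>2 \<le> 3 * (conv (\<lambda>x. w x - c x) ?m x)\<^sup>2 + 3 * (conv c ?m x - c x)\<^sup>2 + 3 * (w x - c x)\<^sup>2"
        by (simp only: p_def q_def r_def)
    qed (use L2_square[OF L2_diff[OF cwL w]] L2_square[OF cd(1)] L2_square[OF L2_diff[OF ccL cL]] L2_square[OF dL] in auto)
    also have "\<dots> = 3 * (\<integral>x. (conv (\<lambda>x. w x - c x) ?m x)\<^sup>2 \<partial>lebesgue) + 3 * (\<integral>x. (conv c ?m x - c x)\<^sup>2 \<partial>lebesgue)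
        + 3 * (\<integral>x. (w x - c x)\<^sup>2 \<partial>lebesgue)"
      using L2_square[OF cd(1)] L2_square[OF L2_diff[OF ccL cL]] L2_square[OF dL] by simp
    also have "\<dots> < e" using cd(2) M[OF n] ce by linarith
    finally have "(\<integral>x. (conv w ?m x - w x)\<^sup>2 \<partial>lebesgue) < e" .
    moreover have "0 \<le> (\<integral>x. (conv w ?m x - w x)\<^sup>2 \<partial>lebesgue)" by simp
    ultimately show ?thesis by simp
  qed
  then show "\<exists>no. \<forall>n\<ge>no. norm ((\<integral>x. (conv w (mollifier n) x - w x)\<^sup>2 \<partial>lebesgue) - 0) < e" by blast
qed

lemma L2_Cauchy_Schwarz:
  assumes f: "f \<in> L2" and g: "g \<in> L2"
  shows "\<bar>\<integral>x. f x * g x \<partial>lebesgue\<bar> \<le> sqrt (\<integral>x. (f x)\<^sup>2 \<partial>lebesgue) * sqrt (\<integral>x. (g x)\<^sup>2 \<partial>lebesgue)"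
proof -
  define F G P where "F = (\<integral>x. (f x)\<^sup>2 \<partial>lebesgue)" and "G = (\<integral>x. (g x)\<^sup>2 \<partial>lebesgue)"
    and "P = (\<integral>x. f x * g x \<partial>lebesgue)"
  have q: "0 \<le> F - 2 * t * P + t\<^sup>2 * G" for t
  proof -
    have "0 \<le> (\<integral>x. (f x - t * g x)\<^sup>2 \<partial>lebesgue)" by simp
    also have "\<dots> = (\<integral>x. (f x)\<^sup>2 - (2 * t) * (f x * g x) + t\<^sup>2 * (g x)\<^sup>2 \<partial>lebesgue)"
      by (rule Bochner_Integration.integral_cong) (simp_all add: power2_eq_square algebra_simps)
    also have "\<dots> = F - 2 * t * P + t\<^sup>2 * G"
      using L2_square[OF f] L2_square[OF g] L2_mult[OF f g] by (simp add: F_def G_def P_def)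
    finally show ?thesis .
  qed
  have G: "0 \<le> G" unfolding G_def by simp
  have "P\<^sup>2 \<le> F * G"
  proof (cases "G = 0")
    case True
    have "P = 0"
    proof (rule ccontr)
      assume "P \<noteq> 0"
      \<comment> \<open>With G = 0 the quadratic in t degenerates to F - 2 t P, and this choice of t
        brings it down to -1.\<close>
      then have "F - 2 * ((F + 1) / (2 * P)) * P + ((F + 1) / (2 * P))\<^sup>2 * G = -1" using True by (simp add: field_simps)
      with q[of "(F + 1) / (2 * P)"] show False by linarith
    qed
    then show ?thesis using True by simp
  next
    case False
    then have "0 \<le> (F - 2 * (P / G) * P + (P / G)\<^sup>2 * G) * G" using q[of "P / G"] G by simp
    also have "\<dots> = F * G - P\<^sup>2" using False by (simp add: field_simps power2_eq_square)
    finally show ?thesis by simp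
  qed
  then have "sqrt (P\<^sup>2) \<le> sqrt (F * G)" by (rule real_sqrt_le_mono)
  then show ?thesis by (simp add: F_def G_def P_def real_sqrt_mult)
qed

text \<open>The difference of the products is split into (a - A)(b - B) + A (b - B) + (a - A) B;
  each piece is small by Cauchy-Schwarz, and only the norms of the limits have to be finite.\<close>

lemma L2_tendsto_mult:
  assumes a: "\<And>n. a n \<in> L2" "A \<in> L2" "(\<lambda>n. \<integral>x. (a n x - A x)\<^sup>2 \<partial>lebesgue) \<longlonglongrightarrow> 0"
    and b: "\<And>n. b n \<in> L2" "B \<in> L2" "(\<lambda>n. \<integral>x. (b n x - B x)\<^sup>2 \<partial>lebesgue) \<longlonglongrightarrow> 0"
  shows "(\<lambda>n. \<integral>x. a n x * b n x \<partial>lebesgue) \<longlonglongrightarrow> (\<integral>x. A x * B x \<partial>lebesgue)"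
proof -
  define e where "e n = sqrt (\<integral>x. (a n x - A x)\<^sup>2 \<partial>lebesgue)" for n
  define d where "d n = sqrt (\<integral>x. (b n x - B x)\<^sup>2 \<partial>lebesgue)" for n
  define nA nB where "nA = sqrt (\<integral>x. (A x)\<^sup>2 \<partial>lebesgue)" and "nB = sqrt (\<integral>x. (B x)\<^sup>2 \<partial>lebesgue)"
  have ed: "e \<longlonglongrightarrow> 0" "d \<longlonglongrightarrow> 0"
    unfolding e_def d_def using tendsto_real_sqrt[OF a(3)] tendsto_real_sqrt[OF b(3)] by simp_all
  have "\<bar>(\<integral>x. a n x * b n x \<partial>lebesgue) - (\<integral>x. A x * B x \<partial>lebesgue)\<bar> \<le> e n * d n + nA * d n + e n * nB" for n
  proof -
    have da: "(\<lambda>x. a n x - A x) \<in> L2" and db: "(\<lambda>x. b n x - B x) \<in> L2" using a b by (auto intro: L2_diff)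
    note i = L2_mult[OF da db] L2_mult[OF a(2) db] L2_mult[OF da b(2)]
    have "(\<integral>x. a n x * b n x \<partial>lebesgue) - (\<integral>x. A x * B x \<partial>lebesgue) = (\<integral>x. a n x * b n x - A x * B x \<partial>lebesgue)"
      using L2_mult[OF a(1) b(1)] L2_mult[OF a(2) b(2)] by simp
    also have "\<dots> = (\<integral>x. (a n x - A x) * (b n x - B x) + A x * (b n x - B x) + (a n x - A x) * B x \<partial>lebesgue)"
      by (rule Bochner_Integration.integral_cong) (simp_all add: algebra_simps)
    also have "\<dots> = (\<integral>x. (a n x - A x) * (b n x - B x) \<partial>lebesgue) + (\<integral>x. A x * (b n x - B x) \<partial>lebesgue)
        + (\<integral>x. (a n x - A x) * B x \<partial>lebesgue)" using i by simp
    finally show ?thesis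
      using L2_Cauchy_Schwarz[OF da db] L2_Cauchy_Schwarz[OF a(2) db] L2_Cauchy_Schwarz[OF da b(2)]
      unfolding e_def d_def nA_def nB_def by linarith
  qed
  then have "\<forall>\<^sub>F n in sequentially. norm ((\<integral>x. a n x * b n x \<partial>lebesgue) - (\<integral>x. A x * B x \<partial>lebesgue))
      \<le> e n * d n + nA * d n + e n * nB" by simp
  moreover have "(\<lambda>n. e n * d n + nA * d n + e n * nB) \<longlonglongrightarrow> 0 * 0 + nA * 0 + 0 * nB"
    by (intro tendsto_intros ed)
  then have "(\<lambda>n. e n * d n + nA * d n + e n * nB) \<longlonglongrightarrow> 0" by simp
  ultimately have "(\<lambda>n. (\<integral>x. a n x * b n x \<partial>lebesgue) - (\<integral>x. A x * B x \<partial>lebesgue)) \<longlonglongrightarrow> 0"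
    by (rule Lim_null_comparison)
  then show ?thesis by (simp add: LIM_zero_iff)
qed

lemma L2_tendsto_bounded_mult:
  assumes a: "\<And>n. a n \<in> L2" "A \<in> L2" "(\<lambda>n. \<integral>x. (a n x - A x)\<^sup>2 \<partial>lebesgue) \<longlonglongrightarrow> 0"
    and g: "g \<in> borel_measurable lebesgue" "\<And>x. \<bar>g x\<bar> \<le> B"
  shows "(\<lambda>n. \<integral>x. (a n x * g x - A x * g x)\<^sup>2 \<partial>lebesgue) \<longlonglongrightarrow> 0"
proof (rule tendsto_sandwich[OF _ _ tendsto_const])
  show "(\<lambda>n. B\<^sup>2 * (\<integral>x. (a n x - A x)\<^sup>2 \<partial>lebesgue)) \<longlonglongrightarrow> 0"
    using tendsto_mult_right_zero[OF a(3)] .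
  show "\<forall>\<^sub>F n in sequentially. (\<integral>x. (a n x * g x - A x * g x)\<^sup>2 \<partial>lebesgue) \<le> B\<^sup>2 * (\<integral>x. (a n x - A x)\<^sup>2 \<partial>lebesgue)"
  proof (rule always_eventually, rule allI)
    fix n
    have d: "(\<lambda>x. a n x - A x) \<in> L2" using a by (auto intro: L2_diff)
    have "(\<integral>x. (a n x * g x - A x * g x)\<^sup>2 \<partial>lebesgue) \<le> (\<integral>x. B\<^sup>2 * (a n x - A x)\<^sup>2 \<partial>lebesgue)"
    proof (rule integral_mono)
      show "integrable lebesgue (\<lambda>x. (a n x * g x - A x * g x)\<^sup>2)"
        using L2_square[OF L2_bounded_mult[OF d g]] by (simp add: left_diff_distrib)
      fix x
      have "(g x)\<^sup>2 \<le> B\<^sup>2" using g(2)[of x] by (metis abs_ge_zero order.trans abs_le_square_iff abs_of_nonneg)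
      from mult_right_mono[OF this zero_le_power2, of "a n x - A x"]
      show "(a n x * g x - A x * g x)\<^sup>2 \<le> B\<^sup>2 * (a n x - A x)\<^sup>2"
        by (simp only: left_diff_distrib[symmetric] power_mult_distrib mult.commute[of "(a n x - A x)\<^sup>2"])
    qed (use L2_square[OF d] in simp)
    then show "(\<integral>x. (a n x * g x - A x * g x)\<^sup>2 \<partial>lebesgue) \<le> B\<^sup>2 * (\<integral>x. (a n x - A x)\<^sup>2 \<partial>lebesgue)" by simp
  qed
qed auto

section \<open>Closure of the test functions under convergence of the function and of its
  Laplacian\<close>

text \<open>Stands in for: \<open>w\<close> is an admissible test function of class \<open>W\<^sup>2\<^sup>,\<^sup>2\<close> with Laplacian \<open>W\<close>.\<close>

definition C0_2_closure :: "('a::euclidean_space \<Rightarrow> real) \<Rightarrow> ('a \<Rightarrow> real) \<Rightarrow> bool" where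
  "C0_2_closure w W \<longleftrightarrow> w \<in> L2 \<and> W \<in> L2 \<and>
     (\<exists>K \<zeta>. compact K \<and> K \<subseteq> -{0} \<and> (\<forall>x. x \<notin> K \<longrightarrow> w x = 0 \<and> W x = 0) \<and>
       (\<forall>n. \<zeta> n \<in> C0 2 (-{0}) \<and> (\<forall>x. x \<notin> K \<longrightarrow> \<zeta> n x = 0)) \<and>
       (\<lambda>n. \<integral>x. (\<zeta> n x - w x)\<^sup>2 \<partial>lebesgue) \<longlonglongrightarrow> 0 \<and>
       (\<lambda>n. \<integral>x. (laplacian (\<zeta> n) x - W x)\<^sup>2 \<partial>lebesgue) \<longlonglongrightarrow> 0)"

lemma C0_2_closureE:
  assumes "C0_2_closure w W"
  obtains K \<zeta> where "w \<in> L2" "W \<in> L2" "compact K" "K \<subseteq> -{0}" "\<And>x. x \<notin> K \<Longrightarrow> w x = 0" "\<And>x. x \<notin> K \<Longrightarrow> W x = 0"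
    "\<And>n. \<zeta> n \<in> C0 2 (-{0})" "\<And>n x. x \<notin> K \<Longrightarrow> \<zeta> n x = 0" "\<And>n x. x \<notin> K \<Longrightarrow> laplacian (\<zeta> n) x = 0"
    "\<And>n. \<zeta> n \<in> L2" "\<And>n. laplacian (\<zeta> n) \<in> L2"
    "(\<lambda>n. \<integral>x. (\<zeta> n x - w x)\<^sup>2 \<partial>lebesgue) \<longlonglongrightarrow> 0"
    "(\<lambda>n. \<integral>x. (laplacian (\<zeta> n) x - W x)\<^sup>2 \<partial>lebesgue) \<longlonglongrightarrow> 0"
  using assms unfolding C0_2_closure_def
proof (elim conjE exE)
  fix K \<zeta> assume w: "w \<in> L2" "W \<in> L2" and K: "compact K" "K \<subseteq> -{0}"
    and wK: "\<forall>x. x \<notin> K \<longrightarrow> w x = 0 \<and> W x = 0"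
    and z': "\<forall>n. \<zeta> n \<in> C0 2 (-{0}) \<and> (\<forall>x. x \<notin> K \<longrightarrow> \<zeta> n x = 0)"
    and l: "(\<lambda>n. \<integral>x. (\<zeta> n x - w x)\<^sup>2 \<partial>lebesgue) \<longlonglongrightarrow> 0"
    "(\<lambda>n. \<integral>x. (laplacian (\<zeta> n) x - W x)\<^sup>2 \<partial>lebesgue) \<longlonglongrightarrow> 0"
  have z: "\<zeta> n \<in> C0 2 (-{0})" for n using z' by simp
  have zK: "\<zeta> n x = 0" if "x \<notin> K" for n x using z' that by simp
  have lK: "laplacian (\<zeta> n) x = 0" if "x \<notin> K" for n x
    using C0_2_laplacian(3)[OF z compact_imp_closed[OF K(1)] zK that] .
  have "\<zeta> n \<in> L2" "laplacian (\<zeta> n) \<in> L2" for n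
    using L2_continuous[OF C0_2_laplacian(1)[OF z] K(1) zK] L2_continuous[OF C0_2_laplacian(2)[OF z] K(1) lK] by blast+
  note zL = this
  have wK': "w x = 0" "W x = 0" if "x \<notin> K" for x using wK that by simp_all
  show thesis by (rule that) fact+
qed

text \<open>Powers of the norm are bounded on compact sets off the origin. With the indicator
  attached they are globally bounded multipliers, which reduces weighted integrals of functions
  supported in \<open>K\<close> to the unweighted \<open>L2\<close> lemmas.\<close>

lemma compact_powr_weight:
  fixes K :: "'a::euclidean_space set"
  assumes "compact K" "K \<subseteq> -{0}"
  obtains B where "(\<lambda>x. indicator K x * norm x powr s) \<in> borel_measurable lebesgue"
    "\<And>x. \<bar>indicator K x * norm x powr s\<bar> \<le> B"
proof -
  have c: "continuous_on K (\<lambda>x. norm x powr s)" using assms by (intro continuous_intros) auto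
  have "(\<lambda>x. indicator K x *\<^sub>R norm x powr s) \<in> borel_measurable borel"
    using c assms(1) by (intro borel_measurable_continuous_on_indicator) (auto simp: compact_imp_closed borel_closed)
  then have m: "(\<lambda>x. indicator K x * norm x powr s) \<in> borel_measurable lebesgue" by (simp add: measurable_completion)
  obtain B where "B > 0" "\<And>x. \<bar>indicator K x * norm x powr s\<bar> \<le> B"
  proof (rule continuous_compact_bounded[OF _ assms(1), of "\<lambda>x. indicator K x * norm x powr s"])
    show "continuous_on K (\<lambda>x. indicator K x * norm x powr s)"
      by (rule continuous_on_eq[OF c]) simp
  qed auto
  with m that show thesis by blast
qed

lemma C0_2_closure_weighted_inequality:
  fixes w :: "'a::euclidean_space \<Rightarrow> real"
  assumes w: "C0_2_closure w W" and \<sigma>: "\<sigma> = (real DIM('a) - 4 - \<beta>) / 2"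
  shows "\<sigma> * (\<sigma> + 2 + \<beta>) * (\<integral>x. (w x)\<^sup>2 * norm x powr (-4 - \<beta>) \<partial>lebesgue)
    \<le> - (\<integral>x. w x * W x * norm x powr (-2 - \<beta>) \<partial>lebesgue)"
  using w
proof (rule C0_2_closureE)
  fix K \<zeta> assume L: "w \<in> L2" "W \<in> L2" and K: "compact K" "K \<subseteq> -{0}" and wK: "\<And>x. x \<notin> K \<Longrightarrow> w x = 0" "\<And>x. x \<notin> K \<Longrightarrow> W x = 0"
    and z: "\<And>n. \<zeta> n \<in> C0 2 (-{0})" "\<And>n x. x \<notin> K \<Longrightarrow> \<zeta> n x = 0" "\<And>n x. x \<notin> K \<Longrightarrow> laplacian (\<zeta> n) x = 0"
    and zL: "\<And>n. \<zeta> n \<in> L2" "\<And>n. laplacian (\<zeta> n) \<in> L2"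
    and lim: "(\<lambda>n. \<integral>x. (\<zeta> n x - w x)\<^sup>2 \<partial>lebesgue) \<longlonglongrightarrow> 0"
    "(\<lambda>n. \<integral>x. (laplacian (\<zeta> n) x - W x)\<^sup>2 \<partial>lebesgue) \<longlonglongrightarrow> 0"
  have conv: "(\<lambda>n. \<integral>x. \<zeta> n x * b n x * norm x powr s \<partial>lebesgue) \<longlonglongrightarrow> (\<integral>x. w x * B x * norm x powr s \<partial>lebesgue)"
    if b: "\<And>n. b n \<in> L2" "B \<in> L2" "(\<lambda>n. \<integral>x. (b n x - B x)\<^sup>2 \<partial>lebesgue) \<longlonglongrightarrow> 0" for b B s
  proof -
    obtain C where C: "(\<lambda>x. indicator K x * norm x powr s) \<in> borel_measurable lebesgue"
      "\<And>x. \<bar>indicator K x * norm x powr s\<bar> \<le> C" using compact_powr_weight[OF K, of s] by blast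
    note t = L2_tendsto_mult[OF L2_bounded_mult[OF zL(1) C] L2_bounded_mult[OF L(1) C]
      L2_tendsto_bounded_mult[OF zL(1) L(1) lim(1) C] b]
    moreover have "(\<lambda>x. \<zeta> n x * (indicator K x * norm x powr s) * b n x) = (\<lambda>x. \<zeta> n x * b n x * norm x powr s)" for n
      using z(2) by (auto simp: indicator_def fun_eq_iff)
    moreover have "(\<lambda>x. w x * (indicator K x * norm x powr s) * B x) = (\<lambda>x. w x * B x * norm x powr s)"
      using wK(1) by (auto simp: indicator_def fun_eq_iff)
    ultimately show ?thesis by simp
  qed
  show ?thesis
  proof (rule LIMSEQ_le)
    show "(\<lambda>n. \<sigma> * (\<sigma> + 2 + \<beta>) * (\<integral>x. (\<zeta> n x)\<^sup>2 * norm x powr (-4 - \<beta>) \<partial>lebesgue)) \<longlonglongrightarrow>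
        \<sigma> * (\<sigma> + 2 + \<beta>) * (\<integral>x. (w x)\<^sup>2 * norm x powr (-4 - \<beta>) \<partial>lebesgue)"
      using conv[OF zL(1) L(1) lim(1), of "-4 - \<beta>"] by (intro tendsto_intros) (simp add: power2_eq_square)
    show "(\<lambda>n. - (\<integral>x. \<zeta> n x * laplacian (\<zeta> n) x * norm x powr (-2 - \<beta>) \<partial>lebesgue)) \<longlonglongrightarrow>
        - (\<integral>x. w x * W x * norm x powr (-2 - \<beta>) \<partial>lebesgue)"
      using conv[OF zL(2) L(2) lim(2), of "-2 - \<beta>"] by (intro tendsto_intros)
  qed (use weighted_laplacian_inequality[OF z(1) \<sigma>] in blast)
qed

text \<open>The upper bounds \<open>c n\<close> may vary with n and only their limit enters, as
  required when the right-hand side of the stability inequality converges together with the test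
  functions.\<close>

lemma Fatou_integrable:
  fixes f :: "nat \<Rightarrow> 'a \<Rightarrow> real"
  assumes f: "\<And>n. integrable M (f n)" "\<And>n x. 0 \<le> f n x" and c: "\<And>n. integral\<^sup>L M (f n) \<le> c n" "c \<longlonglongrightarrow> C"
    and lim: "AE x in M. (\<lambda>n. f n x) \<longlonglongrightarrow> g x" and g: "g \<in> borel_measurable M" "\<And>x. 0 \<le> g x"
  shows "integrable M g" "integral\<^sup>L M g \<le> C"
proof -
  have c0: "0 \<le> c n" for n using c(1)[of n] Bochner_Integration.integral_nonneg[of M "f n"] f(2) by (meson order.trans)
  then have C0: "0 \<le> C" using c(2) by (meson LIMSEQ_le_const)
  have "(\<integral>\<^sup>+x. ennreal (g x) \<partial>M) = (\<integral>\<^sup>+x. liminf (\<lambda>n. ennreal (f n x)) \<partial>M)"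
  proof (rule nn_integral_cong_AE)
    show "AE x in M. ennreal (g x) = liminf (\<lambda>n. ennreal (f n x))"
      using lim
    proof eventually_elim
      case (elim x)
      then have "(\<lambda>n. ennreal (f n x)) \<longlonglongrightarrow> ennreal (g x)" by (rule tendsto_ennrealI)
      then show ?case using lim_imp_Liminf by (metis sequentially_bot)
    qed
  qed
  also have "\<dots> \<le> liminf (\<lambda>n. \<integral>\<^sup>+x. ennreal (f n x) \<partial>M)"
    using f(1) by (intro nn_integral_liminf) auto
  also have "\<dots> \<le> liminf (\<lambda>n. ennreal (c n))"
    using nn_integral_eq_integral[OF f(1)] f(2) c(1) by (intro Liminf_mono always_eventually) (auto intro: ennreal_leI)
  also have "\<dots> = ennreal C"
    using lim_imp_Liminf[OF _ tendsto_ennrealI[OF c(2)]] by simp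
  finally have le: "(\<integral>\<^sup>+x. ennreal (g x) \<partial>M) \<le> ennreal C" .
  show i: "integrable M g"
    by (rule integrableI_nonneg) (use g le in \<open>auto simp: le_less_trans[OF le]\<close>)
  show "integral\<^sup>L M g \<le> C"
    using le nn_integral_eq_integral[OF i] g(2) C0 by simp
qed

text \<open>Nothing bounds \<open>V\<close>, so convergence of the test functions in the mean says
  nothing directly about the left side. Along an almost everywhere convergent subsequence Fatou's
  lemma gives the inequality and with it the integrability of V w^2; the right side converges
  because the Laplacians do.\<close>

lemma C0_2_closure_stability:
  fixes w :: "'a::euclidean_space \<Rightarrow> real"
  assumes w: "C0_2_closure w W" and V: "V \<in> borel_measurable lebesgue" "\<And>x. 0 \<le> V x"
    and st: "\<And>\<zeta>. \<zeta> \<in> C0 2 (-{0}) \<Longrightarrow> integrable lebesgue (\<lambda>x. V x * (\<zeta> x)\<^sup>2) \<and>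
       p * (\<integral>x. V x * (\<zeta> x)\<^sup>2 \<partial>lebesgue) \<le> (\<integral>x. (laplacian \<zeta> x)\<^sup>2 * norm x powr s \<partial>lebesgue)"
    and p: "p > 0"
  shows "integrable lebesgue (\<lambda>x. V x * (w x)\<^sup>2)"
    "p * (\<integral>x. V x * (w x)\<^sup>2 \<partial>lebesgue) \<le> (\<integral>x. (W x)\<^sup>2 * norm x powr s \<partial>lebesgue)"
proof -
  obtain K \<zeta> where L: "w \<in> L2" "W \<in> L2" and K: "compact K" "K \<subseteq> -{0}" and wK: "\<And>x. x \<notin> K \<Longrightarrow> w x = 0" "\<And>x. x \<notin> K \<Longrightarrow> W x = 0"
    and z: "\<And>n. \<zeta> n \<in> C0 2 (-{0})" "\<And>n x. x \<notin> K \<Longrightarrow> \<zeta> n x = 0" "\<And>n x. x \<notin> K \<Longrightarrow> laplacian (\<zeta> n) x = 0"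
    and zL: "\<And>n. \<zeta> n \<in> L2" "\<And>n. laplacian (\<zeta> n) \<in> L2"
    and lim: "(\<lambda>n. \<integral>x. (\<zeta> n x - w x)\<^sup>2 \<partial>lebesgue) \<longlonglongrightarrow> 0"
    "(\<lambda>n. \<integral>x. (laplacian (\<zeta> n) x - W x)\<^sup>2 \<partial>lebesgue) \<longlonglongrightarrow> 0"
    using w by (rule C0_2_closureE) blast
  obtain C where C: "(\<lambda>x. indicator K x * norm x powr s) \<in> borel_measurable lebesgue"
    "\<And>x. \<bar>indicator K x * norm x powr s\<bar> \<le> C" using compact_powr_weight[OF K, of s] by blast
  have "(\<lambda>n. \<integral>x. laplacian (\<zeta> n) x * (indicator K x * norm x powr s) * laplacian (\<zeta> n) x \<partial>lebesgue) \<longlonglongrightarrow>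
      (\<integral>x. W x * (indicator K x * norm x powr s) * W x \<partial>lebesgue)"
    by (rule L2_tendsto_mult[OF L2_bounded_mult[OF zL(2) C] L2_bounded_mult[OF L(2) C]
      L2_tendsto_bounded_mult[OF zL(2) L(2) lim(2) C] zL(2) L(2) lim(2)])
  moreover have "(\<lambda>x. laplacian (\<zeta> n) x * (indicator K x * norm x powr s) * laplacian (\<zeta> n) x) = (\<lambda>x. (laplacian (\<zeta> n) x)\<^sup>2 * norm x powr s)" for n
    using z(3) by (auto simp: indicator_def fun_eq_iff power2_eq_square)
  moreover have "(\<lambda>x. W x * (indicator K x * norm x powr s) * W x) = (\<lambda>x. (W x)\<^sup>2 * norm x powr s)"
    using wK(2) by (auto simp: indicator_def fun_eq_iff power2_eq_square)
  ultimately have limW: "(\<lambda>n. \<integral>x. (laplacian (\<zeta> n) x)\<^sup>2 * norm x powr s \<partial>lebesgue) \<longlonglongrightarrow> (\<integral>x. (W x)\<^sup>2 * norm x powr s \<partial>lebesgue)"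
    by simp
  have "\<exists>r::nat\<Rightarrow>nat. strict_mono r \<and> (AE x in lebesgue. (\<lambda>n. (\<zeta> (r n) x - w x)\<^sup>2) \<longlonglongrightarrow> 0)"
    by (rule tendsto_L1_AE_subseq) (use L2_square[OF L2_diff[OF zL(1) L(1)]] lim(1) in auto)
  then obtain r :: "nat \<Rightarrow> nat" where r: "strict_mono r" "AE x in lebesgue. (\<lambda>n. (\<zeta> (r n) x - w x)\<^sup>2) \<longlonglongrightarrow> 0" by blast
  have ae: "AE x in lebesgue. (\<lambda>n. V x * (\<zeta> (r n) x)\<^sup>2) \<longlonglongrightarrow> V x * (w x)\<^sup>2"
    using r(2)
  proof eventually_elim
    case (elim x)
    then have "(\<lambda>n. sqrt ((\<zeta> (r n) x - w x)\<^sup>2)) \<longlonglongrightarrow> 0" using tendsto_real_sqrt by fastforce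
    then have "(\<lambda>n. \<zeta> (r n) x - w x) \<longlonglongrightarrow> 0" by (simp add: tendsto_rabs_zero_iff)
    then have "(\<lambda>n. \<zeta> (r n) x) \<longlonglongrightarrow> w x" by (simp add: LIM_zero_iff)
    then show ?case by (intro tendsto_intros)
  qed
  have le: "(\<integral>x. V x * (\<zeta> (r n) x)\<^sup>2 \<partial>lebesgue) \<le> (\<integral>x. (laplacian (\<zeta> (r n)) x)\<^sup>2 * norm x powr s \<partial>lebesgue) / p" for n
    using st[OF z(1), of "r n"] p by (simp add: field_simps)
  have lim': "(\<lambda>n. (\<integral>x. (laplacian (\<zeta> (r n)) x)\<^sup>2 * norm x powr s \<partial>lebesgue) / p) \<longlonglongrightarrow> (\<integral>x. (W x)\<^sup>2 * norm x powr s \<partial>lebesgue) / p"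
    using LIMSEQ_subseq_LIMSEQ[OF limW r(1)] p by (intro tendsto_intros) (auto simp: comp_def)
  have m: "(\<lambda>x. V x * (w x)\<^sup>2) \<in> borel_measurable lebesgue"
    using V(1) L2_measurable[OF L(1)] by measurable
  note F = Fatou_integrable[OF _ _ le lim' ae m]
  show "integrable lebesgue (\<lambda>x. V x * (w x)\<^sup>2)" using F(1) st[OF z(1)] V(2) by simp
  have "(\<integral>x. V x * (w x)\<^sup>2 \<partial>lebesgue) \<le> (\<integral>x. (W x)\<^sup>2 * norm x powr s \<partial>lebesgue) / p"
    using F(2) st[OF z(1)] V(2) by simp
  then show "p * (\<integral>x. V x * (w x)\<^sup>2 \<partial>lebesgue) \<le> (\<integral>x. (W x)\<^sup>2 * norm x powr s \<partial>lebesgue)"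
    using p by (simp add: field_simps)
qed

lemma laplacian_diff:
  assumes "C_k 2 f" "C_k 2 g"
  shows "laplacian (\<lambda>x. f x - g x) = (\<lambda>x. laplacian f x - laplacian g x)"
proof
  fix x
  have f: "C_k (Suc 1) f" "C_k (Suc 1) g" using assms by (simp_all add: numeral_2_eq_2)
  have "partial b (partial b (\<lambda>x. f x - g x)) x = partial b (partial b f) x - partial b (partial b g) x" if "b \<in> Basis" for b
  proof -
    have "partial b (\<lambda>x. f x - g x) = (\<lambda>x. partial b f x - partial b g x)"
      using C_k_SucD(1)[OF f(1)] C_k_SucD(1)[OF f(2)] by (intro ext partial_diff)
    then show ?thesis
      using C_k_SucD(2)[OF f(1) that] C_k_SucD(2)[OF f(2) that] by (simp add: partial_diff)
  qed
  then show "laplacian (\<lambda>x. f x - g x) x = laplacian f x - laplacian g x"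
    by (simp add: laplacian_def sum_subtractf)
qed

lemma C0_diff:
  assumes "f \<in> C0 k \<Omega>" "g \<in> C0 k \<Omega>" shows "(\<lambda>x. f x - g x) \<in> C0 k \<Omega>"
proof -
  obtain K where K: "C_k k f" "compact K" "K \<subseteq> \<Omega>" "\<And>x. x \<notin> K \<Longrightarrow> f x = 0" using assms(1) by (rule C0E) blast
  obtain K' where K': "C_k k g" "compact K'" "K' \<subseteq> \<Omega>" "\<And>x. x \<notin> K' \<Longrightarrow> g x = 0" using assms(2) by (rule C0E) blast
  show ?thesis using K K' by (intro C0I[of _ _ "K \<union> K'"] C_k_diff) auto
qed

text \<open>Makes stability applicable to the difference between a test function and
  \<open>w\<close>, which is where the weak equation gets its error bound.\<close>

lemma C0_2_closure_diff:
  assumes \<zeta>: "\<zeta> \<in> C0 2 (-{0})" and w: "C0_2_closure w W"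
  shows "C0_2_closure (\<lambda>x. \<zeta> x - w x) (\<lambda>x. laplacian \<zeta> x - W x)"
proof -
  obtain K' where K': "C_k 2 \<zeta>" "compact K'" "K' \<subseteq> -{0}" "\<And>x. x \<notin> K' \<Longrightarrow> \<zeta> x = 0" using \<zeta> by (rule C0E) blast
  have lK': "laplacian \<zeta> x = 0" if "x \<notin> K'" for x
    using C0_2_laplacian(3)[OF \<zeta> compact_imp_closed[OF K'(2)] K'(4) that] .
  have \<zeta>L: "\<zeta> \<in> L2" "laplacian \<zeta> \<in> L2"
    using L2_continuous[OF C0_2_laplacian(1)[OF \<zeta>] K'(2,4)] L2_continuous[OF C0_2_laplacian(2)[OF \<zeta>] K'(2) lK'] by blast+
  obtain K z where L: "w \<in> L2" "W \<in> L2" and K: "compact K" "K \<subseteq> -{0}" and wK: "\<And>x. x \<notin> K \<Longrightarrow> w x = 0" "\<And>x. x \<notin> K \<Longrightarrow> W x = 0"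
    and z: "\<And>n. z n \<in> C0 2 (-{0})" "\<And>n x. x \<notin> K \<Longrightarrow> z n x = 0"
    and lim: "(\<lambda>n. \<integral>x. (z n x - w x)\<^sup>2 \<partial>lebesgue) \<longlonglongrightarrow> 0"
    "(\<lambda>n. \<integral>x. (laplacian (z n) x - W x)\<^sup>2 \<partial>lebesgue) \<longlonglongrightarrow> 0"
    using w by (rule C0_2_closureE) blast
  have zk: "C_k 2 (z n)" for n using z(1) by (simp add: C0_def)
  have e1: "(\<zeta> x - z n x - (\<zeta> x - w x))\<^sup>2 = (z n x - w x)\<^sup>2" for n x by (simp add: power2_commute)
  have e2: "(laplacian (\<lambda>x. \<zeta> x - z n x) x - (laplacian \<zeta> x - W x))\<^sup>2 = (laplacian (z n) x - W x)\<^sup>2" for n x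
    by (simp add: laplacian_diff[OF K'(1) zk] power2_commute)
  show ?thesis unfolding C0_2_closure_def
  proof (intro conjI exI[of _ "K \<union> K'"] exI[of _ "\<lambda>n x. \<zeta> x - z n x"] allI impI)
    show "(\<lambda>x. \<zeta> x - w x) \<in> L2" "(\<lambda>x. laplacian \<zeta> x - W x) \<in> L2" using \<zeta>L L by (auto intro: L2_diff)
    show "(\<lambda>x. \<zeta> x - z n x) \<in> C0 2 (-{0})" for n using \<zeta> z(1) by (rule C0_diff)
  qed (use K K' wK lK' z lim e1 e2 in auto)
qed

text \<open>The nonlinear term is the pairing of sqrt V u with sqrt V \<zeta>. The first factor is
  locally square integrable by hypothesis; for the second, stability applied to the approximation
  error of \<open>w\<close> bounds it by the error of the Laplacians. Hence both sides of the
  equation pass to the limit.\<close>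

lemma C0_2_closure_weak_equation:
  fixes w :: "'a::euclidean_space \<Rightarrow> real"
  assumes w: "C0_2_closure w W" and V: "V \<in> borel_measurable lebesgue" "\<And>x. 0 \<le> V x"
    and st: "\<And>\<zeta>. \<zeta> \<in> C0 2 (-{0}) \<Longrightarrow> integrable lebesgue (\<lambda>x. V x * (\<zeta> x)\<^sup>2) \<and>
       p * (\<integral>x. V x * (\<zeta> x)\<^sup>2 \<partial>lebesgue) \<le> (\<integral>x. (laplacian \<zeta> x)\<^sup>2 * norm x powr s \<partial>lebesgue)"
    and p: "p > 0"
    and u: "u \<in> borel_measurable lebesgue" "\<And>K. compact K \<Longrightarrow> K \<subseteq> -{0} \<Longrightarrow> integrable lebesgue (\<lambda>x. indicator K x * (V x * (u x)\<^sup>2))"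
    and f: "\<And>K. compact K \<Longrightarrow> K \<subseteq> -{0} \<Longrightarrow> (\<lambda>x. indicator K x * f x) \<in> L2"
    and eq: "\<And>\<zeta>. \<zeta> \<in> C0 2 (-{0}) \<Longrightarrow> (\<integral>x. f x * laplacian \<zeta> x \<partial>lebesgue) = (\<integral>x. V x * u x * \<zeta> x \<partial>lebesgue)"
  shows "(\<integral>x. f x * W x \<partial>lebesgue) = (\<integral>x. V x * u x * w x \<partial>lebesgue)"
proof -
  obtain K \<zeta> where L: "w \<in> L2" "W \<in> L2" and K: "compact K" "K \<subseteq> -{0}" and wK: "\<And>x. x \<notin> K \<Longrightarrow> w x = 0" "\<And>x. x \<notin> K \<Longrightarrow> W x = 0"
    and z: "\<And>n. \<zeta> n \<in> C0 2 (-{0})" "\<And>n x. x \<notin> K \<Longrightarrow> \<zeta> n x = 0" "\<And>n x. x \<notin> K \<Longrightarrow> laplacian (\<zeta> n) x = 0"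
    and zL: "\<And>n. \<zeta> n \<in> L2" "\<And>n. laplacian (\<zeta> n) \<in> L2"
    and lim: "(\<lambda>n. \<integral>x. (\<zeta> n x - w x)\<^sup>2 \<partial>lebesgue) \<longlonglongrightarrow> 0"
    "(\<lambda>n. \<integral>x. (laplacian (\<zeta> n) x - W x)\<^sup>2 \<partial>lebesgue) \<longlonglongrightarrow> 0"
    using w by (rule C0_2_closureE) blast
  have "(\<lambda>n. \<integral>x. (indicator K x * f x) * laplacian (\<zeta> n) x \<partial>lebesgue) \<longlonglongrightarrow> (\<integral>x. (indicator K x * f x) * W x \<partial>lebesgue)"
    by (rule L2_tendsto_mult[OF f[OF K] f[OF K] _ zL(2) L(2) lim(2)]) simp
  moreover have "(\<lambda>x. (indicator K x * f x) * laplacian (\<zeta> n) x) = (\<lambda>x. f x * laplacian (\<zeta> n) x)" for n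
    using z(3) by (auto simp: indicator_def fun_eq_iff)
  moreover have "(\<lambda>x. (indicator K x * f x) * W x) = (\<lambda>x. f x * W x)"
    using wK(2) by (auto simp: indicator_def fun_eq_iff)
  ultimately have l1: "(\<lambda>n. \<integral>x. f x * laplacian (\<zeta> n) x \<partial>lebesgue) \<longlonglongrightarrow> (\<integral>x. f x * W x \<partial>lebesgue)" by simp
  define q where "q x = sqrt (V x)" for x
  have q: "q \<in> borel_measurable lebesgue" "\<And>x. q x * q x = V x" using V by (auto simp: q_def[abs_def])
  have q2: "(q x * t)\<^sup>2 = V x * t\<^sup>2" for x t by (simp add: power2_eq_square q(2)[symmetric])
  have quL: "(\<lambda>x. indicator K x * (q x * u x)) \<in> L2"
  proof -
    have "indicator K x * (V x * (u x)\<^sup>2) = (indicator K x * (q x * u x))\<^sup>2" for x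
      by (simp add: q2 indicator_def)
    with u(2)[OF K] have i: "integrable lebesgue (\<lambda>x. (indicator K x * (q x * u x))\<^sup>2)" by simp
    have "indicat_real K \<in> borel_measurable lebesgue" using compact_integrable_indicator[OF K(1)] by simp
    with q(1) u(1) have "(\<lambda>x. indicator K x * (q x * u x)) \<in> borel_measurable lebesgue" by simp
    with i show ?thesis by (simp add: L2_def)
  qed
  have zq: "(\<lambda>x. q x * \<zeta> n x) \<in> L2" for n
    using st[OF z(1), of n] q(1) L2_measurable[OF zL(1)] by (simp add: L2_def q2)
  have wq: "(\<lambda>x. q x * w x) \<in> L2"
    using C0_2_closure_stability(1)[OF w V st p] q(1) L2_measurable[OF L(1)] by (simp add: L2_def q2)
  obtain C where C: "(\<lambda>x. indicator K x * norm x powr s) \<in> borel_measurable lebesgue"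
    "\<And>x. \<bar>indicator K x * norm x powr s\<bar> \<le> C" using compact_powr_weight[OF K, of s] by blast
  have "(\<lambda>n. \<integral>x. (q x * \<zeta> n x - q x * w x)\<^sup>2 \<partial>lebesgue) \<longlonglongrightarrow> 0"
  proof (rule tendsto_sandwich[OF _ _ tendsto_const])
    show "(\<lambda>n. C * (\<integral>x. (laplacian (\<zeta> n) x - W x)\<^sup>2 \<partial>lebesgue) / p) \<longlonglongrightarrow> 0"
      using tendsto_divide[OF tendsto_mult_right_zero[OF lim(2), of C] tendsto_const, of p] p by simp
    show "\<forall>\<^sub>F n in sequentially. (\<integral>x. (q x * \<zeta> n x - q x * w x)\<^sup>2 \<partial>lebesgue) \<le> C * (\<integral>x. (laplacian (\<zeta> n) x - W x)\<^sup>2 \<partial>lebesgue) / p"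
    proof (rule always_eventually, rule allI)
      fix n
      have dL: "(\<lambda>x. laplacian (\<zeta> n) x - W x) \<in> L2" using L2_diff[OF zL(2) L(2)] .
      have "p * (\<integral>x. V x * (\<zeta> n x - w x)\<^sup>2 \<partial>lebesgue) \<le> (\<integral>x. (laplacian (\<zeta> n) x - W x)\<^sup>2 * norm x powr s \<partial>lebesgue)"
        by (rule C0_2_closure_stability(2)[OF C0_2_closure_diff[OF z(1) w] V st p])
      also have "\<dots> = (\<integral>x. (laplacian (\<zeta> n) x - W x)\<^sup>2 * (indicator K x * norm x powr s) \<partial>lebesgue)"
        by (rule Bochner_Integration.integral_cong) (use z(3) wK(2) in \<open>auto simp: indicator_def\<close>)
      also have "\<dots> \<le> (\<integral>x. (laplacian (\<zeta> n) x - W x)\<^sup>2 * C \<partial>lebesgue)"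
      proof (rule integral_mono)
        show "integrable lebesgue (\<lambda>x. (laplacian (\<zeta> n) x - W x)\<^sup>2 * (indicator K x * norm x powr s))"
          by (rule integrable_bounded_mult[OF L2_square[OF dL] C])
        show "integrable lebesgue (\<lambda>x. (laplacian (\<zeta> n) x - W x)\<^sup>2 * C)" using L2_square[OF dL] by simp
        show "(laplacian (\<zeta> n) x - W x)\<^sup>2 * (indicator K x * norm x powr s) \<le> (laplacian (\<zeta> n) x - W x)\<^sup>2 * C" for x
          using C(2)[of x] by (intro mult_left_mono) auto
      qed
      finally have "p * (\<integral>x. V x * (\<zeta> n x - w x)\<^sup>2 \<partial>lebesgue) \<le> C * (\<integral>x. (laplacian (\<zeta> n) x - W x)\<^sup>2 \<partial>lebesgue)"
        by (simp add: mult.commute)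
      moreover have "(q x * \<zeta> n x - q x * w x)\<^sup>2 = V x * (\<zeta> n x - w x)\<^sup>2" for x
        by (simp only: q2 flip: right_diff_distrib)
      ultimately show "(\<integral>x. (q x * \<zeta> n x - q x * w x)\<^sup>2 \<partial>lebesgue) \<le> C * (\<integral>x. (laplacian (\<zeta> n) x - W x)\<^sup>2 \<partial>lebesgue) / p"
        using p by (simp add: field_simps)
    qed
  qed auto
  then have "(\<lambda>n. \<integral>x. (indicator K x * (q x * u x)) * (q x * \<zeta> n x) \<partial>lebesgue) \<longlonglongrightarrow> (\<integral>x. (indicator K x * (q x * u x)) * (q x * w x) \<partial>lebesgue)"
    by (intro L2_tendsto_mult[OF quL quL _ zq wq]) simp_all
  moreover have "(\<lambda>x. (indicator K x * (q x * u x)) * (q x * \<zeta> n x)) = (\<lambda>x. V x * u x * \<zeta> n x)" for n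
    using z(2) by (auto simp: indicator_def fun_eq_iff q(2)[symmetric])
  moreover have "(\<lambda>x. (indicator K x * (q x * u x)) * (q x * w x)) = (\<lambda>x. V x * u x * w x)"
    using wK(1) by (auto simp: indicator_def fun_eq_iff q(2)[symmetric])
  ultimately have l2: "(\<lambda>n. \<integral>x. V x * u x * \<zeta> n x \<partial>lebesgue) \<longlonglongrightarrow> (\<integral>x. V x * u x * w x \<partial>lebesgue)" by simp
  show ?thesis using l1 l2 unfolding eq[OF z(1)] by (rule LIMSEQ_unique)
qed

lemma laplacian_affine:
  fixes \<psi> :: "'a::euclidean_space \<Rightarrow> real"
  assumes "C_k 2 \<psi>"
  shows "laplacian (\<lambda>y. \<psi> (a + c *\<^sub>R y)) y = c\<^sup>2 * laplacian \<psi> (a + c *\<^sub>R y)"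
proof -
  have f: "C_k (Suc 1) \<psi>" using assms by (simp add: numeral_2_eq_2)
  have "partial b (partial b (\<lambda>y. \<psi> (a + c *\<^sub>R y))) y = c\<^sup>2 * partial b (partial b \<psi>) (a + c *\<^sub>R y)" if b: "b \<in> Basis" for b
  proof -
    have d: "partial b \<psi> differentiable (at y)" for y
      using C_k_SucD(2)[OF f b] by simp
    have "partial b (\<lambda>y. \<psi> (a + c *\<^sub>R y)) = (\<lambda>y. c * partial b \<psi> (a + c *\<^sub>R y))"
      using C_k_SucD(1)[OF f] by (intro ext partial_affine(1))
    then show ?thesis
      using partial_affine(1)[of "partial b \<psi>" b a c y] partial_affine(2)[of "partial b \<psi>" a c y] d
      by (simp add: partial_cmult power2_eq_square)
  qed
  then show ?thesis by (simp add: laplacian_def sum_distrib_left)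
qed

lemma laplacian_reflect:
  "C_k 2 \<psi> \<Longrightarrow> laplacian (\<lambda>y. \<psi> (x - y)) y = laplacian \<psi> (x - y)"
  using laplacian_affine[of \<psi> x "-1" y] by simp

lemma C_k_mollifier_reflect: "C_k k (\<lambda>y. mollifier n (x - y))"
  using C_k_affine[OF C_k_mollifier, of k n x "-1"] by simp

text \<open>The hypothesis \<open>weak\<close> says that \<open>W\<close> is the Laplacian of
  \<open>w\<close> in the sense of distributions; as \<open>w\<close> has compact support, every
  smooth \<psi> can be used. Testing with a reflected mollifier shows that the Laplacian of the
  mollified \<open>w\<close> is the mollified \<open>W\<close>, so mollifications are the required
  approximants.\<close>

lemma C0_2_closureI:
  fixes w :: "'a::euclidean_space \<Rightarrow> real"
  assumes L: "w \<in> L2" "W \<in> L2" and K: "compact K" "K \<subseteq> -{0}" and wK: "\<And>x. x \<notin> K \<Longrightarrow> w x = 0" "\<And>x. x \<notin> K \<Longrightarrow> W x = 0"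
    and weak: "\<And>\<psi>. (\<And>k. C_k k \<psi>) \<Longrightarrow> (\<integral>x. w x * laplacian \<psi> x \<partial>lebesgue) = (\<integral>x. W x * \<psi> x \<partial>lebesgue)"
  shows "C0_2_closure w W"
proof -
  have "0 \<in> -K" "open (-K)" using K by (auto simp: compact_imp_closed open_Compl)
  then obtain d where d: "d > 0" "ball 0 d \<subseteq> -K" using open_contains_ball by blast
  \<comment> \<open>Dropping the first M mollifiers keeps the supports of all approximants in one
    compact set that misses the origin.\<close>
  obtain M where M: "1 / real (Suc M) < d" using d(1) nat_approx_posE by blast
  define r where "r = 1 / real (Suc M)"
  define K' where "K' = {x + y |x y. x \<in> K \<and> y \<in> cball (0::'a) r}"
  have K': "compact K'" unfolding K'_def by (intro compact_sums K compact_cball)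
  have "0 \<notin> K'"
  proof
    assume "0 \<in> K'"
    then obtain x y where xy: "x + y = 0" "x \<in> K" "norm y \<le> r" by (auto simp: K'_def)
    then have "norm x < d" using M by (simp add: r_def add_eq_0_iff)
    then show False using d(2) xy(2) by auto
  qed
  then have K'0: "K' \<subseteq> -{0}" by auto
  have KK': "x \<in> K'" if "x \<in> K" for x
    unfolding K'_def using that by (auto simp: r_def intro: exI[of _ x] exI[of _ "0::'a"])
  define \<rho> where "\<rho> n = (mollifier (n + M) :: 'a \<Rightarrow> real)" for n
  have \<rho>0: "\<rho> n x = 0" if "norm x > r" for n x
    unfolding \<rho>_def
  proof (rule mollifier_zero)
    have "1 / real (Suc (n + M)) \<le> r" unfolding r_def by (simp add: frac_le)
    then show "1 / real (Suc (n + M)) \<le> norm x" using that by linarith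
  qed
  have \<rho>K: "\<rho> n x = 0" if "x \<notin> cball 0 r" for n x using that \<rho>0 by simp
  have wi: "integrable lebesgue w" by (rule L2_integrable[OF L(1) K(1) wK(1)])
  have \<rho>k: "C_k k (\<rho> n)" for k n unfolding \<rho>_def by (rule C_k_mollifier)
  have lap: "laplacian (conv w (\<rho> n)) = conv W (\<rho> n)" for n
  proof
    fix x
    have "laplacian (conv w (\<rho> n)) = conv w (laplacian (\<rho> n))"
      by (rule laplacian_conv[OF wi \<rho>k compact_cball \<rho>K])
    then have "laplacian (conv w (\<rho> n)) x = (\<integral>y. w y * laplacian (\<rho> n) (x - y) \<partial>lebesgue)"
      by (simp add: conv_def)
    also have "\<dots> = (\<integral>y. w y * laplacian (\<lambda>y. \<rho> n (x - y)) y \<partial>lebesgue)"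
      using laplacian_reflect[OF \<rho>k] by simp
    also have "\<dots> = (\<integral>y. W y * \<rho> n (x - y) \<partial>lebesgue)"
      by (rule weak) (simp add: \<rho>_def C_k_mollifier_reflect)
    finally show "laplacian (conv w (\<rho> n)) x = conv W (\<rho> n) x" by (simp add: conv_def)
  qed
  have zK: "conv w (\<rho> n) x = 0" if "x \<notin> K'" for n x
    by (rule conv_eq_0[OF wK(1) \<rho>0]) (use that in \<open>auto simp: K'_def\<close>)
  show ?thesis unfolding C0_2_closure_def
  proof (intro conjI exI[of _ K'] exI[of _ "\<lambda>n. conv w (\<rho> n)"] allI impI)
    show "conv w (\<rho> n) \<in> C0 2 (-{0})" for n
      by (rule C0I[OF C_k_conv[OF wi compact_cball \<rho>k \<rho>K] K' K'0 zK])
    show "(\<lambda>n. \<integral>x. (conv w (\<rho> n) x - w x)\<^sup>2 \<partial>lebesgue) \<longlonglongrightarrow> 0"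
      using LIMSEQ_ignore_initial_segment[OF conv_mollifier_tendsto[OF L(1) K(1) wK(1)], of M] by (simp add: \<rho>_def)
    show "(\<lambda>n. \<integral>x. (laplacian (conv w (\<rho> n)) x - W x)\<^sup>2 \<partial>lebesgue) \<longlonglongrightarrow> 0"
      unfolding lap using LIMSEQ_ignore_initial_segment[OF conv_mollifier_tendsto[OF L(2) K(1) wK(2)], of M] by (simp add: \<rho>_def)
    show "w x = 0" "W x = 0" if "x \<notin> K'" for x using wK KK' that by blast+
  qed (use L K' K'0 zK in auto)
qed

text \<open>Reflected mollifiers are admissible as \<psi>, so all mollifications of \<open>g\<close>
  vanish identically, yet they converge to \<open>g\<close> in the mean.\<close>

lemma L2_AE_zero:
  fixes g :: "'a::euclidean_space \<Rightarrow> real"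
  assumes g: "g \<in> L2" and K: "compact K" "\<And>x. x \<notin> K \<Longrightarrow> g x = 0"
    and weak: "\<And>\<psi>. (\<And>k. C_k k \<psi>) \<Longrightarrow> (\<integral>x. g x * \<psi> x \<partial>lebesgue) = 0"
  shows "AE x in lebesgue. g x = 0"
proof -
  have "conv g (mollifier n) x = 0" for n x
    unfolding conv_def by (rule weak) (rule C_k_mollifier_reflect)
  then have "(\<lambda>n. \<integral>x. (g x)\<^sup>2 \<partial>lebesgue) \<longlonglongrightarrow> 0"
    using conv_mollifier_tendsto[OF g K] by simp
  then have "(\<integral>x. (g x)\<^sup>2 \<partial>lebesgue) = 0" by (simp add: LIMSEQ_const_iff)
  then show ?thesis using integral_nonneg_eq_0_iff_AE[OF L2_square[OF g]] by simp
qed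

section \<open>Homogeneous functions\<close>

lemma measurable_lebesgue_pair:
  fixes f :: "'a::euclidean_space \<times> 'b::euclidean_space \<Rightarrow> real"
  assumes "f \<in> borel_measurable (borel \<Otimes>\<^sub>M borel)"
  shows "f \<in> borel_measurable (lebesgue \<Otimes>\<^sub>M lebesgue)"
proof -
  have "(\<lambda>p::'a \<times> 'b. (fst p, snd p)) \<in> lebesgue \<Otimes>\<^sub>M lebesgue \<rightarrow>\<^sub>M borel \<Otimes>\<^sub>M borel"
    using measurable_compose[OF measurable_fst id_borel_measurable_lebesgue]
      measurable_compose[OF measurable_snd id_borel_measurable_lebesgue]
    by (intro measurable_Pair) simp_all
  from measurable_compose[OF this assms] show ?thesis by simp
qed

lemma rad_measurable_borel:
  assumes "\<Phi> \<in> borel_measurable borel"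
  shows "rad \<Phi> \<in> borel_measurable (borel :: 'a::euclidean_space measure)"
proof -
  note [measurable] = assms
  show ?thesis unfolding rad_def[abs_def] by measurable
qed

lemma rad_measurable:
  "\<Phi> \<in> borel_measurable borel \<Longrightarrow> rad \<Phi> \<in> borel_measurable (lebesgue :: 'a::euclidean_space measure)"
  by (intro measurable_completion) (simp add: rad_measurable_borel)

lemma integrable_rad_mult:
  fixes H :: "'a::euclidean_space \<Rightarrow> real"
  assumes H: "integrable lebesgue (\<lambda>x. indicator (annulus M) x * H x)"
    and B: "\<Phi> \<in> borel_measurable borel" "\<And>\<tau>. \<bar>\<tau>\<bar> > M \<Longrightarrow> \<Phi> \<tau> = 0" "\<And>\<tau>. \<bar>\<Phi> \<tau>\<bar> \<le> C"
  shows "integrable lebesgue (\<lambda>x. H x * rad \<Phi> x)"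
proof -
  have "C \<ge> 0" using B(3)[of 0] by simp
  then have "integrable lebesgue (\<lambda>x. indicator (annulus M) x * H x * rad \<Phi> x)"
    using B by (intro integrable_bounded_mult[OF H] rad_measurable) (auto simp: rad_def)
  moreover have "(\<lambda>x. indicator (annulus M) x * H x * rad \<Phi> x) = (\<lambda>x. H x * rad \<Phi> x)"
    using rad_outside[of M \<Phi>] B(2) by (auto simp: indicator_def fun_eq_iff)
  ultimately show ?thesis by simp
qed

lemma rad_scale:
  "rad \<Phi> (exp a *\<^sub>R x) = rad (\<lambda>\<tau>. \<Phi> (\<tau> + a)) (x :: 'a::euclidean_space)"
proof (cases "x = 0")
  case False
  then have "ln (exp a * norm x) = ln (norm x) + a" by (simp add: ln_mult)
  then show ?thesis using False by (simp add: rad_def)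
qed (simp add: rad_def)

lemma integral_unit_step:
  fixes t :: real
  shows "(\<integral>a. indicator {0..<1} (t - a) \<partial>lebesgue) = (1::real)" "integrable lebesgue (\<lambda>a. indicat_real {0..<1} (t - a))"
proof -
  have eq: "indicat_real {0..<1} (t - a) = indicator {t - 1<..t} a" for a
    unfolding indicator_def by (rule arg_cong[where f=of_bool]) auto
  show "(\<integral>a. indicator {0..<1} (t - a) \<partial>lebesgue) = (1::real)" unfolding eq by simp
  show "integrable lebesgue (\<lambda>a. indicat_real {0..<1} (t - a))"
    unfolding eq using lmeasurable_interval by (simp add: integrable_completion)
qed

text \<open>Polar coordinates for a function homogeneous of degree \<open>- DIM('a)\<close>: by scaling, the integral
  against a function of \<open>ln |x|\<close> is translation invariant, hence a multiple of the integral over the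
  line. The multiple is read off by averaging over all translates of the step \<open>[0, 1)\<close>.\<close>

lemma integral_log_radial:
  fixes H :: "'a::euclidean_space \<Rightarrow> real"
  assumes H: "\<And>M. integrable lebesgue (\<lambda>x. indicator (annulus M) x * H x)"
    and hom: "\<And>a. AE x in lebesgue. H (exp a *\<^sub>R x) = exp (- (real DIM('a) * a)) * H x"
    and G: "continuous_on UNIV G" "\<And>\<tau>. \<bar>\<tau>\<bar> > M \<Longrightarrow> G \<tau> = 0"
  shows "(\<integral>x. H x * rad G x \<partial>lebesgue)
    = (\<integral>x. H x * rad (indicator {0..<1}) x \<partial>lebesgue) * (\<integral>\<tau>. G \<tau> \<partial>lebesgue)"
proof -
  define J :: "real \<Rightarrow> real" where "J = indicator {0..<1}"
  let ?L = "lebesgue :: 'a measure" and ?R = "lebesgue :: real measure"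
  have Jm [measurable]: "J \<in> borel_measurable borel" unfolding J_def by simp
  have Gm [measurable]: "G \<in> borel_measurable borel" using G(1) by (rule borel_measurable_continuous_onI)
  have J0: "J \<tau> = 0" if "\<bar>\<tau>\<bar> > 1" for \<tau> using that by (auto simp: J_def indicator_def)
  have J1: "\<bar>J \<tau>\<bar> \<le> 1" for \<tau> by (auto simp: J_def indicator_def)
  obtain B where B: "B > 0" "\<And>\<tau>. \<bar>G \<tau>\<bar> \<le> B"
    using continuous_compact_bounded[of "{-M..M}" G] G
    by (metis abs_le_iff atLeastAtMost_iff compact_Icc continuous_on_subset not_le neg_le_iff_le top_greatest minus_le_iff)
  have GR: "integrable ?R G"
    by (rule integrable_continuous_compact[OF G(1), of "{-M..M}"]) (use G(2) in auto)
  have Gshift: "(\<integral>a. G (t + a) \<partial>lebesgue) = (\<integral>a. G a \<partial>lebesgue)" "integrable lebesgue (\<lambda>a. G (t + a))" for t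
    using lebesgue_integral_affine[of 1 G t] GR by simp_all
  have HG: "integrable ?L (\<lambda>x. H x * rad G x)" using integrable_rad_mult[OF H Gm G(2) B(2)] .
  have HJ: "integrable ?L (\<lambda>x. H x * rad J x)" using integrable_rad_mult[OF H Jm J0 J1] .
  \<comment> \<open>Integrating \<open>f1\<close> over a gives back H times rad G, because the
    translates of the unit step integrate to 1. Replacing x by e^a x turns \<open>f1\<close> into
    \<open>f2\<close>, whose integral over a produces the integral of G; Fubini compares the
    two.\<close>
  define f1 where "f1 = (\<lambda>x a. H x * rad (\<lambda>\<tau>. G \<tau> * J (\<tau> - a)) (x::'a))"
  define f2 where "f2 = (\<lambda>x a. H x * rad (\<lambda>\<tau>. G (\<tau> + a) * J \<tau>) (x::'a))"
  have Hm: "(\<lambda>p. indicator (annulus K) (fst p) * H (fst p)) \<in> borel_measurable (?L \<Otimes>\<^sub>M ?R)" for K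
    by (rule measurable_compose[OF measurable_fst borel_measurable_integrable[OF H[of K]]])
  have f1m: "(\<lambda>(x, a). f1 x a) \<in> borel_measurable (?L \<Otimes>\<^sub>M ?R)"
  proof -
    have "(\<lambda>p. rad (\<lambda>\<tau>. G \<tau> * J (\<tau> - snd p)) (fst p)) \<in> borel_measurable (?L \<Otimes>\<^sub>M ?R)"
      unfolding rad_def by (rule measurable_lebesgue_pair) measurable
    with Hm[of M] have "(\<lambda>p. indicator (annulus M) (fst p) * H (fst p) * rad (\<lambda>\<tau>. G \<tau> * J (\<tau> - snd p)) (fst p)) \<in> borel_measurable (?L \<Otimes>\<^sub>M ?R)"
      by (rule borel_measurable_times)
    moreover have "(\<lambda>p. indicator (annulus M) (fst p) * H (fst p) * rad (\<lambda>\<tau>. G \<tau> * J (\<tau> - snd p)) (fst p)) = (\<lambda>(x, a). f1 x a)"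
      using G(2) by (auto simp: f1_def rad_def annulus_iff indicator_def fun_eq_iff)
    ultimately show ?thesis by (simp only:)
  qed
  have f2m: "(\<lambda>(x, a). f2 x a) \<in> borel_measurable (?L \<Otimes>\<^sub>M ?R)"
  proof -
    have "(\<lambda>p. rad (\<lambda>\<tau>. G (\<tau> + snd p) * J \<tau>) (fst p)) \<in> borel_measurable (?L \<Otimes>\<^sub>M ?R)"
      unfolding rad_def by (rule measurable_lebesgue_pair) measurable
    with Hm[of 1] have "(\<lambda>p. indicator (annulus 1) (fst p) * H (fst p) * rad (\<lambda>\<tau>. G (\<tau> + snd p) * J \<tau>) (fst p)) \<in> borel_measurable (?L \<Otimes>\<^sub>M ?R)"
      by (rule borel_measurable_times)
    moreover have "(\<lambda>p. indicator (annulus 1) (fst p) * H (fst p) * rad (\<lambda>\<tau>. G (\<tau> + snd p) * J \<tau>) (fst p)) = (\<lambda>(x, a). f2 x a)"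
      using J0 by (auto simp: f2_def rad_def annulus_iff indicator_def fun_eq_iff)
    ultimately show ?thesis by (simp only:)
  qed
  have f1J: "f1 x a = H x * rad G x * J (ln (norm x) - a)" for x a by (simp add: f1_def rad_def)
  have f2G: "f2 x a = H x * rad J x * G (ln (norm x) + a)" for x a by (simp add: f2_def rad_def)
  note Ji = integral_unit_step[folded J_def]
  have Jn: "\<bar>J t\<bar> = J t" for t by (simp add: J_def)
  have i1: "integrable (?L \<Otimes>\<^sub>M ?R) (\<lambda>(x, a). f1 x a)"
  proof (rule lebesgue_pair.Fubini_integrable[OF f1m])
    show "integrable ?L (\<lambda>x. \<integral>a. norm (case (x, a) of (x, a) \<Rightarrow> f1 x a) \<partial>lebesgue)"
      using integrable_abs[OF HG] Ji by (simp add: f1J abs_mult Jn)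
    show "AE x in ?L. integrable ?R (\<lambda>a. case (x, a) of (x, a) \<Rightarrow> f1 x a)"
      using Ji(2) by (simp add: f1J)
  qed
  have i2: "integrable (?L \<Otimes>\<^sub>M ?R) (\<lambda>(x, a). f2 x a)"
  proof (rule lebesgue_pair.Fubini_integrable[OF f2m])
    have "(\<integral>a. \<bar>G (t + a)\<bar> \<partial>lebesgue) = (\<integral>a. \<bar>G a\<bar> \<partial>lebesgue)" for t
      using lebesgue_integral_affine(1)[of 1 "\<lambda>a. \<bar>G a\<bar>" t] GR by simp
    then show "integrable ?L (\<lambda>x. \<integral>a. norm (case (x, a) of (x, a) \<Rightarrow> f2 x a) \<partial>lebesgue)"
      using integrable_abs[OF HJ] by (simp add: f2G abs_mult)
    show "AE x in ?L. integrable ?R (\<lambda>a. case (x, a) of (x, a) \<Rightarrow> f2 x a)"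
      using Gshift(2) by (simp add: f2G)
  qed
  have eq: "(\<integral>x. f1 x a \<partial>lebesgue) = (\<integral>x. f2 x a \<partial>lebesgue)" for a
  proof -
    have m: "(\<lambda>x. f1 x a) \<in> borel_measurable lebesgue"
    proof -
      have "rad (\<lambda>\<tau>. J (\<tau> - a)) \<in> borel_measurable (lebesgue :: 'a measure)"
        by (rule rad_measurable) measurable
      with borel_measurable_integrable[OF HG]
      have "(\<lambda>x. H x * rad G x * rad (\<lambda>\<tau>. J (\<tau> - a)) x) \<in> borel_measurable lebesgue"
        by (rule borel_measurable_times)
      moreover have "(\<lambda>x. H x * rad G x * rad (\<lambda>\<tau>. J (\<tau> - a)) x) = (\<lambda>x. f1 x a)"
        by (auto simp: f1_def rad_def)
      ultimately show ?thesis by simp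
    qed
    have m2: "(\<lambda>x. f2 x a) \<in> borel_measurable lebesgue"
    proof -
      have "rad (\<lambda>\<tau>. G (\<tau> + a)) \<in> borel_measurable (lebesgue :: 'a measure)"
        by (rule rad_measurable) measurable
      with borel_measurable_integrable[OF HJ]
      have "(\<lambda>x. H x * rad J x * rad (\<lambda>\<tau>. G (\<tau> + a)) x) \<in> borel_measurable lebesgue"
        by (rule borel_measurable_times)
      moreover have "(\<lambda>x. H x * rad J x * rad (\<lambda>\<tau>. G (\<tau> + a)) x) = (\<lambda>x. f2 x a)"
        by (auto simp: f2_def rad_def)
      ultimately show ?thesis by simp
    qed
    \<comment> \<open>The Jacobian e^(a N) of the dilation cancels against the degree -N of
      \<open>H\<close>.\<close>
    have "(\<integral>x. f1 x a \<partial>lebesgue) = exp a ^ DIM('a) * (\<integral>x. f1 (exp a *\<^sub>R x) a \<partial>lebesgue)"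
      using lebesgue_integral_affine(1)[of "exp a" "\<lambda>x. f1 x a" 0] m by simp
    also have "\<dots> = (\<integral>x. exp a ^ DIM('a) * f1 (exp a *\<^sub>R x) a \<partial>lebesgue)" by simp
    also have "\<dots> = (\<integral>x. f2 x a \<partial>lebesgue)"
    proof (rule integral_cong_AE)
      show "AE x in lebesgue. exp a ^ DIM('a) * f1 (exp a *\<^sub>R x) a = f2 x a"
        using hom[of a]
      proof eventually_elim
        case (elim x)
        have "exp a ^ DIM('a) * exp (- (real DIM('a) * a)) = 1"
          by (simp add: exp_of_nat_mult exp_minus)
        then show ?case unfolding f1_def f2_def rad_scale elim by (simp add: mult.assoc[symmetric])
      qed
      have "(\<lambda>x. f1 (exp a *\<^sub>R x) a) \<in> borel_measurable lebesgue"
        using measurable_compose[OF lebesgue_scale_measurable[of "exp a" 0] m] by simp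
      then show "(\<lambda>x. exp a ^ DIM('a) * f1 (exp a *\<^sub>R x) a) \<in> borel_measurable lebesgue" by simp
    qed (rule m2)
    finally show ?thesis .
  qed
  have "(\<integral>x. H x * rad G x \<partial>lebesgue) = (\<integral>x. (\<integral>a. f1 x a \<partial>lebesgue) \<partial>lebesgue)"
    using Ji by (simp add: f1J)
  also have "\<dots> = (\<integral>a. (\<integral>x. f1 x a \<partial>lebesgue) \<partial>lebesgue)"
    using lebesgue_pair.Fubini_integral[OF i1] by simp
  also have "\<dots> = (\<integral>x. (\<integral>a. f2 x a \<partial>lebesgue) \<partial>lebesgue)"
    unfolding eq using lebesgue_pair.Fubini_integral[OF i2] by simp
  also have "\<dots> = (\<integral>x. H x * rad J x \<partial>lebesgue) * (\<integral>\<tau>. G \<tau> \<partial>lebesgue)"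
    using Gshift by (simp add: f2G)
  finally show ?thesis by (simp add: J_def)
qed

lemma compact_subset_annulus:
  assumes "compact K" "K \<subseteq> -{0}"
  obtains M where "K \<subseteq> annulus M" "M > 0"
proof -
  have "continuous_on K (\<lambda>x. ln (norm x))" using assms by (intro continuous_intros) auto
  then have "bounded ((\<lambda>x. ln (norm x)) ` K)" using assms by (intro compact_imp_bounded compact_continuous_image)
  then obtain M where "M > 0" "\<And>y. y \<in> (\<lambda>x. ln (norm x)) ` K \<Longrightarrow> norm y \<le> M" unfolding bounded_pos by auto
  then show thesis using assms by (intro that[of M]) (auto simp: annulus_iff)
qed

text \<open>The n-th bump is positive on the shell where the modulus of ln |x| is below n + 1; these
  shells exhaust the punctured space, and countably many null sets form a null set.\<close>

lemma AE_zero_rad_bump: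
  fixes g :: "'a::euclidean_space \<Rightarrow> real"
  assumes "\<And>n. AE x in lebesgue. g x * rad (bump 1 ((real (Suc n))\<^sup>2)) x = 0"
  shows "AE x in lebesgue. g x = 0"
proof -
  have "AE x in lebesgue. \<forall>n. g x * rad (bump 1 ((real (Suc n))\<^sup>2)) x = 0"
    by (subst AE_all_countable) (blast intro: assms)
  moreover have "AE x in lebesgue. x \<noteq> (0::'a)" by (simp add: AE_not_in[of "{0}", simplified])
  ultimately show ?thesis
  proof eventually_elim
    case (elim x)
    obtain n :: nat where n: "\<bar>ln (norm x)\<bar> < real n" using reals_Archimedean2 by blast
    then have "\<bar>ln (norm x)\<bar> < \<bar>real (Suc n)\<bar>" by simp
    then have "(ln (norm x))\<^sup>2 < (real (Suc n))\<^sup>2" by (simp only: not_le[symmetric] abs_le_square_iff simp_thms)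
    then have "bump 1 ((real (Suc n))\<^sup>2) (ln (norm x)) > 0" by (intro bump_pos) (simp add: power2_eq_square)
    then show ?case using elim(1)[rule_format, of n] elim(2) by (simp add: rad_def)
  qed
qed

section \<open>Weak calculus for a homogeneous function and its Laplacian\<close>

lemma laplacian_mult:
  assumes "C_k 2 f" "C_k 2 g"
  shows "laplacian (\<lambda>x. f x * g x) x =
    f x * laplacian g x + 2 * (\<Sum>b\<in>Basis. partial b f x * partial b g x) + g x * laplacian f x"
proof -
  have f: "C_k (Suc 1) f" "C_k (Suc 1) g" using assms by (simp_all add: numeral_2_eq_2)
  note d = C_k_SucD(1)[OF f(1)] C_k_SucD(1)[OF f(2)]
  have "partial b (partial b (\<lambda>x. f x * g x)) x = f x * partial b (partial b g) x
      + 2 * (partial b f x * partial b g x) + g x * partial b (partial b f) x" if b: "b \<in> Basis" for b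
  proof -
    have p: "partial b f differentiable (at x)" "partial b g differentiable (at x)"
      using C_k_SucD(2)[OF f(1) b] C_k_SucD(2)[OF f(2) b] by simp_all
    have m: "(\<lambda>x. partial b f x * g x) differentiable (at x)" "(\<lambda>x. f x * partial b g x) differentiable (at x)"
      using p d by (auto intro: differentiable_mult)
    have "partial b (\<lambda>x. f x * g x) = (\<lambda>x. partial b f x * g x + f x * partial b g x)"
      by (intro ext partial_mult d)
    then show ?thesis using m p d by (simp add: partial_add partial_mult algebra_simps)
  qed
  then show ?thesis by (simp add: laplacian_def sum.distrib sum_distrib_left)
qed

text \<open>\<open>f\<close> is tied to \<open>u\<close> only as a distributional Laplacian, square
  integrable on compact sets off the origin, so no derivative of \<open>u\<close> has to be handled.
  Such an \<open>f\<close> is determined only up to a null set; its own homogeneity is derived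
  almost everywhere.\<close>

locale homogeneous_laplacian =
  fixes u f :: "'a::euclidean_space \<Rightarrow> real" and l :: real
  assumes u_meas: "u \<in> borel_measurable lebesgue" and f_meas: "f \<in> borel_measurable lebesgue"
    and u_loc: "\<And>K. compact K \<Longrightarrow> K \<subseteq> -{0} \<Longrightarrow> (\<lambda>x. indicator K x * u x) \<in> L2"
    and f_loc: "\<And>K. compact K \<Longrightarrow> K \<subseteq> -{0} \<Longrightarrow> (\<lambda>x. indicator K x * f x) \<in> L2"
    and weak_laplacian: "\<And>\<psi>. \<psi> \<in> C0_infinity (-{0}) \<Longrightarrow> (\<integral>x. u x * laplacian \<psi> x \<partial>lebesgue) = (\<integral>x. f x * \<psi> x \<partial>lebesgue)"
    and homog: "\<And>m x. m > 0 \<Longrightarrow> x \<noteq> 0 \<Longrightarrow> u (m *\<^sub>R x) = m powr (- l) * u x"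
begin

lemma L2_cutoff:
  assumes "continuous_on UNIV \<phi>" "compact K" "K \<subseteq> -{0}" "\<And>x. x \<notin> K \<Longrightarrow> \<phi> x = 0"
  shows "(\<lambda>x. u x * \<phi> x) \<in> L2" "(\<lambda>x. f x * \<phi> x) \<in> L2"
proof -
  obtain B where B: "B > 0" "\<And>x. \<bar>\<phi> x\<bar> \<le> B"
    by (rule continuous_compact_bounded[OF continuous_on_subset[OF assms(1)] assms(2,4)]) auto
  have e: "(\<lambda>x. indicator K x * g x * \<phi> x) = (\<lambda>x. g x * \<phi> x)" for g :: "'a \<Rightarrow> real"
    using assms(4) by (auto simp: indicator_def fun_eq_iff)
  note m = continuous_measurable_lebesgue[OF assms(1)]
  show "(\<lambda>x. u x * \<phi> x) \<in> L2"
    using L2_bounded_mult[OF u_loc[OF assms(2,3)] m B(2)] unfolding e .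
  show "(\<lambda>x. f x * \<phi> x) \<in> L2"
    using L2_bounded_mult[OF f_loc[OF assms(2,3)] m B(2)] unfolding e .
qed

lemma integrable_cutoff:
  assumes "continuous_on UNIV \<phi>" "compact K" "K \<subseteq> -{0}" "\<And>x. x \<notin> K \<Longrightarrow> \<phi> x = 0"
  shows "integrable lebesgue (\<lambda>x. u x * \<phi> x)" "integrable lebesgue (\<lambda>x. f x * \<phi> x)"
  using L2_integrable[OF L2_cutoff(1)[OF assms] assms(2)] L2_integrable[OF L2_cutoff(2)[OF assms] assms(2)] assms(4)
  by auto

lemma integral_scale_u:
  assumes c: "continuous_on UNIV \<phi>" and m: "m > 0" and z: "\<phi> 0 = 0"
  shows "(\<integral>x. u x * \<phi> x \<partial>lebesgue) = m ^ DIM('a) * m powr (- l) * (\<integral>x. u x * \<phi> (m *\<^sub>R x) \<partial>lebesgue)"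
proof -
  have "(\<lambda>x. u x * \<phi> x) \<in> borel_measurable lebesgue"
    using u_meas continuous_measurable_lebesgue[OF c] by simp
  then have "(\<integral>x. u x * \<phi> x \<partial>lebesgue) = m ^ DIM('a) * (\<integral>x. u (m *\<^sub>R x) * \<phi> (m *\<^sub>R x) \<partial>lebesgue)"
    using lebesgue_integral_affine(1)[of m "\<lambda>x. u x * \<phi> x" 0] m by simp
  also have "(\<lambda>x. u (m *\<^sub>R x) * \<phi> (m *\<^sub>R x)) = (\<lambda>x. m powr (- l) * (u x * \<phi> (m *\<^sub>R x)))"
  proof
    fix x show "u (m *\<^sub>R x) * \<phi> (m *\<^sub>R x) = m powr (- l) * (u x * \<phi> (m *\<^sub>R x))"
      using homog[OF m, of x] z by (cases "x = 0") simp_all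
  qed
  finally show ?thesis by simp
qed

text \<open>Euler's identity \<open>x \<cdot> \<nabla>u = - l u\<close> in weak form: differentiate the scaling identity at 1.\<close>

lemma weak_Euler:
  assumes h: "C_k 1 h" and K: "compact K" "K \<subseteq> -{0}" "\<And>x. x \<notin> K \<Longrightarrow> h x = 0"
  shows "(\<integral>x. u x * (\<Sum>b\<in>Basis. (x \<bullet> b) * partial b h x) \<partial>lebesgue) = - (real DIM('a) - l) * (\<integral>x. u x * h x \<partial>lebesgue)"
proof -
  have c: "continuous_on UNIV h" using C_k_continuous[OF h] .
  obtain L where L: "L > 0" "\<And>x y. \<bar>h x - h y\<bar> \<le> L * norm (x - y)"
    using C_k_1_Lipschitz[OF h K(1,3)] by metis
  obtain M where M: "K \<subseteq> annulus M" "M > 0" using compact_subset_annulus[OF K(1,2)] .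
  define D where "D x = (\<Sum>b\<in>Basis. (x \<bullet> b) * partial b h x)" for x
  define m where "m n = 1 + 1 / real (Suc n)" for n
  have m: "m n > 0" "m n - 1 > 0" "m n \<le> 2" "m n \<ge> 1" for n
  proof -
    have "0 < 1 / real (Suc n)" "1 / real (Suc n) \<le> 1" by simp_all
    then show "m n > 0" "m n - 1 > 0" "m n \<le> 2" "m n \<ge> 1" unfolding m_def by linarith+
  qed
  have h0: "h 0 = 0" using K by auto
  define s where "s n x = u x * ((h (m n *\<^sub>R x) - h x) / (m n - 1))" for n x
  define I where "I = (\<integral>x. u x * h x \<partial>lebesgue)"
  have hc: "continuous_on UNIV (\<lambda>x. h (c *\<^sub>R x))" for c
    by (intro continuous_on_compose2[OF c] continuous_intros) auto
  have hi: "integrable lebesgue (\<lambda>x. u x * h (m n *\<^sub>R x))" for n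
  proof (rule integrable_cutoff(1)[OF hc, of "(\<lambda>x. (1 / m n) *\<^sub>R x) ` K"])
    show "compact ((\<lambda>x. (1 / m n) *\<^sub>R x) ` K)" using K(1) by (rule compact_scaling)
    show "(\<lambda>x. (1 / m n) *\<^sub>R x) ` K \<subseteq> -{0}" using K(2) m(1)[of n] by auto
    fix x assume "x \<notin> (\<lambda>x. (1 / m n) *\<^sub>R x) ` K"
    then have "m n *\<^sub>R x \<notin> K" using m(1)[of n] by (auto simp: image_iff dest!: bspec[of K _ "m n *\<^sub>R x"])
    then show "h (m n *\<^sub>R x) = 0" using K(3) by simp
  qed
  have hi0: "integrable lebesgue (\<lambda>x. u x * h x)" by (rule integrable_cutoff(1)[OF c K])
  have "(\<integral>x. s n x \<partial>lebesgue) = (m n powr (l - real DIM('a)) - 1) / (m n - 1) * I" for n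
  proof -
    have "I = m n ^ DIM('a) * m n powr (- l) * (\<integral>x. u x * h (m n *\<^sub>R x) \<partial>lebesgue)"
      unfolding I_def using integral_scale_u[OF c m(1) h0] .
    also have "m n ^ DIM('a) * m n powr (- l) = m n powr (real DIM('a) - l)"
      using m(1)[of n] by (simp add: powr_realpow powr_diff powr_minus_divide)
    finally have "m n powr (l - real DIM('a)) * I = m n powr (l - real DIM('a)) * m n powr (real DIM('a) - l) * (\<integral>x. u x * h (m n *\<^sub>R x) \<partial>lebesgue)"
      by simp
    also have "m n powr (l - real DIM('a)) * m n powr (real DIM('a) - l) = 1"
      using m(1)[of n] by (simp flip: powr_add)
    finally have e: "(\<integral>x. u x * h (m n *\<^sub>R x) \<partial>lebesgue) = m n powr (l - real DIM('a)) * I" by simp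
    have "(\<integral>x. s n x \<partial>lebesgue) = (\<integral>x. (u x * h (m n *\<^sub>R x) - u x * h x) / (m n - 1) \<partial>lebesgue)"
      unfolding s_def by (simp add: algebra_simps)
    also have "\<dots> = (m n powr (l - real DIM('a)) * I - I) / (m n - 1)"
      using hi hi0 e by (simp add: I_def)
    finally show ?thesis by (simp add: left_diff_distrib diff_divide_distrib)
  qed
  moreover have "(\<lambda>n. (m n powr (l - real DIM('a)) - 1) / (m n - 1) * I) \<longlonglongrightarrow> (l - real DIM('a)) * I"
  proof -
    have "((\<lambda>z. z powr (l - real DIM('a))) has_real_derivative (l - real DIM('a)) * 1 powr (l - real DIM('a) - 1)) (at 1)"
      by (rule has_real_derivative_powr) simp
    then have "((\<lambda>h. ((1 + h) powr (l - real DIM('a)) - 1) / h) \<longlongrightarrow> l - real DIM('a)) (at 0)"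
      by (simp add: DERIV_def)
    moreover have "filterlim (\<lambda>n. 1 / real (Suc n)) (at 0) sequentially"
      using LIMSEQ_inverse_real_of_nat by (auto simp: filterlim_at inverse_eq_divide)
    ultimately have "(\<lambda>n. ((1 + 1 / real (Suc n)) powr (l - real DIM('a)) - 1) / (1 / real (Suc n))) \<longlonglongrightarrow> l - real DIM('a)"
      by (rule filterlim_compose)
    then show ?thesis by (intro tendsto_intros) (simp add: m_def)
  qed
  moreover have "(\<lambda>n. \<integral>x. s n x \<partial>lebesgue) \<longlonglongrightarrow> (\<integral>x. u x * D x \<partial>lebesgue)"
  \<comment> \<open>As ln (m n) \<le> m n - 1 \<le> 1, both x and its dilate lie outside the support
    of h once x lies outside the annulus widened by 1; inside it the Lipschitz bound controls the
    difference quotient by L |x|.\<close>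
  proof (rule integral_dominated_convergence[where w = "\<lambda>x. \<bar>indicator (annulus (M + 1)) x * u x\<bar> * (L * exp (M + 1))"])
    show "integrable lebesgue (\<lambda>x. \<bar>indicator (annulus (M + 1)) x * u x\<bar> * (L * exp (M + 1)))"
      using L2_integrable[OF u_loc[OF compact_annulus zero_notin_annulus(2)] compact_annulus, of "M + 1"] by auto
    have Dc: "continuous_on UNIV D" unfolding D_def using h by (intro continuous_intros) auto
    show "(\<lambda>x. u x * D x) \<in> borel_measurable lebesgue"
      using u_meas continuous_measurable_lebesgue[OF Dc] by simp
    show "s n \<in> borel_measurable lebesgue" for n
      unfolding s_def[abs_def] using u_meas continuous_measurable_lebesgue[OF c] continuous_measurable_lebesgue[OF hc[of "m n"]]
      by simp
    show "AE x in lebesgue. (\<lambda>n. s n x) \<longlonglongrightarrow> u x * D x"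
    proof (rule AE_I2)
      fix x
      have der: "((\<lambda>t. h (x + t *\<^sub>R x)) has_real_derivative D x) (at 0)"
      proof -
        have 1: "(h has_derivative (\<lambda>k. \<Sum>b\<in>Basis. (k \<bullet> b) * partial b h x)) (at (x + 0 *\<^sub>R x))"
          using has_derivative_partial[of h x] h by simp
        have 2: "((\<lambda>t. x + t *\<^sub>R x) has_derivative (\<lambda>t. t *\<^sub>R x)) (at 0)"
          by (auto intro!: derivative_eq_intros)
        show ?thesis
          by (rule has_derivative_imp_has_field_derivative[OF has_derivative_compose[OF 2 1]])
             (simp add: D_def sum_distrib_left mult_ac)
      qed
      then have "((\<lambda>t. (h (x + t *\<^sub>R x) - h x) / t) \<longlongrightarrow> D x) (at 0)"
        by (simp add: DERIV_def)
      moreover have "filterlim (\<lambda>n. 1 / real (Suc n)) (at 0) sequentially"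
        using LIMSEQ_inverse_real_of_nat by (auto simp: filterlim_at inverse_eq_divide)
      ultimately have "(\<lambda>n. (h (x + (1 / real (Suc n)) *\<^sub>R x) - h x) / (1 / real (Suc n))) \<longlonglongrightarrow> D x"
        by (rule filterlim_compose)
      then have "(\<lambda>n. (h (m n *\<^sub>R x) - h x) / (m n - 1)) \<longlonglongrightarrow> D x"
        by (simp add: m_def scaleR_add_left)
      then show "(\<lambda>n. s n x) \<longlonglongrightarrow> u x * D x" unfolding s_def by (intro tendsto_intros)
    qed
    show "AE x in lebesgue. norm (s n x) \<le> \<bar>indicator (annulus (M + 1)) x * u x\<bar> * (L * exp (M + 1))" for n
    proof (rule AE_I2)
      fix x
      show "norm (s n x) \<le> \<bar>indicator (annulus (M + 1)) x * u x\<bar> * (L * exp (M + 1))"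
      proof (cases "x \<in> annulus (M + 1)")
        case True
        then have nx: "norm x \<le> exp (M + 1)" by (simp add: annulus_def)
        have "\<bar>h (m n *\<^sub>R x) - h x\<bar> \<le> L * norm ((m n - 1) *\<^sub>R x)"
          using L(2)[of "m n *\<^sub>R x" x] by (simp add: scaleR_left_diff_distrib)
        also have "\<dots> = (m n - 1) * (L * norm x)" using m(2)[of n] by simp
        finally have "\<bar>(h (m n *\<^sub>R x) - h x) / (m n - 1)\<bar> \<le> L * norm x"
          using m(2)[of n] by (simp add: field_simps)
        also have "\<dots> \<le> L * exp (M + 1)" using nx L(1) by simp
        finally have "\<bar>u x\<bar> * \<bar>(h (m n *\<^sub>R x) - h x) / (m n - 1)\<bar> \<le> \<bar>u x\<bar> * (L * exp (M + 1))"
          by (intro mult_left_mono) simp_all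
        then show ?thesis using True by (simp add: s_def abs_mult)
      next
        case False
        have "x \<notin> K"
        proof
          assume "x \<in> K"
          then have "x \<in> annulus M" using M by blast
          then show False using False by (simp add: annulus_iff)
        qed
        moreover have "m n *\<^sub>R x \<notin> K"
        proof
          assume "m n *\<^sub>R x \<in> K"
          then have a: "m n *\<^sub>R x \<in> annulus M" using M by blast
          then have x0: "x \<noteq> 0" by (auto simp: annulus_iff)
          have "ln (norm (m n *\<^sub>R x)) = ln (m n) + ln (norm x)"
            using x0 m(1)[of n] by (simp add: ln_mult)
          moreover have "0 \<le> ln (m n)" using m(4)[of n] by simp
          moreover have "ln (m n) \<le> m n - 1" using m(1)[of n] by (rule ln_le_minus_one)
          ultimately show False using a False x0 m(3)[of n] by (simp add: annulus_iff)
        qed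
        ultimately show ?thesis using K(3) L(1) by (simp add: s_def)
      qed
    qed
  qed
  ultimately have "(\<integral>x. u x * D x \<partial>lebesgue) = (l - real DIM('a)) * I"
    using LIMSEQ_unique by simp
  then show ?thesis by (simp add: D_def I_def algebra_simps)
qed

text \<open>Formally, with \<phi> = rad \<Phi>, the Laplacian of u \<phi> is f \<phi> plus twice the
  product of the gradients plus u times the Laplacian of \<phi>. The gradient of \<phi> is Q x with
  Q = |x|^(-2) \<Phi>', so Euler's identity turns the middle term into -2 l Q u, and what multiplies
  u collects into the stated radial function. In weak form this computation never mentions the
  gradient of u.\<close>

lemma rad_test_closure:
  assumes \<Phi>: "\<And>k. C_k k \<Phi>" "\<And>\<tau>. \<bar>\<tau>\<bar> > M \<Longrightarrow> \<Phi> \<tau> = 0"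
  shows "C0_2_closure (\<lambda>x. u x * rad \<Phi> x) (\<lambda>x. f x * rad \<Phi> x +
     u x * rad (\<lambda>\<tau>. exp (-2 * \<tau>) * (partial 1 (partial 1 \<Phi>) \<tau> + (real DIM('a) - 2 - 2 * l) * partial 1 \<Phi> \<tau>)) x)"
proof -
  let ?A = "annulus M :: 'a set"
  have A: "compact ?A" "?A \<subseteq> -{0}" by (rule compact_annulus, rule zero_notin_annulus)
  define \<Phi>1 \<Phi>2 where "\<Phi>1 = partial 1 \<Phi>" and "\<Phi>2 = partial 1 (partial 1 \<Phi>)"
  have k1: "C_k k \<Phi>1" for k using \<Phi>(1)[of "Suc k"] by (simp add: \<Phi>1_def)
  have k2: "C_k k \<Phi>2" for k using k1[of "Suc k"] by (simp add: \<Phi>1_def \<Phi>2_def)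
  have z1: "\<Phi>1 \<tau> = 0" if "\<bar>\<tau>\<bar> > M" for \<tau> using partial_vanish[OF \<Phi>(2) that] by (simp add: \<Phi>1_def)
  have z2: "\<Phi>2 \<tau> = 0" if "\<bar>\<tau>\<bar> > M" for \<tau> using partial_vanish[OF z1 that] by (simp add: \<Phi>1_def \<Phi>2_def)
  define \<phi> :: "'a \<Rightarrow> real" where "\<phi> = rad \<Phi>"
  define q where "q = (\<lambda>\<tau>. exp (-2 * \<tau>) * \<Phi>1 \<tau>)"
  define Q :: "'a \<Rightarrow> real" where "Q = rad q"
  define E :: "'a \<Rightarrow> real" where "E = rad (\<lambda>\<tau>. exp (-2 * \<tau>) * (\<Phi>2 \<tau> - 2 * \<Phi>1 \<tau>))"
  define P :: "'a \<Rightarrow> real" where "P = rad (\<lambda>\<tau>. exp (-2 * \<tau>) * (\<Phi>2 \<tau> + (real DIM('a) - 2 - 2 * l) * \<Phi>1 \<tau>))"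
  have qk: "C_k k q" for k unfolding q_def by (intro C_k_mult C_k_exp k1)
  have q0: "q \<tau> = 0" if "\<bar>\<tau>\<bar> > M" for \<tau> using z1[OF that] by (simp add: q_def)
  have \<phi>k: "C_k k \<phi>" and Qk: "C_k k Q" and Ek: "C_k k E" and Pk: "C_k k P" for k
    unfolding \<phi>_def Q_def E_def P_def using \<Phi> q0 z1 z2
    by (intro C_k_rad[of _ M] C_k_mult C_k_exp C_k_diff C_k_add C_k_const qk k1 k2; simp)+
  have \<phi>0: "\<phi> x = 0" and Q0: "Q x = 0" and E0: "E x = 0" and P0: "P x = 0" if "x \<notin> ?A" for x
    unfolding \<phi>_def Q_def E_def P_def using that \<Phi>(2) q0 z1 z2
    by (auto intro!: rad_outside[of M])
  have \<Phi>d: "\<Phi> differentiable (at \<tau>)" "\<Phi>1 differentiable (at \<tau>)" "q differentiable (at \<tau>)" for \<tau>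
    using \<Phi>(1)[of 1] k1[of 1] qk[of 1] by simp_all
  have p\<phi>: "partial b \<phi> = (\<lambda>x. (x \<bullet> b) * Q x)" for b
    unfolding \<phi>_def Q_def q_def \<Phi>1_def by (rule partial_rad[OF \<Phi>d(1) \<Phi>(2)])
  have q': "partial 1 q \<tau> = exp (-2 * \<tau>) * (\<Phi>2 \<tau> - 2 * \<Phi>1 \<tau>)" for \<tau>
  proof -
    have e: "(\<lambda>\<tau>::real. exp (-2 * \<tau>)) differentiable (at \<tau>)" using C_k_exp[of 1 "-2"] by simp
    have d: "((\<lambda>\<tau>::real. exp (-2 * \<tau>)) has_derivative (\<lambda>h. -2 * exp (-2 * \<tau>) * h)) (at \<tau>)"
      by (auto intro!: derivative_eq_intros)
    have "partial 1 (\<lambda>\<tau>::real. exp (-2 * \<tau>)) \<tau> = -2 * exp (-2 * \<tau>)" using partial_eqI[OF d, of 1] by simp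
    then show ?thesis unfolding q_def using partial_mult[OF e \<Phi>d(2), of 1]
      by (simp add: \<Phi>1_def \<Phi>2_def algebra_simps)
  qed
  have EQ: "(\<Sum>b\<in>Basis. (x \<bullet> b) * partial b Q x) = E x" for x
  proof -
    have "(\<Sum>b\<in>Basis. (x \<bullet> b) * partial b Q x) = (\<Sum>b\<in>Basis. (x \<bullet> b) * (x \<bullet> b)) * rad (\<lambda>\<tau>. exp (-2 * \<tau>) * partial 1 q \<tau>) x"
      unfolding Q_def by (simp add: partial_rad[OF \<Phi>d(3) q0] sum_distrib_right mult_ac)
    also have "(\<Sum>b\<in>Basis. (x \<bullet> b) * (x \<bullet> b)) = (norm x)\<^sup>2"
      by (simp add: power2_norm_eq_inner euclidean_inner[of x x])
    also have "(norm x)\<^sup>2 * rad (\<lambda>\<tau>. exp (-2 * \<tau>) * partial 1 q \<tau>) x = E x"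
    proof (cases "x = 0")
      case False
      have "exp (2 * ln (norm x)) = (norm x)\<^sup>2"
        using False by (metis exp_double exp_ln zero_less_norm_iff)
      then have "(norm x)\<^sup>2 * exp (-2 * ln (norm x)) = 1" using False by (simp add: exp_minus)
      then show ?thesis using False
        by (simp add: rad_def E_def q' mult.assoc[symmetric])
    qed (simp add: rad_def E_def)
    finally show ?thesis .
  qed
  have lap\<phi>: "laplacian \<phi> x = real DIM('a) * Q x + E x" for x
  proof -
    have "partial b (partial b \<phi>) x = Q x + (x \<bullet> b) * partial b Q x" if "b \<in> Basis" for b
      unfolding p\<phi> using Qk[of 1] that by (subst partial_mult) auto
    then show ?thesis unfolding laplacian_def by (simp add: sum.distrib EQ)
  qed
  have weak: "(\<integral>x. u x * \<phi> x * laplacian \<psi> x \<partial>lebesgue) = (\<integral>x. (f x * \<phi> x + u x * P x) * \<psi> x \<partial>lebesgue)" if \<psi>: "\<And>k. C_k k \<psi>" for \<psi>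
  proof -
    have \<psi>2: "C_k (Suc 1) \<psi>" using \<psi> by blast
    have \<psi>c: "continuous_on UNIV \<psi>" using C_k_continuous[OF \<psi>2] .
    define h where "h x = Q x * \<psi> x" for x
    have hk: "C_k k h" for k unfolding h_def[abs_def] by (intro C_k_mult Qk \<psi>)
    define D where "D x = (\<Sum>b\<in>Basis. (x \<bullet> b) * partial b h x)" for x
    have D: "D x = \<psi> x * E x + Q x * (\<Sum>b\<in>Basis. (x \<bullet> b) * partial b \<psi> x)" for x
    proof -
      have "partial b h x = partial b Q x * \<psi> x + Q x * partial b \<psi> x" for b
        unfolding h_def[abs_def] using Qk[of 1] \<psi>[of 1] by (intro partial_mult) simp_all
      then show ?thesis unfolding D_def EQ[symmetric] sum_distrib_left sum.distrib[symmetric]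
        by (intro sum.cong) (simp_all add: algebra_simps)
    qed
    \<comment> \<open>The mixed term Q x . grad \<psi> is rewritten through D, the Euler derivative
      of h = Q \<psi>, because \<open>weak_Euler\<close> applies to D. The correction turns the sign
      of E from plus to minus.\<close>
    have lp: "laplacian (\<lambda>x. \<phi> x * \<psi> x) x = \<phi> x * laplacian \<psi> x + 2 * D x + (real DIM('a) * Q x - E x) * \<psi> x" for x
      unfolding laplacian_mult[OF \<phi>k \<psi>] p\<phi> lap\<phi> D by (simp add: algebra_simps sum_distrib_left)
    have t: "(\<lambda>x. \<phi> x * \<psi> x) \<in> C0_infinity (-{0})"
      by (rule C0_infinityI[OF _ A]) (auto intro!: C_k_mult \<phi>k \<psi> simp: \<phi>0)
    have lc: "continuous_on UNIV (laplacian \<psi>)"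
      unfolding laplacian_def[abs_def] using C_k_SucD(2)[OF \<psi>2] by (intro continuous_on_sum) auto
    have Dc: "continuous_on UNIV D" unfolding D_def[abs_def] using hk[of 1] by (intro continuous_intros) auto
    have D0: "D x = 0" if "x \<notin> ?A" for x using E0[OF that] Q0[OF that] by (simp add: D)
    note co = C_k_continuous[OF \<phi>k[of 0]] C_k_continuous[OF Qk[of 0]] C_k_continuous[OF Ek[of 0]] C_k_continuous[OF Pk[of 0]]
    have i1: "integrable lebesgue (\<lambda>x. u x * (\<phi> x * laplacian \<psi> x))"
      by (rule integrable_cutoff(1)[OF _ A]) (auto intro!: continuous_intros co lc simp: \<phi>0)
    have i2: "integrable lebesgue (\<lambda>x. u x * D x)"
      by (rule integrable_cutoff(1)[OF Dc A D0])
    have i3: "integrable lebesgue (\<lambda>x. u x * ((real DIM('a) * Q x - E x) * \<psi> x))"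
      by (rule integrable_cutoff(1)[OF _ A]) (auto intro!: continuous_intros co \<psi>c simp: Q0 E0)
    have i4: "integrable lebesgue (\<lambda>x. u x * h x)"
      by (rule integrable_cutoff(1)[OF _ A]) (auto intro!: continuous_intros co \<psi>c simp: Q0 h_def)
    have i5: "integrable lebesgue (\<lambda>x. f x * (\<phi> x * \<psi> x))"
      by (rule integrable_cutoff(2)[OF _ A]) (auto intro!: continuous_intros co \<psi>c simp: \<phi>0)
    have "(\<integral>x. f x * (\<phi> x * \<psi> x) \<partial>lebesgue) = (\<integral>x. u x * laplacian (\<lambda>x. \<phi> x * \<psi> x) x \<partial>lebesgue)"
      using weak_laplacian[OF t] by simp
    also have "\<dots> = (\<integral>x. u x * (\<phi> x * laplacian \<psi> x) + 2 * (u x * D x) + u x * ((real DIM('a) * Q x - E x) * \<psi> x) \<partial>lebesgue)"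
      by (rule Bochner_Integration.integral_cong) (simp_all add: lp algebra_simps)
    also have "\<dots> = (\<integral>x. u x * (\<phi> x * laplacian \<psi> x) \<partial>lebesgue) + 2 * (\<integral>x. u x * D x \<partial>lebesgue)
        + (\<integral>x. u x * ((real DIM('a) * Q x - E x) * \<psi> x) \<partial>lebesgue)" using i1 i2 i3 by simp
    also have "(\<integral>x. u x * D x \<partial>lebesgue) = - (real DIM('a) - l) * (\<integral>x. u x * h x \<partial>lebesgue)"
      unfolding D_def by (rule weak_Euler[OF hk A]) (simp add: h_def Q0)
    finally have "(\<integral>x. u x * (\<phi> x * laplacian \<psi> x) \<partial>lebesgue) = (\<integral>x. f x * (\<phi> x * \<psi> x) \<partial>lebesgue)
        + (2 * (real DIM('a) - l)) * (\<integral>x. u x * h x \<partial>lebesgue) - (\<integral>x. u x * ((real DIM('a) * Q x - E x) * \<psi> x) \<partial>lebesgue)"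
      by (simp add: algebra_simps)
    also have "\<dots> = (\<integral>x. f x * (\<phi> x * \<psi> x) + (2 * (real DIM('a) - l)) * (u x * h x) - u x * ((real DIM('a) * Q x - E x) * \<psi> x) \<partial>lebesgue)"
      using i3 i4 i5 by simp
    also have "\<dots> = (\<integral>x. (f x * \<phi> x + u x * P x) * \<psi> x \<partial>lebesgue)"
    proof (rule Bochner_Integration.integral_cong[OF refl])
      fix x
      have "P x = (real DIM('a) - 2 * l) * Q x + E x"
        by (simp add: P_def Q_def E_def q_def rad_def algebra_simps)
      then show "f x * (\<phi> x * \<psi> x) + (2 * (real DIM('a) - l)) * (u x * h x) - u x * ((real DIM('a) * Q x - E x) * \<psi> x) = (f x * \<phi> x + u x * P x) * \<psi> x"
        by (simp only: h_def) (simp add: algebra_simps)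
    qed
    finally show ?thesis by (simp add: mult.assoc)
  qed
  have L: "(\<lambda>x. u x * \<phi> x) \<in> L2" "(\<lambda>x. f x * \<phi> x + u x * P x) \<in> L2"
    using L2_cutoff[OF C_k_continuous[OF \<phi>k[of 0]] A \<phi>0] L2_cutoff[OF C_k_continuous[OF Pk[of 0]] A P0]
    by (auto intro: L2_add)
  have "C0_2_closure (\<lambda>x. u x * \<phi> x) (\<lambda>x. f x * \<phi> x + u x * P x)"
    by (rule C0_2_closureI[OF L A]) (use weak in \<open>auto simp: \<phi>0 P0\<close>)
  then show ?thesis unfolding \<phi>_def P_def \<Phi>1_def \<Phi>2_def .
qed

text \<open>Scaling the weak identity by m shows that f(m x) and m^(-l-2) f(x) have the same
  pairings with test functions, hence agree almost everywhere. The exceptional null set may depend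
  on \<open>a\<close>; the polar formula uses one dilation at a time.\<close>

lemma AE_homogeneous_laplacian:
  "AE x in lebesgue. f (exp a *\<^sub>R x) = exp (- ((l + 2) * a)) * f x"
proof -
  define m where "m = exp a"
  have m: "m > 0" by (simp add: m_def)
  define g where "g x = f (m *\<^sub>R x) - m powr (- (l + 2)) * f x" for x
  have fm: "(\<lambda>x. f (m *\<^sub>R x)) \<in> borel_measurable lebesgue"
    using measurable_compose[OF lebesgue_scale_measurable[of m 0] f_meas] m by simp
  have weak0: "(\<integral>x. g x * \<psi> x \<partial>lebesgue) = 0" and gL: "\<And>K. compact K \<Longrightarrow> K \<subseteq> -{0} \<Longrightarrow> (\<And>x. x \<notin> K \<Longrightarrow> \<psi> x = 0) \<Longrightarrow> (\<lambda>x. g x * \<psi> x) \<in> L2"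
    if \<psi>: "\<psi> \<in> C0_infinity (-{0})" for \<psi>
  proof -
    have k: "C_k k \<psi>" for k using \<psi> by (auto simp: C0_infinity_def C0_def)
    have "\<psi> \<in> C0 0 (-{0})" using \<psi> by (auto simp: C0_infinity_def)
    then obtain K where K: "compact K" "K \<subseteq> -{0}" "\<And>x. x \<notin> K \<Longrightarrow> \<psi> x = 0" by (rule C0E) blast
    have c: "continuous_on UNIV \<psi>" using C_k_continuous[OF k] .
    \<comment> \<open>The dilation is moved to the test function, whose Laplacian then scales by
      m^(-2).\<close>
    define \<psi>m where "\<psi>m x = \<psi> ((1 / m) *\<^sub>R x)" for x
    have kmm: "C_k k \<psi>m" for k unfolding \<psi>m_def[abs_def] using C_k_affine[OF k, of k 0 "1 / m"] by simp
    have Km: "compact ((\<lambda>x. m *\<^sub>R x) ` K')" "(\<lambda>x. m *\<^sub>R x) ` K' \<subseteq> -{0}" if "compact K'" "K' \<subseteq> -{0}" for K' :: "'a set"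
      using that m by (auto intro: compact_scaling)
    have \<psi>m0: "\<psi>m x = 0" if "x \<notin> (\<lambda>x. m *\<^sub>R x) ` K'" "\<And>x. x \<notin> K' \<Longrightarrow> \<psi> x = 0" for x K'
    proof -
      have "(1 / m) *\<^sub>R x \<notin> K'" using that(1) m by (auto simp: image_iff dest!: bspec[of K' _ "(1 / m) *\<^sub>R x"])
      then show ?thesis using that(2) by (simp add: \<psi>m_def)
    qed
    have t: "\<psi>m \<in> C0_infinity (-{0})"
      by (rule C0_infinityI[OF kmm Km[OF K(1,2)]]) (use \<psi>m0 K(3) in blast)
    have cm: "continuous_on UNIV \<psi>m" using C_k_continuous[OF kmm] .
    have lapm: "laplacian \<psi>m x = (1 / m)\<^sup>2 * laplacian \<psi> ((1 / m) *\<^sub>R x)" for x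
      unfolding \<psi>m_def[abs_def] using laplacian_affine[OF k, of 0 "1 / m" x] by simp
    have sc: "(\<integral>x. f x * \<psi>m x \<partial>lebesgue) = m ^ DIM('a) * (\<integral>x. f (m *\<^sub>R x) * \<psi> x \<partial>lebesgue)"
    proof -
      have "(\<lambda>x. f x * \<psi>m x) \<in> borel_measurable lebesgue"
        using f_meas continuous_measurable_lebesgue[OF cm] by simp
      from lebesgue_integral_affine(1)[of m _ 0, OF _ this] m show ?thesis by (simp add: \<psi>m_def)
    qed
    have lc: "continuous_on UNIV (laplacian \<psi>m)"
      using C0_2_laplacian(2)[of \<psi>m "-{0}"] t by (auto simp: C0_infinity_def)
    have l0: "laplacian \<psi>m 0 = 0"
      using C0_2_laplacian(3)[of \<psi>m "-{0}" "(\<lambda>x. m *\<^sub>R x) ` K" 0] t Km[OF K(1,2)] \<psi>m0[OF _ K(3)]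
      by (auto simp: C0_infinity_def compact_imp_closed)
    have "m ^ DIM('a) * (\<integral>x. f (m *\<^sub>R x) * \<psi> x \<partial>lebesgue) = (\<integral>x. u x * laplacian \<psi>m x \<partial>lebesgue)"
      using sc weak_laplacian[OF t] by simp
    also have "\<dots> = m ^ DIM('a) * m powr (- l) * (\<integral>x. u x * laplacian \<psi>m (m *\<^sub>R x) \<partial>lebesgue)"
      by (rule integral_scale_u[OF lc m l0])
    also have "(\<integral>x. u x * laplacian \<psi>m (m *\<^sub>R x) \<partial>lebesgue) = (\<integral>x. (1 / m)\<^sup>2 * (u x * laplacian \<psi> x) \<partial>lebesgue)"
      using m by (simp add: lapm mult_ac)
    also have "\<dots> = (1 / m)\<^sup>2 * (\<integral>x. f x * \<psi> x \<partial>lebesgue)"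
      using weak_laplacian[OF \<psi>] by simp
    finally have "(\<integral>x. f (m *\<^sub>R x) * \<psi> x \<partial>lebesgue) = m powr (- l) * (1 / m)\<^sup>2 * (\<integral>x. f x * \<psi> x \<partial>lebesgue)"
      using m by simp
    also have "m powr (- l) * (1 / m)\<^sup>2 = m powr (- (l + 2))"
    proof -
      have "(1 / m)\<^sup>2 = m powr (-2)" using m by (simp add: powr_minus_divide power_divide)
      then show ?thesis by (simp flip: powr_add)
    qed
    finally have eq: "(\<integral>x. f (m *\<^sub>R x) * \<psi> x \<partial>lebesgue) = m powr (- (l + 2)) * (\<integral>x. f x * \<psi> x \<partial>lebesgue)" .
    have sL: "(\<lambda>x. f (m *\<^sub>R x) * \<psi> x) \<in> L2" if K': "compact K'" "K' \<subseteq> -{0}" "\<And>x. x \<notin> K' \<Longrightarrow> \<psi> x = 0" for K'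
    proof -
      have "(\<lambda>x. f x * \<psi>m x) \<in> L2" by (rule L2_cutoff(2)[OF cm Km[OF K'(1,2)]]) (use \<psi>m0 K'(3) in blast)
      then have i: "integrable lebesgue (\<lambda>x. (f x * \<psi>m x)\<^sup>2)" by (rule L2_square)
      have "integrable lebesgue (\<lambda>x. (f (m *\<^sub>R x) * \<psi>m (m *\<^sub>R x))\<^sup>2)"
        using lebesgue_integral_affine(2)[of m _ 0, OF _ borel_measurable_integrable[OF i]] i m by simp
      then show ?thesis using fm continuous_measurable_lebesgue[OF c] m by (simp add: L2_def \<psi>m_def)
    qed
    show "(\<lambda>x. g x * \<psi> x) \<in> L2" if K': "compact K'" "K' \<subseteq> -{0}" "\<And>x. x \<notin> K' \<Longrightarrow> \<psi> x = 0" for K'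
      using L2_diff[OF sL[OF K'] L2_cmult[OF L2_cutoff(2)[OF c K'], of "m powr (- (l + 2))"]]
      by (simp add: g_def left_diff_distrib mult.assoc)
    have "integrable lebesgue (\<lambda>x. f (m *\<^sub>R x) * \<psi> x)"
      by (rule L2_integrable[OF sL[OF K(1,2)] K(1)]) (simp_all add: K(3))
    then show "(\<integral>x. g x * \<psi> x \<partial>lebesgue) = 0"
      using integrable_cutoff(2)[OF c K] eq by (simp add: g_def left_diff_distrib mult.assoc)
  qed
  have ae: "AE x in lebesgue. g x * rad (bump 1 ((real (Suc n))\<^sup>2)) x = 0" for n
  proof -
    let ?\<Phi> = "bump 1 ((real (Suc n))\<^sup>2) :: real \<Rightarrow> real"
    let ?A = "annulus (real (Suc n)) :: 'a set"
    have z: "?\<Phi> \<tau> = 0" if "\<bar>\<tau>\<bar> > real (Suc n)" for \<tau>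
      by (rule bump_zero_norm) (use that in auto)
    have z': "rad ?\<Phi> x = 0" if "x \<notin> ?A" for x by (rule rad_outside[OF z that])
    note k = C_k_rad[OF C_k_bump z]
    have t: "rad ?\<Phi> \<in> C0_infinity (-{0} :: 'a set)"
      by (rule C0_infinityI[OF k compact_annulus zero_notin_annulus(2) z'])
    show ?thesis
    proof (rule L2_AE_zero[OF gL[OF t compact_annulus zero_notin_annulus(2) z'] compact_annulus])
      show "g x * rad ?\<Phi> x = 0" if "x \<notin> ?A" for x using z'[OF that] by simp
      \<comment> \<open>\<open>L2_AE_zero\<close> asks for test functions of arbitrary support;
        absorbing the radial bump into \<psi> makes them admissible for
        \<open>weak0\<close>.\<close>
      fix \<psi> :: "'a \<Rightarrow> real" assume \<psi>: "\<And>k. C_k k \<psi>"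
      have "(\<lambda>x. rad ?\<Phi> x * \<psi> x) \<in> C0_infinity (-{0})"
      proof (rule C0_infinityI[OF C_k_mult[OF k \<psi>] compact_annulus zero_notin_annulus(2)])
        fix x assume "x \<notin> ?A"
        from z'[OF this] show "rad ?\<Phi> x * \<psi> x = 0" by simp
      qed
      from weak0[OF this] show "(\<integral>x. g x * rad ?\<Phi> x * \<psi> x \<partial>lebesgue) = 0" by (simp add: mult.assoc)
    qed
  qed
  from AE_zero_rad_bump[OF this] show ?thesis
    by eventually_elim (simp add: g_def m_def powr_def algebra_simps)
qed

end

section \<open>The critical dimension\<close>

text \<open>The difference ff - FF is positive at the left end, so a nonpositive value at
  \<open>y\<close> would force a zero at or before \<open>y\<close>, and the least root could not
  lie beyond \<open>y\<close>. That \<open>LEAST\<close> really denotes a root requires a smallest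
  zero to exist, which follows from compactness of the zero set.\<close>

lemma ff_gt_FF:
  assumes "\<alpha> > -4" "0 \<le> \<beta>" "p > 1" and y: "4 + \<beta> + 2 * lam \<alpha> \<beta> p < y" "y < N_crit \<alpha> \<beta> p"
  shows "FF \<beta> y < ff \<alpha> \<beta> p y"
proof (rule ccontr)
  assume neg: "\<not> FF \<beta> y < ff \<alpha> \<beta> p y"
  define l where "l = lam \<alpha> \<beta> p"
  have l: "l > 0" unfolding l_def lam_def using assms by (intro divide_pos_pos) auto
  have g: "(4 + \<alpha> + \<beta> * p) / (p - 1) = l + \<beta>"
    unfolding l_def lam_def using assms(3) by (simp add: field_simps)
  define d where "d z = ff \<alpha> \<beta> p z - FF \<beta> z" for z
  have d: "d z = p * l * (l + \<beta> + 2) * (z - 2 - l) * (z - 4 - (l + \<beta>)) - (z + \<beta>)\<^sup>2 * (z - 4 - \<beta>)\<^sup>2 / 16" for z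
    unfolding d_def ff_def FF_def g l_def[symmetric] by simp
  define a b where "a = 4 + \<beta> + 2 * l" and "b = 4 + \<beta> + (4 * p + 1) * l"
  \<comment> \<open>At \<open>a\<close> the bases of the squares in FF are 2 (l + \<beta> + 2) and 2
    l, and the difference collapses to a positive multiple of p - 1.\<close>
  have da: "d a > 0"
  proof -
    have "d a = (p - 1) * (l\<^sup>2 * (l + \<beta> + 2)\<^sup>2)"
      unfolding d a_def by (simp add: power2_eq_square algebra_simps)
    then show ?thesis using assms l by simp
  qed
  have db: "d b < 0"
  proof -
    define c where "c = 2 + \<beta>"
    have c: "c > 0" using assms(2) by (simp add: c_def)
    have e: "d b = 4 * p\<^sup>2 * l\<^sup>2 * ((l + c) * (c + 4 * p * l)) - ((l + c) + (c + 4 * p * l))\<^sup>2 * ((4 * p + 1)\<^sup>2 * l\<^sup>2) / 16"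
      unfolding d b_def c_def by (simp add: power2_eq_square field_simps)
    \<comment> \<open>With X the product and S the squared sum of l + c and c + 4 p l, negativity
      combines 4 X \<le> S (arithmetic and geometric mean) with 4 p < 4 p + 1; the summand 1 in the
      right endpoint makes the argument strict.\<close>
    define X where "X = (l + c) * (c + 4 * p * l)"
    define S where "S = ((l + c) + (c + 4 * p * l))\<^sup>2"
    have X: "X > 0" unfolding X_def using c l assms(3) by (intro mult_pos_pos add_pos_pos) auto
    have "0 \<le> ((l + c) - (c + 4 * p * l))\<^sup>2" by simp
    then have S: "4 * X \<le> S" by (simp add: X_def S_def power2_eq_square algebra_simps)
    have "16 * p\<^sup>2 < (4 * p + 1)\<^sup>2" using assms(3) by (simp add: power2_eq_square algebra_simps)
    then have "16 * p\<^sup>2 * l\<^sup>2 < (4 * p + 1)\<^sup>2 * l\<^sup>2" using l by simp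
    then have "4 * X * (16 * p\<^sup>2 * l\<^sup>2) < 4 * X * ((4 * p + 1)\<^sup>2 * l\<^sup>2)" using X by (intro mult_strict_left_mono) auto
    also have "\<dots> \<le> S * ((4 * p + 1)\<^sup>2 * l\<^sup>2)" using S by (intro mult_right_mono) auto
    finally show ?thesis unfolding e X_def[symmetric] S_def[symmetric] by (simp add: algebra_simps)
  qed
  have dc: "continuous_on T d" for T
    unfolding d[abs_def] by (intro continuous_intros) auto
  have al: "a < y" using y(1) by (simp add: a_def l_def)
  have ab: "a \<le> b" using l assms(3) by (simp add: a_def b_def)
  \<comment> \<open>The point \<open>y\<close> may lie beyond \<open>b\<close>; at
    \<open>min y b\<close> the difference is nonpositive in either case.\<close>
  obtain r where r: "a \<le> r" "r \<le> min y b" "d r = 0"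
  proof -
    have "d (min y b) \<le> 0" using neg db by (auto simp: d_def min_def)
    moreover have "a \<le> min y b" using al ab by simp
    ultimately show thesis using IVT2'[of d "min y b" 0 a] da dc that by auto
  qed
  \<comment> \<open>The closed interval gives compactness; the strict signs at its ends put the
    least zero back into the open interval used by \<open>N_crit\<close>.\<close>
  define R where "R = {z \<in> {a..b}. d z = 0}"
  have "compact R"
  proof -
    have "closed {z \<in> {a..b}. d z = 0}"
      using continuous_closed_preimage_constant[OF dc closed_atLeastAtMost, of a b 0] by simp
    then show ?thesis unfolding R_def compact_eq_bounded_closed
      by (metis (mono_tags, lifting) bounded_closed_interval bounded_subset mem_Collect_eq subsetI box_real(2) interval_cbox)
  qed
  moreover have "r \<in> R" using r by (simp add: R_def)
  ultimately obtain m where m: "m \<in> R" "\<And>z. z \<in> R \<Longrightarrow> m \<le> z"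
    using compact_attains_inf[of R] by blast
  have "N_crit \<alpha> \<beta> p = m"
    unfolding N_crit_def
  proof (rule Least_equality)
    have "m \<noteq> a" "m \<noteq> b" using m(1) da db by (auto simp: R_def)
    then show "m \<in> {4 + \<beta> + 2 * lam \<alpha> \<beta> p <..< 4 + \<beta> + (4 * p + 1) * lam \<alpha> \<beta> p} \<and> ff \<alpha> \<beta> p m = FF \<beta> m"
      using m(1) by (auto simp: R_def a_def b_def l_def d_def)
    show "m \<le> z" if "z \<in> {4 + \<beta> + 2 * lam \<alpha> \<beta> p <..< 4 + \<beta> + (4 * p + 1) * lam \<alpha> \<beta> p} \<and> ff \<alpha> \<beta> p z = FF \<beta> z" for z
      using that by (intro m(2)) (auto simp: R_def a_def b_def l_def d_def)
  qed
  moreover have "m \<le> y" using m(2)[OF \<open>r \<in> R\<close>] r(2) by simp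
  ultimately show False using y(2) by simp
qed

section \<open>The limit of long cut-offs\<close>

text \<open>With \<open>\<psi>\<close> the spherical part of \<open>u\<close>, the numbers \<open>A + 2 \<mu> B + \<mu>\<^sup>2 D\<close>, \<open>- (B + \<mu> D)\<close> and \<open>D\<close> are the integrals
  of \<open>(\<Delta>\<psi>)\<^sup>2\<close>, \<open>|\<nabla>\<psi>|\<^sup>2\<close> and \<open>\<psi>\<^sup>2\<close> over the sphere.\<close>

lemma spherical_inequality:
  fixes A B D :: real
  assumes ineq: "p * (A + (\<mu> - \<kappa>) * B) \<le> A + 2 * (\<mu> - \<nu>) * B + (\<mu> - \<nu>)\<^sup>2 * D"
    and Y: "B + \<mu> * D \<le> 0" and X: "0 \<le> A + 2 * \<mu> * B + \<mu>\<^sup>2 * D" and D: "0 \<le> D"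
    and p: "p > 1" and \<mu>: "0 < \<mu>" "0 < \<kappa>" and \<nu>: "\<nu>\<^sup>2 < p * (\<mu> * \<kappa>)"
  shows "D = 0"
proof -
  \<comment> \<open>4 \<nu>^2 < 4 p \<mu> \<kappa> \<le> 4 p^2 \<mu> \<kappa> \<le> p^2 (\<mu> +
    \<kappa>)^2, so the coefficient of the gradient term is positive as well.\<close>
  have "(2 * \<nu>)\<^sup>2 < (p * (\<mu> + \<kappa>))\<^sup>2"
  proof -
    have "0 < \<mu> * \<kappa>" using \<mu> by simp
    then have "1 * (\<mu> * \<kappa>) \<le> p * (\<mu> * \<kappa>)" using p by (intro mult_right_mono) auto
    then have "p * (\<mu> * \<kappa>) \<le> p * (p * (\<mu> * \<kappa>))" using p by (intro mult_left_mono) auto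
    moreover have "0 \<le> p\<^sup>2 * (\<mu> - \<kappa>)\<^sup>2" by simp
    ultimately show ?thesis using \<nu> by (simp add: power2_eq_square algebra_simps)
  qed
  then have "2 * \<nu> < p * (\<mu> + \<kappa>)"
    by (rule power2_less_imp_less) (use p \<mu> in simp)
  then have "0 \<le> (p * (\<mu> + \<kappa>) - 2 * \<nu>) * - (B + \<mu> * D)" using Y by (intro mult_nonneg_nonneg) auto
  moreover have "0 \<le> (p - 1) * (A + 2 * \<mu> * B + \<mu>\<^sup>2 * D)" using p X by simp
  \<comment> \<open>Regrouping the difference of the two sides of \<open>ineq\<close> by the three
    spherical integrals: the first two contributions are nonnegative, so the one with D cannot be
    positive.\<close>
  moreover have "(p - 1) * (A + 2 * \<mu> * B + \<mu>\<^sup>2 * D) + (p * (\<mu> + \<kappa>) - 2 * \<nu>) * - (B + \<mu> * D)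
      + (p * (\<mu> * \<kappa>) - \<nu>\<^sup>2) * D = p * (A + (\<mu> - \<kappa>) * B) - (A + 2 * (\<mu> - \<nu>) * B + (\<mu> - \<nu>)\<^sup>2 * D)"
    by (simp add: power2_eq_square algebra_simps)
  ultimately have "(p * (\<mu> * \<kappa>) - \<nu>\<^sup>2) * D \<le> 0" using ineq by linarith
  then show ?thesis using \<nu> D by (simp add: mult_le_0_iff)
qed

section \<open>Power weights with long cut-offs, and the vanishing argument\<close>

context homogeneous_laplacian
begin

text \<open>Taking \<Phi>(\<tau>) = exp (t \<tau>) g(\<tau>) absorbs the weight |x|^t into the
  radial profile. The coefficient t^2 + (N - 2 - 2 l) t is the difference of q (N - 2 - q) between q
  = l and q = l - t, since the weight changes the degree of u from -l to t - l.\<close>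

lemma rad_powr_test_closure:
  assumes g: "\<And>k. C_k k g" "\<And>\<tau>. \<bar>\<tau>\<bar> > M \<Longrightarrow> g \<tau> = 0"
  shows "C0_2_closure (\<lambda>x. u x * (norm x powr t * rad g x))
     (\<lambda>x. norm x powr t * f x * rad g x + norm x powr (t - 2) * u x *
       rad (\<lambda>\<tau>. (t\<^sup>2 + (real DIM('a) - 2 - 2 * l) * t) * g \<tau> + (2 * t + real DIM('a) - 2 - 2 * l) * partial 1 g \<tau>
         + partial 1 (partial 1 g) \<tau>) x)"
proof -
  define \<Phi> where "\<Phi> \<tau> = exp (t * \<tau>) * g \<tau>" for \<tau>
  have gd: "g differentiable (at \<tau>)" "partial 1 g differentiable (at \<tau>)" for \<tau>
    using g(1)[of 2] by (simp_all add: numeral_2_eq_2)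
  have k: "C_k k \<Phi>" for k unfolding \<Phi>_def[abs_def] by (intro C_k_mult C_k_exp g)
  have z: "\<Phi> \<tau> = 0" if "\<bar>\<tau>\<bar> > M" for \<tau> using g(2)[OF that] by (simp add: \<Phi>_def)
  have ed: "(\<lambda>\<tau>. exp (t * \<tau>)) differentiable (at \<tau>)" for \<tau> using C_k_exp[of 1 t] by simp
  have pe: "partial 1 (\<lambda>\<tau>. exp (t * \<tau>)) \<tau> = t * exp (t * \<tau>)" for \<tau>
  proof -
    have d: "((\<lambda>\<tau>. exp (t * \<tau>)) has_derivative (\<lambda>h. t * exp (t * \<tau>) * h)) (at \<tau>)"
      by (auto intro!: derivative_eq_intros)
    show ?thesis using partial_eqI[OF d, of 1] by simp
  qed
  have p1: "partial 1 \<Phi> = (\<lambda>\<tau>. exp (t * \<tau>) * (t * g \<tau> + partial 1 g \<tau>))"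
    unfolding \<Phi>_def[abs_def] by (intro ext, subst partial_mult[OF ed gd(1)], subst pe) (simp add: algebra_simps)
  have dd: "(\<lambda>\<tau>. t * g \<tau> + partial 1 g \<tau>) differentiable (at \<tau>)" for \<tau>
    using gd by (intro differentiable_add differentiable_mult) auto
  have tg: "(\<lambda>\<tau>. t * g \<tau>) differentiable (at \<tau>)" for \<tau>
    using gd by (intro differentiable_mult) auto
  have p2: "partial 1 (\<lambda>\<tau>. exp (t * \<tau>) * (t * g \<tau> + partial 1 g \<tau>)) = (\<lambda>\<tau>. exp (t * \<tau>) * (t\<^sup>2 * g \<tau> + 2 * t * partial 1 g \<tau> + partial 1 (partial 1 g) \<tau>))"
    by (intro ext, subst partial_mult[OF ed dd], subst partial_add[OF tg gd(2)], subst partial_cmult[OF gd(1)], subst pe)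
       (simp add: algebra_simps power2_eq_square)
  have e: "exp (c * ln (norm x)) = norm x powr c" if "x \<noteq> 0" for x :: 'a and c
    using that by (simp add: powr_def)
  have r1: "rad \<Phi> x = norm x powr t * rad g x" for x :: 'a
    by (simp add: rad_def \<Phi>_def e)
  have r2: "rad (\<lambda>\<tau>. exp (-2 * \<tau>) * (partial 1 (partial 1 \<Phi>) \<tau> + (real DIM('a) - 2 - 2 * l) * partial 1 \<Phi> \<tau>)) x
    = norm x powr (t - 2) * rad (\<lambda>\<tau>. (t\<^sup>2 + (real DIM('a) - 2 - 2 * l) * t) * g \<tau> + (2 * t + real DIM('a) - 2 - 2 * l) * partial 1 g \<tau>
         + partial 1 (partial 1 g) \<tau>) x" for x :: 'a
  proof (cases "x = 0")
    case False
    have "exp (-2 * ln (norm x)) * exp (t * ln (norm x)) = norm x powr (t - 2)"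
      using e[OF False, of "t - 2"] by (simp flip: exp_add add: algebra_simps)
    then show ?thesis using False unfolding rad_def p1 p2
      by (simp only: if_False) (simp add: algebra_simps)
  qed (simp add: rad_def)
  show ?thesis using rad_test_closure[OF k z] unfolding r1 r2 by (simp add: mult_ac)
qed

lemma integrable_annulus_mult:
  assumes "v \<in> {u, f}" "w \<in> {u, f}"
  shows "integrable lebesgue (\<lambda>x. indicator (annulus M) x * (v x * w x * norm x powr t))"
proof -
  let ?A = "annulus M :: 'a set"
  have A: "compact ?A" "?A \<subseteq> -{0}" by (rule compact_annulus, rule zero_notin_annulus)
  obtain B where B: "(\<lambda>x. indicator ?A x * norm x powr t) \<in> borel_measurable lebesgue"
    "\<And>x. \<bar>indicator ?A x * norm x powr t\<bar> \<le> B" using compact_powr_weight[OF A, of t] by blast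
  have "(\<lambda>x. indicator ?A x * v x) \<in> L2" "(\<lambda>x. indicator ?A x * w x) \<in> L2"
    using assms u_loc[OF A] f_loc[OF A] by auto
  from integrable_bounded_mult[OF L2_mult[OF this] B]
  show ?thesis
    by (rule Bochner_Integration.integrable_cong[THEN iffD1, rotated 2]) (auto simp: indicator_def)
qed

text \<open>\<open>V\<close> abstracts |x|^\<alpha> |u|^(p - 1). Testing the equation with u |x|^(2
  s) G^2 and stability with w = u |x|^s G produces the same integral of V w^2; eliminating it leaves
  only integrals quadratic in \<open>u\<close> and \<open>f\<close>, so the nonlinearity disappears
  from the estimate.\<close>

lemma stable_solution_eq_0:
  assumes V: "V \<in> borel_measurable lebesgue" "\<And>x. 0 \<le> V x"
    and st: "\<And>\<zeta>. \<zeta> \<in> C0 2 (-{0}) \<Longrightarrow> integrable lebesgue (\<lambda>x. V x * (\<zeta> x)\<^sup>2) \<and>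
       p * (\<integral>x. V x * (\<zeta> x)\<^sup>2 \<partial>lebesgue) \<le> (\<integral>x. (laplacian \<zeta> x)\<^sup>2 * norm x powr (- \<beta>) \<partial>lebesgue)"
    and Vu: "\<And>K. compact K \<Longrightarrow> K \<subseteq> -{0} \<Longrightarrow> integrable lebesgue (\<lambda>x. indicator K x * (V x * (u x)\<^sup>2))"
    and eq: "\<And>\<zeta>. \<zeta> \<in> C0 2 (-{0}) \<Longrightarrow> (\<integral>x. f x * norm x powr (- \<beta>) * laplacian \<zeta> x \<partial>lebesgue) = (\<integral>x. V x * u x * \<zeta> x \<partial>lebesgue)"
    and p: "p > 1" and \<sigma>: "\<sigma> = (real DIM('a) - 4 - \<beta>) / 2" and \<mu>: "\<mu> = l * (real DIM('a) - 2 - l)"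
    and \<kappa>: "\<kappa> = (real DIM('a) - 4 - \<beta> - l) * (2 + \<beta> + l)" and \<nu>: "\<nu> = \<sigma> * (\<sigma> + 2 + \<beta>)"
    and pos: "0 < \<mu>" "0 < \<kappa>" "\<nu>\<^sup>2 < p * (\<mu> * \<kappa>)"
  shows "AE x in lebesgue. u x = 0"
proof -
  \<comment> \<open>With this exponent u |x|^s has degree -\<sigma>, and the three densities defined
    next have degree -N.\<close>
  define s where "s = l - \<sigma>"
  define HA where "HA x = f x * f x * norm x powr (2 * s - \<beta>)" for x
  define HB where "HB x = u x * f x * norm x powr (2 * s - 2 - \<beta>)" for x
  define HD where "HD x = u x * u x * norm x powr (2 * s - 4 - \<beta>)" for x
  have N: "real DIM('a) = 2 * \<sigma> + 4 + \<beta>" using \<sigma> by simp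
  have iH: "integrable lebesgue (\<lambda>x. indicator (annulus M) x * HA x)" "integrable lebesgue (\<lambda>x. indicator (annulus M) x * HB x)"
    "integrable lebesgue (\<lambda>x. indicator (annulus M) x * HD x)" for M
    unfolding HA_def HB_def HD_def by (rule integrable_annulus_mult; simp)+
  have ns: "norm (exp a *\<^sub>R x) powr t = exp (t * a) * norm x powr t" if "x \<noteq> 0" for a t and x :: 'a
    using that by (simp add: powr_def ln_mult algebra_simps exp_add)
  have ne: "AE x in lebesgue. x \<noteq> (0::'a)" by (simp add: AE_not_in[of "{0}", simplified])
  have us: "u (exp a *\<^sub>R x) = exp (- (l * a)) * u x" if "x \<noteq> 0" for a x
    using homog[OF _ that, of "exp a"] by (simp add: powr_def)
  have hH: "AE x in lebesgue. HA (exp a *\<^sub>R x) = exp (- (real DIM('a) * a)) * HA x"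
    "AE x in lebesgue. HB (exp a *\<^sub>R x) = exp (- (real DIM('a) * a)) * HB x"
    "AE x in lebesgue. HD (exp a *\<^sub>R x) = exp (- (real DIM('a) * a)) * HD x" for a
  proof -
    have c: "exp (- ((l + 2) * a)) * exp (- ((l + 2) * a)) * exp ((2 * s - \<beta>) * a) = exp (- (real DIM('a) * a))"
      "exp (- (l * a)) * exp (- ((l + 2) * a)) * exp ((2 * s - 2 - \<beta>) * a) = exp (- (real DIM('a) * a))"
      "exp (- (l * a)) * exp (- (l * a)) * exp ((2 * s - 4 - \<beta>) * a) = exp (- (real DIM('a) * a))"
      unfolding exp_add[symmetric] N s_def by (simp_all add: algebra_simps)
    show "AE x in lebesgue. HA (exp a *\<^sub>R x) = exp (- (real DIM('a) * a)) * HA x"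
      using AE_homogeneous_laplacian[of a] ne
    proof eventually_elim
      case (elim x)
      show ?case unfolding HA_def elim(1) ns[OF elim(2)] c(1)[symmetric] by (simp only: mult_ac)
    qed
    show "AE x in lebesgue. HB (exp a *\<^sub>R x) = exp (- (real DIM('a) * a)) * HB x"
      using AE_homogeneous_laplacian[of a] ne
    proof eventually_elim
      case (elim x)
      show ?case unfolding HB_def elim(1) us[OF elim(2)] ns[OF elim(2)] c(2)[symmetric] by (simp only: mult_ac)
    qed
    show "AE x in lebesgue. HD (exp a *\<^sub>R x) = exp (- (real DIM('a) * a)) * HD x"
      using ne
    proof eventually_elim
      case (elim x)
      show ?case unfolding HD_def us[OF elim] ns[OF elim] c(3)[symmetric] by (simp only: mult_ac)
    qed
  qed
  let ?J = "\<lambda>x::'a. rad (indicator {0..<1}) x :: real"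
  define A B D where "A = (\<integral>x. HA x * ?J x \<partial>lebesgue)" and "B = (\<integral>x. HB x * ?J x \<partial>lebesgue)"
    and "D = (\<integral>x. HD x * ?J x \<partial>lebesgue)"
  have iJ: "integrable lebesgue (\<lambda>x. HA x * ?J x)" "integrable lebesgue (\<lambda>x. HB x * ?J x)" "integrable lebesgue (\<lambda>x. HD x * ?J x)"
    by (rule integrable_rad_mult[where M=1 and C=1, OF iH(1)] integrable_rad_mult[where M=1 and C=1, OF iH(2)]
          integrable_rad_mult[where M=1 and C=1, OF iH(3)]; auto simp: indicator_def)+
  have J0: "0 \<le> ?J x" for x by (simp add: rad_def)
  have D0: "0 \<le> D" unfolding D_def using J0 by (intro Bochner_Integration.integral_nonneg) (simp add: HD_def)
  \<comment> \<open>The combined density is |x|^(2 s - 4 - \<beta>) (|x|^2 f + \<mu> u)^2, where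
    |x|^2 f + \<mu> u corresponds to the spherical Laplacian of the profile.\<close>
  have X0: "0 \<le> A + 2 * \<mu> * B + \<mu>\<^sup>2 * D"
  proof -
    have "0 \<le> (\<integral>x. HA x * ?J x + (2 * \<mu>) * (HB x * ?J x) + \<mu>\<^sup>2 * (HD x * ?J x) \<partial>lebesgue)"
    proof (rule Bochner_Integration.integral_nonneg)
      fix x :: 'a
      define r where "r = norm x powr (2 * s - 4 - \<beta>)"
      have "HA x + 2 * \<mu> * HB x + \<mu>\<^sup>2 * HD x = r * (f x * norm x powr 2 + \<mu> * u x)\<^sup>2"
      proof (cases "x = 0")
        case False
        have "norm x powr (2 * s - 2 - \<beta>) = r * norm x powr 2" "norm x powr (2 * s - \<beta>) = r * norm x powr 2 * norm x powr 2"
          unfolding r_def powr_add[symmetric] by (rule arg_cong[of _ _ "(powr) (norm x)"], simp)+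
        then show ?thesis unfolding HA_def HB_def HD_def r_def[symmetric]
          by (simp only:) (simp add: power2_eq_square algebra_simps)
      qed (simp add: HA_def HB_def HD_def r_def)
      then have "0 \<le> (HA x + 2 * \<mu> * HB x + \<mu>\<^sup>2 * HD x) * ?J x" using J0[of x] by (simp add: r_def)
      then show "0 \<le> HA x * ?J x + (2 * \<mu>) * (HB x * ?J x) + \<mu>\<^sup>2 * (HD x * ?J x)" by (simp add: algebra_simps)
    qed
    then show ?thesis using iJ by (simp add: A_def B_def D_def)
  qed
  define ap bp where "ap t = t\<^sup>2 + (real DIM('a) - 2 - 2 * l) * t" and "bp t = 2 * t + real DIM('a) - 2 - 2 * l" for t
  \<comment> \<open>\<open>ap t\<close> is \<mu> minus q (N - 2 - q) at q = l - t. Here l - s =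
    \<sigma> gives \<nu>, and l - 2 s = N - 4 - \<beta> - l gives \<kappa>.\<close>
  have aps: "ap s = \<mu> - \<nu>" "ap (2 * s) = \<mu> - \<kappa>"
    unfolding ap_def \<mu> \<nu> \<kappa> s_def N by (simp_all add: power2_eq_square algebra_simps)
  \<comment> \<open>Any nonzero smooth profile supported in [-1, 1] would serve; only the positivity
    of the integral of h^2 survives in the limit.\<close>
  define h :: "real \<Rightarrow> real" where "h = bump 1 1"
  define h1 h2 where "h1 = partial 1 h" and "h2 = partial 1 h1"
  have hk: "C_k k h" "C_k k h1" "C_k k h2" for k
  proof -
    show 1: "C_k k h" for k unfolding h_def by (rule C_k_bump)
    show 2: "C_k k h1" for k using 1[of "Suc k"] by (simp add: h1_def)
    show "C_k k h2" using 2[of "Suc k"] by (simp add: h2_def)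
  qed
  have hz: "h \<tau> = 0" "h1 \<tau> = 0" "h2 \<tau> = 0" if "\<bar>\<tau>\<bar> > 1" for \<tau>
  proof -
    have 1: "h \<tau> = 0" if "\<bar>\<tau>\<bar> > 1" for \<tau> unfolding h_def using bump_zero_norm[of 1 \<tau> 1] that by simp
    have 2: "h1 \<tau> = 0" if "\<bar>\<tau>\<bar> > 1" for \<tau> using partial_vanish[OF 1 that] by (simp add: h1_def)
    show "h \<tau> = 0" "h1 \<tau> = 0" "h2 \<tau> = 0" using 1 2 partial_vanish[OF 2 that] that by (simp_all add: h2_def)
  qed
  note hc = C_k_continuous[OF hk(1)] C_k_continuous[OF hk(2)] C_k_continuous[OF hk(3)]
  have hd: "h differentiable (at \<tau>)" "h1 differentiable (at \<tau>)" for \<tau> using hk(1)[of 1] hk(2)[of 1] by simp_all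
  have ih: "integrable lebesgue (\<lambda>\<tau>. v \<tau> * w \<tau>)" if "v \<in> {h, h1, h2}" "w \<in> {h, h1, h2}" for v w
    by (rule integrable_continuous_compact[of _ "{-1..1}"])
       (use that hc hz in \<open>auto intro!: continuous_intros simp: abs_le_iff\<close>)
  define m where "m v w = (\<integral>\<tau>. v \<tau> * w \<tau> \<partial>lebesgue)" for v w :: "real \<Rightarrow> real"
  have m0: "m h h > 0"
  proof -
    have "(\<integral>\<tau>. h \<tau> * h \<tau> \<partial>lebesgue) \<noteq> 0"
    proof
      assume "(\<integral>\<tau>. h \<tau> * h \<tau> \<partial>lebesgue) = 0"
      then have "AE \<tau> in lebesgue. h \<tau> * h \<tau> = 0"
        using integral_nonneg_eq_0_iff_AE[OF ih[of h h]] by simp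
      then have "AE \<tau> in lebesgue. h \<tau> = 0" by simp
      have "integral\<^sup>L lebesgue h = (\<integral>\<tau>. 0 \<partial>(lebesgue :: real measure))"
        by (rule integral_cong_AE) (use \<open>AE \<tau> in lebesgue. h \<tau> = 0\<close> continuous_measurable_lebesgue[OF hc(1)] in auto)
      then show False using integral_bump_pos[of 1, where 'a=real] by (simp add: h_def)
    qed
    moreover have "0 \<le> m h h" unfolding m_def by simp
    ultimately show ?thesis by (simp add: m_def less_le)
  qed
  \<comment> \<open>The common factor 1 / e of all integrals has been divided out; every term in
    which h has been differentiated keeps at least one power of e. The first inequality joins
    equation and stability, the second is the weighted inequality.\<close>
  have key: "p * (A + (\<mu> - \<kappa>) * B) * m h h \<le> A * m h h
      + 2 * B * (ap s * m h h + e * bp s * m h h1 + e\<^sup>2 * m h h2)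
      + D * ((ap s)\<^sup>2 * m h h + e\<^sup>2 * (bp s)\<^sup>2 * m h1 h1 + e ^ 4 * m h2 h2 + 2 * e * ap s * bp s * m h h1
          + 2 * e\<^sup>2 * ap s * m h h2 + 2 * e ^ 3 * bp s * m h1 h2) \<and>
      \<nu> * D * m h h \<le> - (B * m h h + D * (ap s * m h h + e * bp s * m h h1 + e\<^sup>2 * m h h2))" if e: "e > 0" for e
  proof -
    define G where "G \<tau> = h (e * \<tau>)" for \<tau>
    define k where "k \<tau> = ap s * G \<tau> + bp s * partial 1 G \<tau> + partial 1 (partial 1 G) \<tau>" for \<tau>
    define K where "K \<tau> = ap s * h \<tau> + e * bp s * h1 \<tau> + e\<^sup>2 * h2 \<tau>" for \<tau>
    have Gk: "C_k i G" for i unfolding G_def[abs_def] using C_k_affine[OF hk(1), of i 0 e] by simp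
    have Gz: "G \<tau> = 0" if "\<bar>\<tau>\<bar> > 1 / e" for \<tau>
      unfolding G_def using that e by (intro hz(1)) (simp add: abs_mult field_simps)
    have G1: "partial 1 G = (\<lambda>\<tau>. e * h1 (e * \<tau>))"
      unfolding G_def[abs_def] h1_def using partial_affine(1)[OF hd(1), of 1 0 e] by auto
    have h1d: "(\<lambda>\<tau>. h1 (e * \<tau>)) differentiable (at \<tau>)" for \<tau>
      using partial_affine(2)[OF hd(2), of 0 e] by simp
    have G2: "partial 1 (partial 1 G) = (\<lambda>\<tau>. e\<^sup>2 * h2 (e * \<tau>))"
    proof
      fix \<tau>
      have b: "partial 1 (\<lambda>\<tau>. h1 (e * \<tau>)) \<tau> = e * h2 (e * \<tau>)"
        using partial_affine(1)[OF hd(2), of 1 0 e \<tau>] by (simp add: h2_def)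
      have a: "partial 1 (\<lambda>\<tau>. e * h1 (e * \<tau>)) \<tau> = e * partial 1 (\<lambda>\<tau>. h1 (e * \<tau>)) \<tau>"
        by (rule partial_cmult[OF h1d])
      show "partial 1 (partial 1 G) \<tau> = e\<^sup>2 * h2 (e * \<tau>)"
        by (simp only: G1 a b power2_eq_square mult.assoc)
    qed
    have kK: "k \<tau> = K (e * \<tau>)" for \<tau> unfolding k_def K_def G2[unfolded G1] G1 G_def by simp
    have Kc: "continuous_on UNIV K" unfolding K_def[abs_def] by (intro continuous_intros hc)
    have Kz: "K \<tau> = 0" if "\<bar>\<tau>\<bar> > 1" for \<tau> using hz[OF that] by (simp add: K_def)
    have kc: "continuous_on UNIV k" unfolding kK[abs_def] by (intro continuous_on_compose2[OF Kc] continuous_intros) auto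
    have kz: "k \<tau> = 0" if "\<bar>\<tau>\<bar> > 1 / e" for \<tau>
      unfolding kK using that e by (intro Kz) (simp add: abs_mult field_simps)
    have Gc: "continuous_on UNIV G" using C_k_continuous[OF Gk[of 0]] .
    have sc: "(\<integral>\<tau>. Q (e * \<tau>) \<partial>lebesgue) = (\<integral>\<tau>. Q \<tau> \<partial>lebesgue) / e" if "continuous_on UNIV Q" for Q :: "real \<Rightarrow> real"
      using lebesgue_integral_affine(1)[of e Q 0] continuous_measurable_lebesgue[OF that] e by (simp add: field_simps)
    define W where "W x = norm x powr s * f x * rad G x + norm x powr (s - 2) * u x * rad k x" for x
    define w where "w x = u x * (norm x powr s * rad G x)" for x
    have cl: "C0_2_closure w W"
      using rad_powr_test_closure[where t = s, OF Gk Gz] unfolding w_def[abs_def] W_def[abs_def] k_def[abs_def] ap_def bp_def .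
    \<comment> \<open>The cut-off is squared so that u times the test function of the equation is
      exactly w^2, matching the left side of stability.\<close>
    define G' where "G' \<tau> = G \<tau> * G \<tau>" for \<tau>
    have G'k: "C_k i G'" for i unfolding G'_def[abs_def] by (intro C_k_mult Gk)
    have G'z: "G' \<tau> = 0" if "\<bar>\<tau>\<bar> > 1 / e" for \<tau> using Gz[OF that] by (simp add: G'_def)
    define k' where "k' \<tau> = ap (2 * s) * G' \<tau> + bp (2 * s) * partial 1 G' \<tau> + partial 1 (partial 1 G') \<tau>" for \<tau>
    have cl': "C0_2_closure (\<lambda>x. u x * (norm x powr (2 * s) * rad G' x))
        (\<lambda>x. norm x powr (2 * s) * f x * rad G' x + norm x powr (2 * s - 2) * u x * rad k' x)" (is "C0_2_closure ?w' ?W'")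
      using rad_powr_test_closure[where t = "2 * s", OF G'k G'z] unfolding k'_def[abs_def] ap_def bp_def .
    have G'1k: "C_k i (partial 1 G')" for i using G'k[of "Suc i"] by simp
    have G'2k: "C_k i (partial 1 (partial 1 G'))" for i using G'1k[of "Suc i"] by simp
    have G'1z: "partial 1 G' \<tau> = 0" if "\<bar>\<tau>\<bar> > 1 / e" for \<tau> by (rule partial_vanish[OF G'z that])
    have G'2z: "partial 1 (partial 1 G') \<tau> = 0" if "\<bar>\<tau>\<bar> > 1 / e" for \<tau> by (rule partial_vanish[OF G'1z that])
    have k'c: "continuous_on UNIV k'" unfolding k'_def[abs_def]
      by (intro continuous_intros C_k_continuous[OF G'k[of 0]] C_k_continuous[OF G'1k[of 0]] C_k_continuous[OF G'2k[of 0]])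
    have k'z: "k' \<tau> = 0" if "\<bar>\<tau>\<bar> > 1 / e" for \<tau>
      using G'z[OF that] G'1z[OF that] G'2z[OF that] by (simp add: k'_def)
    have zI: "F \<tau> = 0" if "\<tau> \<notin> {-(1/e)..1/e}" "\<And>\<tau>. \<bar>\<tau>\<bar> > 1 / e \<Longrightarrow> F \<tau> = 0" for F :: "real \<Rightarrow> real" and \<tau>
      using that by (auto simp: abs_if)
    have ic: "integrable lebesgue F" if "continuous_on UNIV F" "\<And>\<tau>. \<bar>\<tau>\<bar> > 1 / e \<Longrightarrow> F \<tau> = 0" for F :: "real \<Rightarrow> real"
      by (rule integrable_continuous_compact[OF that(1), of "{-(1/e)..1/e}"]) (auto intro: zI that(2))
    \<comment> \<open>The derivatives of the compactly supported \<open>G'\<close> integrate to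
      zero, so the equation contributes no error term in e.\<close>
    have k'int: "(\<integral>\<tau>. k' \<tau> \<partial>lebesgue) = ap (2 * s) * (\<integral>\<tau>. G' \<tau> \<partial>lebesgue)"
    proof -
      have "(\<integral>\<tau>. partial 1 G' \<tau> \<partial>lebesgue) = 0"
        by (rule integral_partial_eq_0[OF G'k, of "{-(1/e)..1/e}"]) (auto intro: zI G'z)
      moreover have "(\<integral>\<tau>. partial 1 (partial 1 G') \<tau> \<partial>lebesgue) = 0"
        by (rule integral_partial_eq_0[OF G'1k, of "{-(1/e)..1/e}"]) (auto intro: zI G'1z)
      ultimately show ?thesis unfolding k'_def
        using ic[OF C_k_continuous[OF G'k[of 0]] G'z] ic[OF C_k_continuous[OF G'1k[of 0]] G'1z] ic[OF C_k_continuous[OF G'2k[of 0]] G'2z]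
        by simp
    qed
    have pol: "(\<integral>x. HA x * rad F x \<partial>lebesgue) = A * (\<integral>\<tau>. F \<tau> \<partial>lebesgue)"
        "(\<integral>x. HB x * rad F x \<partial>lebesgue) = B * (\<integral>\<tau>. F \<tau> \<partial>lebesgue)"
        "(\<integral>x. HD x * rad F x \<partial>lebesgue) = D * (\<integral>\<tau>. F \<tau> \<partial>lebesgue)"
        "integrable lebesgue (\<lambda>x. HA x * rad F x)" "integrable lebesgue (\<lambda>x. HB x * rad F x)" "integrable lebesgue (\<lambda>x. HD x * rad F x)"
      if F: "continuous_on UNIV F" "\<And>\<tau>. \<bar>\<tau>\<bar> > 1 / e \<Longrightarrow> F \<tau> = 0" for F
    proof -
      show "(\<integral>x. HA x * rad F x \<partial>lebesgue) = A * (\<integral>\<tau>. F \<tau> \<partial>lebesgue)"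
        "(\<integral>x. HB x * rad F x \<partial>lebesgue) = B * (\<integral>\<tau>. F \<tau> \<partial>lebesgue)"
        "(\<integral>x. HD x * rad F x \<partial>lebesgue) = D * (\<integral>\<tau>. F \<tau> \<partial>lebesgue)"
        unfolding A_def B_def D_def
        using integral_log_radial[OF iH(1) hH(1) F] integral_log_radial[OF iH(2) hH(2) F] integral_log_radial[OF iH(3) hH(3) F]
        by blast+
      obtain C where C: "\<And>\<tau>. \<bar>F \<tau>\<bar> \<le> C"
        by (rule continuous_compact_bounded[OF continuous_on_subset[OF F(1)], of "{-(1/e)..1/e}"]) (auto intro: zI F(2))
      have Fm: "F \<in> borel_measurable borel" using F(1) by (rule borel_measurable_continuous_onI)
      show "integrable lebesgue (\<lambda>x. HA x * rad F x)" "integrable lebesgue (\<lambda>x. HB x * rad F x)" "integrable lebesgue (\<lambda>x. HD x * rad F x)"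
        using integrable_rad_mult[OF iH(1) Fm F(2) C] integrable_rad_mult[OF iH(2) Fm F(2) C] integrable_rad_mult[OF iH(3) Fm F(2) C]
        by blast+
    qed
    have GG: "continuous_on UNIV (\<lambda>\<tau>. G \<tau> * G \<tau>)" "continuous_on UNIV (\<lambda>\<tau>. G \<tau> * k \<tau>)" "continuous_on UNIV (\<lambda>\<tau>. k \<tau> * k \<tau>)"
      by (intro continuous_intros Gc kc)+
    have GGz: "G \<tau> * G \<tau> = 0" "G \<tau> * k \<tau> = 0" "k \<tau> * k \<tau> = 0" if "\<bar>\<tau>\<bar> > 1 / e" for \<tau> using Gz[OF that] by (simp_all add: kz[OF that])
    note pGG = pol[OF GG(1) GGz(1)] and pGk = pol[OF GG(2) GGz(2)] and pkk = pol[OF GG(3) GGz(3)]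
    have radm: "rad (\<lambda>\<tau>. a \<tau> * b \<tau>) x = rad a x * rad b x" for a b :: "real \<Rightarrow> real" and x :: 'a
      by (simp add: rad_def)
    have I0: "(\<integral>\<tau>. G \<tau> * G \<tau> \<partial>lebesgue) = m h h / e"
      using sc[of "\<lambda>\<tau>. h \<tau> * h \<tau>"] hc by (simp add: G_def m_def continuous_on_mult)
    have I1: "(\<integral>\<tau>. G \<tau> * k \<tau> \<partial>lebesgue) = (ap s * m h h + e * bp s * m h h1 + e\<^sup>2 * m h h2) / e"
    proof -
      have "(\<integral>\<tau>. G \<tau> * k \<tau> \<partial>lebesgue) = (\<integral>\<tau>. h \<tau> * K \<tau> \<partial>lebesgue) / e"
        unfolding kK G_def using hc Kc by (intro sc continuous_on_mult)
      also have "(\<integral>\<tau>. h \<tau> * K \<tau> \<partial>lebesgue) = (\<integral>\<tau>. ap s * (h \<tau> * h \<tau>) + (e * bp s) * (h \<tau> * h1 \<tau>) + e\<^sup>2 * (h \<tau> * h2 \<tau>) \<partial>lebesgue)"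
        by (rule Bochner_Integration.integral_cong) (simp_all add: K_def algebra_simps)
      also have "\<dots> = ap s * m h h + e * bp s * m h h1 + e\<^sup>2 * m h h2"
        unfolding m_def using ih[of h h] ih[of h h1] ih[of h h2] by simp
      finally show ?thesis .
    qed
    have I2: "(\<integral>\<tau>. k \<tau> * k \<tau> \<partial>lebesgue) = ((ap s)\<^sup>2 * m h h + e\<^sup>2 * (bp s)\<^sup>2 * m h1 h1 + e ^ 4 * m h2 h2 + 2 * e * ap s * bp s * m h h1
          + 2 * e\<^sup>2 * ap s * m h h2 + 2 * e ^ 3 * bp s * m h1 h2) / e"
    proof -
      have "(\<integral>\<tau>. k \<tau> * k \<tau> \<partial>lebesgue) = (\<integral>\<tau>. K \<tau> * K \<tau> \<partial>lebesgue) / e"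
        unfolding kK using Kc by (intro sc[of "\<lambda>\<tau>. K \<tau> * K \<tau>"] continuous_on_mult)
      also have "(\<integral>\<tau>. K \<tau> * K \<tau> \<partial>lebesgue) = (\<integral>\<tau>. (ap s)\<^sup>2 * (h \<tau> * h \<tau>) + (e\<^sup>2 * (bp s)\<^sup>2) * (h1 \<tau> * h1 \<tau>) + e ^ 4 * (h2 \<tau> * h2 \<tau>)
          + (2 * e * ap s * bp s) * (h \<tau> * h1 \<tau>) + (2 * e\<^sup>2 * ap s) * (h \<tau> * h2 \<tau>) + (2 * e ^ 3 * bp s) * (h1 \<tau> * h2 \<tau>) \<partial>lebesgue)"
        by (rule Bochner_Integration.integral_cong) (simp_all add: K_def algebra_simps power2_eq_square power3_eq_cube power4_eq_xxxx)
      also have "\<dots> = (ap s)\<^sup>2 * m h h + e\<^sup>2 * (bp s)\<^sup>2 * m h1 h1 + e ^ 4 * m h2 h2 + 2 * e * ap s * bp s * m h h1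
          + 2 * e\<^sup>2 * ap s * m h h2 + 2 * e ^ 3 * bp s * m h1 h2"
        unfolding m_def using ih[of h h] ih[of h h1] ih[of h h2] ih[of h1 h1] ih[of h1 h2] ih[of h2 h2] by simp
      finally show ?thesis .
    qed
    have pw: "norm x powr a * norm x powr b = norm x powr (a + b)" for a b and x :: 'a
      by (simp add: powr_add)
    have "(\<integral>x. f x * norm x powr (- \<beta>) * ?W' x \<partial>lebesgue) = (\<integral>x. V x * u x * ?w' x \<partial>lebesgue)"
    proof (rule C0_2_closure_weak_equation[OF cl' V st _ u_meas Vu _ eq])
      fix K :: "'a set" assume K: "compact K" "K \<subseteq> -{0}"
      obtain C where C: "(\<lambda>x. indicator K x * norm x powr (- \<beta>)) \<in> borel_measurable lebesgue"
        "\<And>x. \<bar>indicator K x * norm x powr (- \<beta>)\<bar> \<le> C" using compact_powr_weight[OF K, of "- \<beta>"] by blast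
      have "(\<lambda>x. indicator K x * f x * (indicator K x * norm x powr (- \<beta>))) = (\<lambda>x. indicator K x * (f x * norm x powr (- \<beta>)))"
        by (auto simp: indicator_def)
      then show "(\<lambda>x. indicator K x * (f x * norm x powr (- \<beta>))) \<in> L2"
        using L2_bounded_mult[OF f_loc[OF K] C] by simp
    qed (use p in auto)
    also have "(\<lambda>x. V x * u x * ?w' x) = (\<lambda>x. V x * (w x)\<^sup>2)"
    proof
      fix x :: 'a
      have "norm x powr (2 * s) = norm x powr s * norm x powr s" by (simp add: pw algebra_simps)
      then show "V x * u x * ?w' x = V x * (w x)\<^sup>2"
        unfolding w_def G'_def radm by (simp add: power2_eq_square)
    qed
    also have "(\<lambda>x. f x * norm x powr (- \<beta>) * ?W' x) = (\<lambda>x. HA x * rad G' x + HB x * rad k' x)"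
    proof
      fix x :: 'a
      have "norm x powr (2 * s - \<beta>) = norm x powr (- \<beta>) * norm x powr (2 * s)"
        "norm x powr (2 * s - 2 - \<beta>) = norm x powr (- \<beta>) * norm x powr (2 * s - 2)"
        by (simp_all add: pw algebra_simps)
      then show "f x * norm x powr (- \<beta>) * ?W' x = HA x * rad G' x + HB x * rad k' x"
        unfolding HA_def HB_def by (simp add: algebra_simps)
    qed
    finally have E1: "A * (\<integral>\<tau>. G' \<tau> \<partial>lebesgue) + B * (ap (2 * s) * (\<integral>\<tau>. G' \<tau> \<partial>lebesgue)) = (\<integral>x. V x * (w x)\<^sup>2 \<partial>lebesgue)"
      using pol[OF C_k_continuous[OF G'k[of 0]] G'z] pol[OF k'c k'z] by (simp add: k'int)
    have "p * (\<integral>x. V x * (w x)\<^sup>2 \<partial>lebesgue) \<le> (\<integral>x. (W x)\<^sup>2 * norm x powr (- \<beta>) \<partial>lebesgue)"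
      by (rule C0_2_closure_stability(2)[OF cl V st]) (use p in auto)
    also have "(\<lambda>x. (W x)\<^sup>2 * norm x powr (- \<beta>)) = (\<lambda>x. HA x * rad (\<lambda>\<tau>. G \<tau> * G \<tau>) x
        + 2 * (HB x * rad (\<lambda>\<tau>. G \<tau> * k \<tau>) x) + HD x * rad (\<lambda>\<tau>. k \<tau> * k \<tau>) x)"
    proof
      fix x :: 'a
      have "norm x powr (2 * s - \<beta>) = norm x powr (- \<beta>) * (norm x powr s * norm x powr s)"
        "norm x powr (2 * s - 2 - \<beta>) = norm x powr (- \<beta>) * (norm x powr s * norm x powr (s - 2))"
        "norm x powr (2 * s - 4 - \<beta>) = norm x powr (- \<beta>) * (norm x powr (s - 2) * norm x powr (s - 2))"
        by (simp_all add: pw algebra_simps)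
      then show "(W x)\<^sup>2 * norm x powr (- \<beta>) = HA x * rad (\<lambda>\<tau>. G \<tau> * G \<tau>) x
        + 2 * (HB x * rad (\<lambda>\<tau>. G \<tau> * k \<tau>) x) + HD x * rad (\<lambda>\<tau>. k \<tau> * k \<tau>) x"
        unfolding HA_def HB_def HD_def W_def radm by (simp only:) (simp add: power2_eq_square algebra_simps)
    qed
    finally have E2: "p * (\<integral>x. V x * (w x)\<^sup>2 \<partial>lebesgue) \<le> A * (\<integral>\<tau>. G \<tau> * G \<tau> \<partial>lebesgue)
        + 2 * (B * (\<integral>\<tau>. G \<tau> * k \<tau> \<partial>lebesgue)) + D * (\<integral>\<tau>. k \<tau> * k \<tau> \<partial>lebesgue)"
      using pGG pGk pkk by simp
    have "\<nu> * (\<integral>x. (w x)\<^sup>2 * norm x powr (-4 - \<beta>) \<partial>lebesgue) \<le> - (\<integral>x. w x * W x * norm x powr (-2 - \<beta>) \<partial>lebesgue)"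
      unfolding \<nu> by (rule C0_2_closure_weighted_inequality[OF cl \<sigma>])
    also have "(\<lambda>x. (w x)\<^sup>2 * norm x powr (-4 - \<beta>)) = (\<lambda>x. HD x * rad (\<lambda>\<tau>. G \<tau> * G \<tau>) x)"
    proof
      fix x :: 'a
      have "norm x powr (2 * s - 4 - \<beta>) = norm x powr (-4 - \<beta>) * (norm x powr s * norm x powr s)"
        by (simp add: pw algebra_simps)
      then show "(w x)\<^sup>2 * norm x powr (-4 - \<beta>) = HD x * rad (\<lambda>\<tau>. G \<tau> * G \<tau>) x"
        unfolding HD_def w_def radm by (simp only:) (simp add: power2_eq_square algebra_simps)
    qed
    also have "(\<lambda>x. w x * W x * norm x powr (-2 - \<beta>)) = (\<lambda>x. HB x * rad (\<lambda>\<tau>. G \<tau> * G \<tau>) x + HD x * rad (\<lambda>\<tau>. G \<tau> * k \<tau>) x)"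
    proof
      fix x :: 'a
      have "norm x powr (2 * s - 2 - \<beta>) = norm x powr (-2 - \<beta>) * (norm x powr s * norm x powr s)"
        "norm x powr (2 * s - 4 - \<beta>) = norm x powr (-2 - \<beta>) * (norm x powr s * norm x powr (s - 2))"
        by (simp_all add: pw algebra_simps)
      then show "w x * W x * norm x powr (-2 - \<beta>) = HB x * rad (\<lambda>\<tau>. G \<tau> * G \<tau>) x + HD x * rad (\<lambda>\<tau>. G \<tau> * k \<tau>) x"
        unfolding HB_def HD_def W_def w_def radm by (simp only:) (simp add: power2_eq_square algebra_simps)
    qed
    finally have E3: "\<nu> * (D * (\<integral>\<tau>. G \<tau> * G \<tau> \<partial>lebesgue)) \<le> - (B * (\<integral>\<tau>. G \<tau> * G \<tau> \<partial>lebesgue) + D * (\<integral>\<tau>. G \<tau> * k \<tau> \<partial>lebesgue))"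
      using pGG pGk by simp
    have "p * (A * (m h h / e) + B * (ap (2 * s) * (m h h / e))) \<le> A * (m h h / e)
        + 2 * (B * (\<integral>\<tau>. G \<tau> * k \<tau> \<partial>lebesgue)) + D * (\<integral>\<tau>. k \<tau> * k \<tau> \<partial>lebesgue)"
      using E1 E2 unfolding G'_def I0 by simp
    note F1 = this
    define q1 where "q1 = ap s * m h h + e * bp s * m h h1 + e\<^sup>2 * m h h2"
    define q2 where "q2 = (ap s)\<^sup>2 * m h h + e\<^sup>2 * (bp s)\<^sup>2 * m h1 h1 + e ^ 4 * m h2 h2 + 2 * e * ap s * bp s * m h h1
          + 2 * e\<^sup>2 * ap s * m h h2 + 2 * e ^ 3 * bp s * m h1 h2"
    have cancel: "X \<le> Y" if "X / e \<le> Y / e" for X Y using that e by (simp add: divide_le_cancel)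
    have "p * (A + (\<mu> - \<kappa>) * B) * m h h / e \<le> (A * m h h + 2 * B * q1 + D * q2) / e"
      using F1 unfolding I1 I2 q1_def[symmetric] q2_def[symmetric] aps(2)
      by (simp add: add_divide_distrib diff_divide_distrib algebra_simps)
    then have "p * (A + (\<mu> - \<kappa>) * B) * m h h \<le> A * m h h + 2 * B * q1 + D * q2"
      by (rule cancel)
    moreover have "\<nu> * D * m h h / e \<le> - (B * m h h + D * q1) / e"
      using E3 unfolding I0 I1 q1_def[symmetric]
      by (simp add: add_divide_distrib diff_divide_distrib algebra_simps)
    then have "\<nu> * D * m h h \<le> - (B * m h h + D * q1)" by (rule cancel)
    ultimately show ?thesis unfolding q1_def q2_def by blast
  qed
  define e where "e n = 1 / real (Suc n)" for n
  have e: "e n > 0" for n by (simp add: e_def)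
  have elim: "e \<longlonglongrightarrow> 0" unfolding e_def[abs_def] using LIMSEQ_inverse_real_of_nat by (simp add: inverse_eq_divide)
  have "(\<lambda>n. A * m h h
      + 2 * B * (ap s * m h h + e n * bp s * m h h1 + (e n)\<^sup>2 * m h h2)
      + D * ((ap s)\<^sup>2 * m h h + (e n)\<^sup>2 * (bp s)\<^sup>2 * m h1 h1 + e n ^ 4 * m h2 h2 + 2 * e n * ap s * bp s * m h h1
          + 2 * (e n)\<^sup>2 * ap s * m h h2 + 2 * e n ^ 3 * bp s * m h1 h2))
    \<longlonglongrightarrow> A * m h h
      + 2 * B * (ap s * m h h + 0 * bp s * m h h1 + 0\<^sup>2 * m h h2)
      + D * ((ap s)\<^sup>2 * m h h + 0\<^sup>2 * (bp s)\<^sup>2 * m h1 h1 + 0 ^ 4 * m h2 h2 + 2 * 0 * ap s * bp s * m h h1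
          + 2 * 0\<^sup>2 * ap s * m h h2 + 2 * 0 ^ 3 * bp s * m h1 h2)"
    by (intro tendsto_intros elim)
  then have "p * (A + (\<mu> - \<kappa>) * B) * m h h \<le> A * m h h
      + 2 * B * (ap s * m h h + 0 * bp s * m h h1 + 0\<^sup>2 * m h h2)
      + D * ((ap s)\<^sup>2 * m h h + 0\<^sup>2 * (bp s)\<^sup>2 * m h1 h1 + 0 ^ 4 * m h2 h2 + 2 * 0 * ap s * bp s * m h h1
          + 2 * 0\<^sup>2 * ap s * m h h2 + 2 * 0 ^ 3 * bp s * m h1 h2)"
    by (rule LIMSEQ_le_const) (use key[OF e] in blast)
  then have "p * (A + (\<mu> - \<kappa>) * B) * m h h \<le> (A + 2 * (\<mu> - \<nu>) * B + (\<mu> - \<nu>)\<^sup>2 * D) * m h h"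
    by (simp add: aps algebra_simps)
  then have Z1: "p * (A + (\<mu> - \<kappa>) * B) \<le> A + 2 * (\<mu> - \<nu>) * B + (\<mu> - \<nu>)\<^sup>2 * D"
    using m0 by simp
  have "(\<lambda>n. - (B * m h h + D * (ap s * m h h + e n * bp s * m h h1 + (e n)\<^sup>2 * m h h2)))
    \<longlonglongrightarrow> - (B * m h h + D * (ap s * m h h + 0 * bp s * m h h1 + 0\<^sup>2 * m h h2))"
    by (intro tendsto_intros elim)
  then have "\<nu> * D * m h h \<le> - (B * m h h + D * (ap s * m h h + 0 * bp s * m h h1 + 0\<^sup>2 * m h h2))"
    by (rule LIMSEQ_le_const) (use key[OF e] in blast)
  \<comment> \<open>Since ap s = \<mu> - \<nu>, the multiples of \<nu> D on the two sides
    cancel.\<close>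
  then have "(B + \<mu> * D) * m h h \<le> 0" by (simp add: aps algebra_simps)
  then have Z2: "B + \<mu> * D \<le> 0" using m0 by (simp add: mult_le_0_iff)
  have DZ: "D = 0" by (rule spherical_inequality[OF Z1 Z2 X0 D0 p pos])
  \<comment> \<open>D = 0 concerns a single shell; the polar formula transports it to every radial
    cut-off.\<close>
  have "AE x in lebesgue. HD x = 0"
  proof (rule AE_zero_rad_bump)
    fix n
    let ?F = "bump 1 ((real (Suc n))\<^sup>2) :: real \<Rightarrow> real"
    have Fc: "continuous_on UNIV ?F" using C_k_continuous[OF C_k_bump[of 0]] .
    have Fz: "?F \<tau> = 0" if "\<bar>\<tau>\<bar> > real (Suc n)" for \<tau> by (rule bump_zero_norm) (use that in auto)
    obtain C where C: "\<And>\<tau>. \<bar>?F \<tau>\<bar> \<le> C"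
      by (rule continuous_compact_bounded[OF continuous_on_subset[OF Fc], of "{- real (Suc n)..real (Suc n)}"])
         (use Fz in \<open>force simp: abs_if\<close>)+
    have Fm: "?F \<in> borel_measurable borel" using Fc by (rule borel_measurable_continuous_onI)
    have i: "integrable lebesgue (\<lambda>x. HD x * rad ?F x)" by (rule integrable_rad_mult[OF iH(3) Fm Fz C])
    have nn: "0 \<le> HD x * rad ?F x" for x by (simp add: HD_def rad_def bump_nonneg)
    have "(\<integral>x. HD x * rad ?F x \<partial>lebesgue) = 0"
      using integral_log_radial[OF iH(3) hH(3) Fc Fz] DZ by (simp add: D_def)
    then show "AE x in lebesgue. HD x * rad ?F x = 0"
      using integral_nonneg_eq_0_iff_AE[OF i] nn by simp
  qed
  with ne show ?thesis
    by eventually_elim (simp add: HD_def)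
qed

end

section \<open>The weak Laplacian\<close>

text \<open>Local assumptions control a function only on compact sets off the origin. The annuli
  exhaust the punctured space, and at each point the restricted values are eventually
  constant.\<close>

lemma measurable_punctured:
  fixes g :: "'a::euclidean_space \<Rightarrow> real"
  assumes "\<And>M. (\<lambda>x. indicator (annulus M) x * g x) \<in> borel_measurable lebesgue"
  shows "(\<lambda>x. if x = 0 then 0 else g x) \<in> borel_measurable lebesgue"
proof (rule borel_measurable_LIMSEQ_real)
  show "(\<lambda>x. indicator (annulus (real n)) x * g x) \<in> borel_measurable lebesgue" for n :: nat by (rule assms)
  fix x :: 'a
  obtain n0 :: nat where n0: "\<bar>ln (norm x)\<bar> \<le> real n0" using real_arch_simple by blast
  have "eventually (\<lambda>n. indicator (annulus (real n)) x * g x = (if x = 0 then 0 else g x)) sequentially"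
    unfolding eventually_sequentially
  proof (intro exI[of _ n0] allI impI)
    fix n assume "n0 \<le> n"
    then have "\<bar>ln (norm x)\<bar> \<le> real n" using n0 by linarith
    then show "indicator (annulus (real n)) x * g x = (if x = 0 then 0 else g x)"
      by (simp add: annulus_iff indicator_def)
  qed
  then show "(\<lambda>n. indicator (annulus (real n)) x * g x) \<longlonglongrightarrow> (if x = 0 then 0 else g x)"
    by (rule tendsto_eventually)
qed

lemma C0_infinity_C_k: "\<psi> \<in> C0_infinity \<Omega> \<Longrightarrow> C_k k \<psi>"
  by (auto simp: C0_infinity_def C0_def)

lemma C0_infinity_support:
  assumes "\<psi> \<in> C0_infinity \<Omega>"
  obtains K where "compact K" "K \<subseteq> \<Omega>" "\<And>x. x \<notin> K \<Longrightarrow> \<psi> x = 0"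
proof -
  have "\<psi> \<in> C0 0 \<Omega>" using assms by (auto simp: C0_infinity_def)
  then show thesis using that by (rule C0E) blast
qed

text \<open>Testing with \<open>\<partial>\<^sub>b\<phi>\<close> shows that the second weak derivative depends only on \<open>u\<close>, not on the
  representative picked for the first one.\<close>

lemma weak_partial_W22_loc:
  assumes u: "u \<in> W22_loc \<Omega>" and b: "b \<in> Basis"
  shows "has_weak_partial \<Omega> b u (weak_partial \<Omega> b u)"
    and "has_weak_partial \<Omega> b (weak_partial \<Omega> b u) (weak_partial \<Omega> b (weak_partial \<Omega> b u))"
proof -
  from u b obtain g h where g: "has_weak_partial \<Omega> b u g" and h: "has_weak_partial \<Omega> b g h"
    unfolding W22_loc_def by blast
  show G: "has_weak_partial \<Omega> b u (weak_partial \<Omega> b u)"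
    unfolding weak_partial_def[of \<Omega> b u] by (rule someI[of "has_weak_partial \<Omega> b u", OF g])
  have h': "has_weak_partial \<Omega> b (weak_partial \<Omega> b u) h"
    unfolding has_weak_partial_def
  proof (intro conjI ballI)
    show "weak_partial \<Omega> b u \<in> L1_loc \<Omega>" "h \<in> L1_loc \<Omega>" using G h unfolding has_weak_partial_def by blast+
    fix \<phi> assume \<phi>: "\<phi> \<in> C0_infinity \<Omega>"
    have p\<phi>: "partial b \<phi> \<in> C0_infinity \<Omega>" by (rule C0_infinity_partial[OF \<phi> b])
    have "(LINT x:\<Omega>|lebesgue. weak_partial \<Omega> b u x * partial b \<phi> x) = (LINT x:\<Omega>|lebesgue. g x * partial b \<phi> x)"
      using G g p\<phi> unfolding has_weak_partial_def by force
    then show "(LINT x:\<Omega>|lebesgue. weak_partial \<Omega> b u x * partial b \<phi> x) = - (LINT x:\<Omega>|lebesgue. h x * \<phi> x)"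
      using h \<phi> unfolding has_weak_partial_def by simp
  qed
  show "has_weak_partial \<Omega> b (weak_partial \<Omega> b u) (weak_partial \<Omega> b (weak_partial \<Omega> b u))"
    unfolding weak_partial_def[of \<Omega> b "weak_partial \<Omega> b u"]
    by (rule someI[of "has_weak_partial \<Omega> b (weak_partial \<Omega> b u)", OF h'])
qed

text \<open>The representatives chosen by \<open>weak_partial\<close> are known only to be locally
  integrable, so that is all that is recorded here; square integrability will come from the weighted
  energy. The identity is the sum over coordinates of two weak integrations by parts.\<close>

lemma weak_laplacian_W22_loc:
  fixes u :: "'a::euclidean_space \<Rightarrow> real"
  assumes u: "u \<in> W22_loc (-{0})"
  shows "weak_laplacian (-{0}) u \<in> L1_loc (-{0})"
    and "\<psi> \<in> C0_infinity (-{0}) \<Longrightarrow>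
      (\<integral>x. u x * laplacian \<psi> x \<partial>lebesgue) = (\<integral>x. weak_laplacian (-{0}) u x * \<psi> x \<partial>lebesgue)"
proof -
  let ?\<Omega> = "-{0} :: 'a set"
  define H where "H b = weak_partial ?\<Omega> b (weak_partial ?\<Omega> b u)" for b
  note w = weak_partial_W22_loc[OF u]
  have HL: "H b \<in> L1_loc ?\<Omega>" if "b \<in> Basis" for b
    using w(2)[OF that] unfolding has_weak_partial_def H_def by blast
  obtain b0 :: 'a where "b0 \<in> Basis" using nonempty_Basis by blast
  then have uL: "u \<in> L1_loc ?\<Omega>" using w(1) unfolding has_weak_partial_def by blast
  show "weak_laplacian ?\<Omega> u \<in> L1_loc ?\<Omega>"
    unfolding L1_loc_def weak_laplacian_def[abs_def] H_def[symmetric] set_integrable_def scaleR_sum_right mem_Collect_eq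
    using HL by (intro allI impI Bochner_Integration.integrable_sum) (simp add: L1_loc_def set_integrable_def)
  assume \<psi>: "\<psi> \<in> C0_infinity ?\<Omega>"
  obtain K where K: "compact K" "K \<subseteq> ?\<Omega>" "\<And>x. x \<notin> K \<Longrightarrow> \<psi> x = 0" using C0_infinity_support[OF \<psi>] by blast
  have z0: "\<phi> 0 = 0" if "\<phi> \<in> C0_infinity ?\<Omega>" for \<phi>
    using C0_infinity_support[OF that] by (metis ComplD insertI1 subsetD)
  have eq: "(\<integral>x. u x * partial b (partial b \<psi>) x \<partial>lebesgue) = (\<integral>x. H b x * \<psi> x \<partial>lebesgue)" if b: "b \<in> Basis" for b
  proof -
    have p: "partial b \<psi> \<in> C0_infinity ?\<Omega>" and pp: "partial b (partial b \<psi>) \<in> C0_infinity ?\<Omega>"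
      using C0_infinity_partial[OF _ b] \<psi> by blast+
    have "(LINT x:?\<Omega>|lebesgue. u x * partial b (partial b \<psi>) x) = (LINT x:?\<Omega>|lebesgue. H b x * \<psi> x)"
      using w[OF b] p \<psi> unfolding has_weak_partial_def H_def by force
    then show ?thesis
      using z0[OF pp] z0[OF \<psi>] by (simp add: set_integral_minus_zero)
  qed
  have iu: "integrable lebesgue (\<lambda>x. u x * partial b (partial b \<psi>) x)" if b: "b \<in> Basis" for b
  proof (rule integrable_L1_loc_mult[OF uL K(1,2)])
    have pp: "partial b (partial b \<psi>) \<in> C0_infinity ?\<Omega>" using C0_infinity_partial[OF _ b] \<psi> by blast
    show "continuous_on K (partial b (partial b \<psi>))"
      by (rule continuous_on_subset[OF C_k_continuous[OF C0_infinity_C_k[OF pp, of 0]]]) auto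
    show "partial b (partial b \<psi>) x = 0" if "x \<notin> K" for x
      using that K by (intro partial_zero_outside[of K] ) (auto simp: compact_imp_closed intro: partial_zero_outside[of K])
  qed
  have iH: "integrable lebesgue (\<lambda>x. H b x * \<psi> x)" if b: "b \<in> Basis" for b
    by (rule integrable_L1_loc_mult[OF HL[OF b] K(1,2) continuous_on_subset[OF C_k_continuous[OF C0_infinity_C_k[OF \<psi>, of 0]]] K(3)])
       auto
  have "(\<integral>x. u x * laplacian \<psi> x \<partial>lebesgue) = (\<Sum>b\<in>Basis. \<integral>x. u x * partial b (partial b \<psi>) x \<partial>lebesgue)"
    unfolding laplacian_def sum_distrib_left using iu by (intro Bochner_Integration.integral_sum) auto
  also have "\<dots> = (\<Sum>b\<in>Basis. \<integral>x. H b x * \<psi> x \<partial>lebesgue)" using eq by simp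
  also have "\<dots> = (\<integral>x. weak_laplacian ?\<Omega> u x * \<psi> x \<partial>lebesgue)"
    unfolding weak_laplacian_def sum_distrib_right H_def[symmetric]
    using iH by (intro Bochner_Integration.integral_sum[symmetric]) auto
  finally show "(\<integral>x. u x * laplacian \<psi> x \<partial>lebesgue) = (\<integral>x. weak_laplacian ?\<Omega> u x * \<psi> x \<partial>lebesgue)" .
qed

text \<open>Homogeneity is given for contractions; a factor m > 1 is reached by applying it with 1 /
  m at the point m x.\<close>

lemma homogeneous_scale:
  assumes "homogeneous \<alpha> \<beta> p u" "m > 0" "x \<noteq> 0"
  shows "u (m *\<^sub>R x) = m powr (- lam \<alpha> \<beta> p) * u x"
proof -
  have h: "u (c *\<^sub>R y) = c powr (- lam \<alpha> \<beta> p) * u y" if "0 < c" "c \<le> 1" "y \<noteq> 0" for c y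
    using assms(1) that by (simp add: homogeneous_def)
  show ?thesis
  proof (cases "m \<le> 1")
    case True
    then show ?thesis using h assms(2,3) by simp
  next
    case False
    then have "u ((1 / m) *\<^sub>R (m *\<^sub>R x)) = (1 / m) powr (- lam \<alpha> \<beta> p) * u (m *\<^sub>R x)"
      using assms(2,3) by (intro h) auto
    then have "u x = m powr (lam \<alpha> \<beta> p) * u (m *\<^sub>R x)"
      using assms(2) by (simp add: powr_divide powr_minus field_simps)
    then have "m powr (- lam \<alpha> \<beta> p) * u x = m powr (- lam \<alpha> \<beta> p) * m powr (lam \<alpha> \<beta> p) * u (m *\<^sub>R x)" by simp
    also have "m powr (- lam \<alpha> \<beta> p) * m powr (lam \<alpha> \<beta> p) = 1" using assms(2) by (simp flip: powr_add)
    finally show ?thesis by simp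
  qed
qed

lemma L1_loc_integrable:
  "g \<in> L1_loc \<Omega> \<Longrightarrow> compact K \<Longrightarrow> K \<subseteq> \<Omega> \<Longrightarrow> integrable lebesgue (\<lambda>x. indicator K x * g x)"
  unfolding L1_loc_def set_integrable_def by simp

text \<open>Membership in \<open>W22_loc\<close> and the weak equation do not see null sets, and
  nothing constrains the value at the origin; hence u = 0 takes the form of vanishing almost
  everywhere.\<close>

theorem theorem1p1:
  fixes \<alpha> \<beta> p :: real and N :: nat and u :: "real ^ 'n \<Rightarrow> real"
  assumes "N = CARD('n)" and "N \<ge> 5"
    and "\<alpha> > -4" and "0 \<le> \<beta>" and "\<beta> \<le> (real N - 4) / 2" and "p > 1"
    and "4 + \<beta> + (8 + 2 * \<alpha> + 2 * \<beta>) / (p - 1) < real N" and "real N < N_crit \<alpha> \<beta> p"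
    and "u \<in> W22_loc (-{0})"
    and "homogeneous \<alpha> \<beta> p u"
    and "stable_solution \<alpha> \<beta> p (-{0}) u"
    and "(\<lambda>x. norm x powr \<alpha> * \<bar>u x\<bar> powr (p + 1)) \<in> L1_loc (-{0})"
    and "(\<lambda>x. norm x powr (-\<beta>) * \<bar>weak_laplacian (-{0}) u x\<bar>\<^sup>2) \<in> L1_loc (-{0})"
  shows "AE x in lebesgue. u x = 0"
proof -
  let ?\<Omega> = "-{0} :: (real ^ 'n) set"
  define f0 where "f0 = weak_laplacian ?\<Omega> u"
  \<comment> \<open>Giving \<open>u\<close> and its weak Laplacian the value 0 at the origin makes
    both measurable on the whole space, and changes none of the integrals over the punctured
    space.\<close>
  define v where "v x = (if x = 0 then 0 else u x)" for x
  define f where "f x = (if x = 0 then 0 else f0 x)" for x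
  define l where "l = lam \<alpha> \<beta> p"
  define V where "V x = norm x powr \<alpha> * \<bar>v x\<bar> powr (p - 1)" for x
  have N: "real DIM(real ^ 'n) = real N" using assms(1) by simp
  have u2: "u \<in> L2_loc ?\<Omega>" using assms(9) by (simp add: W22_loc_def)
  have vK: "indicator K x * v x = indicator K x * u x" "indicator K x * f x = indicator K x * f0 x"
    if "K \<subseteq> ?\<Omega>" for K x using that by (auto simp: v_def f_def indicator_def)
  have Kl: "K \<in> sets lebesgue" if "compact K" for K :: "(real ^ 'n) set"
    using that by (simp add: compact_imp_closed)
  have um: "(\<lambda>x. indicator K x * u x) \<in> borel_measurable lebesgue" if K: "compact K" "K \<subseteq> ?\<Omega>" for K
  proof -
    have "u \<in> borel_measurable (lebesgue_on K)"
      using u2 K(2) unfolding L2_loc_def by (blast intro: measurable_restrict_mono)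
    then have "(\<lambda>x. indicator K x *\<^sub>R u x) \<in> borel_measurable lebesgue"
      using Kl[OF K(1)] by (subst borel_measurable_restrict_space_iff[symmetric]) auto
    then show ?thesis by simp
  qed
  have fm: "(\<lambda>x. indicator K x * f0 x) \<in> borel_measurable lebesgue" if K: "compact K" "K \<subseteq> ?\<Omega>" for K
    using L1_loc_integrable[OF weak_laplacian_W22_loc(1)[OF assms(9)] K] by (simp add: f0_def)
  have vL: "(\<lambda>x. indicator K x * v x) \<in> L2" if K: "compact K" "K \<subseteq> ?\<Omega>" for K
  proof -
    have "(\<lambda>x. (u x)\<^sup>2) \<in> L1_loc ?\<Omega>" using u2 by (simp add: L2_loc_def L1_loc_def)
    moreover have "(\<lambda>x. (indicator K x * u x)\<^sup>2) = (\<lambda>x. indicator K x * (u x)\<^sup>2)" by (auto simp: indicator_def)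
    ultimately show ?thesis
      using um[OF K] L1_loc_integrable[OF _ K, of "\<lambda>x. (u x)\<^sup>2"] by (simp add: L2_def vK[OF K(2)])
  qed
  have fL: "(\<lambda>x. indicator K x * f x) \<in> L2" if K: "compact K" "K \<subseteq> ?\<Omega>" for K
  proof -
    obtain B where B: "(\<lambda>x. indicator K x * norm x powr \<beta>) \<in> borel_measurable lebesgue"
      "\<And>x. \<bar>indicator K x * norm x powr \<beta>\<bar> \<le> B" using compact_powr_weight[OF K, of \<beta>] by blast
    \<comment> \<open>The factor |x|^\<beta>, bounded on \<open>K\<close>, undoes the weight in the
      energy assumption and leaves the plain square of the Laplacian.\<close>
    have "integrable lebesgue (\<lambda>x. indicator K x * (norm x powr (-\<beta>) * \<bar>f0 x\<bar>\<^sup>2) * (indicator K x * norm x powr \<beta>))"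
      unfolding f0_def by (rule integrable_bounded_mult[OF L1_loc_integrable[OF assms(13) K] B])
    moreover have "(\<lambda>x. indicator K x * (norm x powr (-\<beta>) * \<bar>f0 x\<bar>\<^sup>2) * (indicator K x * norm x powr \<beta>)) = (\<lambda>x. (indicator K x * f0 x)\<^sup>2)"
    proof
      fix x
      show "indicator K x * (norm x powr (-\<beta>) * \<bar>f0 x\<bar>\<^sup>2) * (indicator K x * norm x powr \<beta>) = (indicator K x * f0 x)\<^sup>2"
      proof (cases "x \<in> K")
        case True
        then have "norm x powr (-\<beta>) * norm x powr \<beta> = 1" using K(2) by (auto simp flip: powr_add)
        then show ?thesis using True by (simp add: mult_ac)
      qed simp
    qed
    ultimately show ?thesis using fm[OF K] by (simp add: L2_def vK[OF K(2)])
  qed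
  have vm: "v \<in> borel_measurable lebesgue"
    unfolding v_def[abs_def] by (intro measurable_punctured um compact_annulus zero_notin_annulus)
  have fme: "f \<in> borel_measurable lebesgue"
    unfolding f_def[abs_def] by (intro measurable_punctured fm compact_annulus zero_notin_annulus)
  have C20: "\<zeta> 0 = 0" "laplacian \<zeta> 0 = 0" if z: "\<zeta> \<in> C0 2 ?\<Omega>" for \<zeta>
  proof -
    obtain K where K: "compact K" "K \<subseteq> ?\<Omega>" "\<And>x. x \<notin> K \<Longrightarrow> \<zeta> x = 0" using z by (rule C0E) blast
    then have "0 \<notin> K" by blast
    then show "\<zeta> 0 = 0" "laplacian \<zeta> 0 = 0"
      using K(3) C0_2_laplacian(3)[OF z compact_imp_closed[OF K(1)]] by blast+
  qed
  interpret homogeneous_laplacian v f l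
  proof
    show "v \<in> borel_measurable lebesgue" "f \<in> borel_measurable lebesgue" by (fact vm fme)+
    show "(\<lambda>x. indicator K x * v x) \<in> L2" "(\<lambda>x. indicator K x * f x) \<in> L2"
      if "compact K" "K \<subseteq> ?\<Omega>" for K using vL fL that by blast+
    show "v (m *\<^sub>R x) = m powr (- l) * v x" if "m > 0" "x \<noteq> 0" for m x
      using homogeneous_scale[OF assms(10) that] that by (simp add: v_def l_def)
    fix \<psi> assume \<psi>: "\<psi> \<in> C0_infinity ?\<Omega>"
    have \<psi>2: "\<psi> \<in> C0 2 ?\<Omega>" using \<psi> by (auto simp: C0_infinity_def)
    have "(\<lambda>x. v x * laplacian \<psi> x) = (\<lambda>x. u x * laplacian \<psi> x)" "(\<lambda>x. f x * \<psi> x) = (\<lambda>x. f0 x * \<psi> x)"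
      using C20[OF \<psi>2] by (auto simp: v_def f_def)
    then show "(\<integral>x. v x * laplacian \<psi> x \<partial>lebesgue) = (\<integral>x. f x * \<psi> x \<partial>lebesgue)"
      using weak_laplacian_W22_loc(2)[OF assms(9) \<psi>] by (simp add: f0_def)
  qed
  have Vm: "V \<in> borel_measurable lebesgue"
  proof -
    have "(\<lambda>x::real ^ 'n. norm x powr \<alpha>) \<in> borel_measurable lebesgue"
      by (intro measurable_completion) simp
    then show ?thesis unfolding V_def[abs_def] using vm by measurable
  qed
  have V0: "0 \<le> V x" for x by (simp add: V_def)
  have Vu2: "V x * (v x)\<^sup>2 = norm x powr \<alpha> * \<bar>v x\<bar> powr (p + 1)" for x
  proof (cases "v x = 0")
    case False
    then have "\<bar>v x\<bar> powr (p - 1) * \<bar>v x\<bar> powr 2 = \<bar>v x\<bar> powr (p + 1)" by (simp only: powr_add[symmetric]) (simp add: add.commute)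
    moreover have "\<bar>v x\<bar> powr 2 = (v x)\<^sup>2" using False powr_numeral[of "\<bar>v x\<bar>" "num.Bit0 num.One"] by simp
    ultimately show ?thesis by (simp add: V_def mult.assoc)
  qed (simp add: V_def)
  have Vloc: "integrable lebesgue (\<lambda>x. indicator K x * (V x * (v x)\<^sup>2))" if K: "compact K" "K \<subseteq> ?\<Omega>" for K
  proof -
    have "(\<lambda>x. indicator K x * (V x * (v x)\<^sup>2)) = (\<lambda>x. indicator K x * (norm x powr \<alpha> * \<bar>u x\<bar> powr (p + 1)))"
      unfolding Vu2 using K(2) by (auto simp: indicator_def v_def)
    then show ?thesis using L1_loc_integrable[OF assms(12) K] by simp
  qed
  have l0: "l > 0" unfolding l_def lam_def using assms(3,4,6) by (intro divide_pos_pos) auto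
  have st: "integrable lebesgue (\<lambda>x. V x * (\<zeta> x)\<^sup>2) \<and>
      p * (\<integral>x. V x * (\<zeta> x)\<^sup>2 \<partial>lebesgue) \<le> (\<integral>x. (laplacian \<zeta> x)\<^sup>2 * norm x powr (- \<beta>) \<partial>lebesgue)"
    if \<zeta>: "\<zeta> \<in> C0 2 ?\<Omega>" for \<zeta>
  proof
    obtain K where K: "compact K" "K \<subseteq> ?\<Omega>" "\<And>x. x \<notin> K \<Longrightarrow> \<zeta> x = 0" using \<zeta> by (rule C0E) blast
    have zc: "continuous_on UNIV \<zeta>" by (rule C0_2_laplacian(1)[OF \<zeta>])
    have z2: "continuous_on UNIV (\<lambda>x. (\<zeta> x)\<^sup>2)" by (intro continuous_intros zc)
    have z20: "(\<zeta> x)\<^sup>2 = 0" if "x \<notin> K" for x using K(3)[OF that] by simp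
    obtain C where C: "C > 0" "\<And>x. \<bar>(\<zeta> x)\<^sup>2\<bar> \<le> C"
      by (rule continuous_compact_bounded[OF continuous_on_subset[OF z2] K(1) z20]) auto
    obtain B where B: "(\<lambda>x. indicator K x * norm x powr \<alpha>) \<in> borel_measurable lebesgue"
      "\<And>x. \<bar>indicator K x * norm x powr \<alpha>\<bar> \<le> B" using compact_powr_weight[OF K(1,2), of \<alpha>] by blast
    have i1: "integrable lebesgue (\<lambda>x. indicator K x * (indicator K x * norm x powr \<alpha>))"
      by (rule integrable_bounded_mult[OF compact_integrable_indicator[OF K(1)] B])
    have i2: "integrable lebesgue (\<lambda>x. indicator K x * (indicator K x * norm x powr \<alpha>) + indicator K x * (V x * (v x)\<^sup>2))"
      using i1 Vloc[OF K(1,2)] by simp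
    have i3: "integrable lebesgue (\<lambda>x. (indicator K x * (indicator K x * norm x powr \<alpha>) + indicator K x * (V x * (v x)\<^sup>2)) * (\<zeta> x)\<^sup>2)"
      by (rule integrable_bounded_mult[OF i2 continuous_measurable_lebesgue[OF z2] C(2)])
    show "integrable lebesgue (\<lambda>x. V x * (\<zeta> x)\<^sup>2)"
    proof (rule Bochner_Integration.integrable_bound[OF i3])
      show "(\<lambda>x. V x * (\<zeta> x)\<^sup>2) \<in> borel_measurable lebesgue"
        using Vm continuous_measurable_lebesgue[OF z2] by simp
      show "AE x in lebesgue. norm (V x * (\<zeta> x)\<^sup>2)
          \<le> norm ((indicator K x * (indicator K x * norm x powr \<alpha>) + indicator K x * (V x * (v x)\<^sup>2)) * (\<zeta> x)\<^sup>2)"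
      proof (rule AE_I2)
        fix x
        show "norm (V x * (\<zeta> x)\<^sup>2)
          \<le> norm ((indicator K x * (indicator K x * norm x powr \<alpha>) + indicator K x * (V x * (v x)\<^sup>2)) * (\<zeta> x)\<^sup>2)"
        proof (cases "x \<in> K")
          case True
          \<comment> \<open>This reduces local integrability of the potential \<open>V\<close> to
            that of |x|^\<alpha> and |x|^\<alpha> |u|^(p + 1).\<close>
          have "\<bar>v x\<bar> powr (p - 1) \<le> 1 + \<bar>v x\<bar> powr (p + 1)"
          proof (cases "\<bar>v x\<bar> \<le> 1")
            case True
            then have "\<bar>v x\<bar> powr (p - 1) \<le> 1 powr (p - 1)" using assms(6) by (intro powr_mono2) auto
            moreover have "0 \<le> \<bar>v x\<bar> powr (p + 1)" by simp
            ultimately show ?thesis by (simp del: powr_ge_zero)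
          next
            case False
            then have "\<bar>v x\<bar> powr (p - 1) \<le> \<bar>v x\<bar> powr (p + 1)" by (intro powr_mono) auto
            then show ?thesis by simp
          qed
          then have "V x \<le> norm x powr \<alpha> * (1 + \<bar>v x\<bar> powr (p + 1))"
            unfolding V_def by (intro mult_left_mono) auto
          then have "V x \<le> norm x powr \<alpha> + V x * (v x)\<^sup>2" unfolding Vu2 by (simp add: distrib_left)
          then have "V x * (\<zeta> x)\<^sup>2 \<le> (norm x powr \<alpha> + V x * (v x)\<^sup>2) * (\<zeta> x)\<^sup>2" by (intro mult_right_mono) auto
          moreover have "0 \<le> V x * (\<zeta> x)\<^sup>2" using V0[of x] by simp
          ultimately show ?thesis using True by simp
        next
          case False
          then show ?thesis using K(3) by simp
        qed
      qed
    qed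
    have "p * (LINT x:?\<Omega>|lebesgue. norm x powr \<alpha> * \<bar>u x\<bar> powr (p - 1) * (\<zeta> x)\<^sup>2)
        \<le> (LINT x:?\<Omega>|lebesgue. \<bar>laplacian \<zeta> x\<bar>\<^sup>2 / norm x powr \<beta>)"
      using assms(11) \<zeta> unfolding stable_solution_def by blast
    then have "p * (\<integral>x. norm x powr \<alpha> * \<bar>u x\<bar> powr (p - 1) * (\<zeta> x)\<^sup>2 \<partial>lebesgue)
        \<le> (\<integral>x. \<bar>laplacian \<zeta> x\<bar>\<^sup>2 / norm x powr \<beta> \<partial>lebesgue)"
      using C20[OF \<zeta>] by (simp add: set_integral_minus_zero)
    moreover have "(\<lambda>x. norm x powr \<alpha> * \<bar>u x\<bar> powr (p - 1) * (\<zeta> x)\<^sup>2) = (\<lambda>x. V x * (\<zeta> x)\<^sup>2)"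
      using C20[OF \<zeta>] by (auto simp: V_def v_def)
    moreover have "(\<lambda>x. \<bar>laplacian \<zeta> x\<bar>\<^sup>2 / norm x powr \<beta>) = (\<lambda>x. (laplacian \<zeta> x)\<^sup>2 * norm x powr (- \<beta>))"
      by (auto simp: powr_minus divide_inverse)
    ultimately show "p * (\<integral>x. V x * (\<zeta> x)\<^sup>2 \<partial>lebesgue) \<le> (\<integral>x. (laplacian \<zeta> x)\<^sup>2 * norm x powr (- \<beta>) \<partial>lebesgue)"
      by simp
  qed
  have eq: "(\<integral>x. f x * norm x powr (- \<beta>) * laplacian \<zeta> x \<partial>lebesgue) = (\<integral>x. V x * v x * \<zeta> x \<partial>lebesgue)"
    if \<zeta>: "\<zeta> \<in> C0 2 ?\<Omega>" for \<zeta>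
  proof -
    have "(LINT x:?\<Omega>|lebesgue. f0 x * laplacian \<zeta> x / norm x powr \<beta>) =
        (LINT x:?\<Omega>|lebesgue. norm x powr \<alpha> * \<bar>u x\<bar> powr (p - 1) * u x * \<zeta> x)"
      using assms(11) \<zeta> unfolding stable_solution_def weak_solution_def f0_def by blast
    then have "(\<integral>x. f0 x * laplacian \<zeta> x / norm x powr \<beta> \<partial>lebesgue) =
        (\<integral>x. norm x powr \<alpha> * \<bar>u x\<bar> powr (p - 1) * u x * \<zeta> x \<partial>lebesgue)"
      using C20[OF \<zeta>] by (simp add: set_integral_minus_zero)
    moreover have "(\<lambda>x. f0 x * laplacian \<zeta> x / norm x powr \<beta>) = (\<lambda>x. f x * norm x powr (- \<beta>) * laplacian \<zeta> x)"
      using C20[OF \<zeta>] by (auto simp: f_def powr_minus divide_inverse)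
    moreover have "(\<lambda>x. norm x powr \<alpha> * \<bar>u x\<bar> powr (p - 1) * u x * \<zeta> x) = (\<lambda>x. V x * v x * \<zeta> x)"
      using C20[OF \<zeta>] by (auto simp: V_def v_def)
    ultimately show ?thesis by simp
  qed
  \<comment> \<open>The fraction (8 + 2 \<alpha> + 2 \<beta>) / (p - 1) is 2 l. In particular N - 4
    - \<beta> - l > l > 0, which gives the signs of \<mu> and \<kappa> below.\<close>
  have Nl: "4 + \<beta> + 2 * l < real N"
    using assms(7) unfolding l_def lam_def by (simp add: algebra_simps add_divide_distrib)
  have ffFF: "FF \<beta> (real N) < ff \<alpha> \<beta> p (real N)"
    using ff_gt_FF[OF assms(3,4,6) _ assms(8)] Nl by (simp add: l_def)
  have g: "(4 + \<alpha> + \<beta> * p) / (p - 1) = l + \<beta>"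
    unfolding l_def lam_def using assms(6) by (simp add: field_simps)
  define \<sigma> where "\<sigma> = (real DIM(real ^ 'n) - 4 - \<beta>) / 2"
  define \<mu> where "\<mu> = l * (real DIM(real ^ 'n) - 2 - l)"
  define \<kappa> where "\<kappa> = (real DIM(real ^ 'n) - 4 - \<beta> - l) * (2 + \<beta> + l)"
  define \<nu> where "\<nu> = \<sigma> * (\<sigma> + 2 + \<beta>)"
  have "0 < \<mu>" "0 < \<kappa>"
    unfolding \<mu>_def \<kappa>_def N using Nl l0 assms(4) by (auto intro!: mult_pos_pos)
  moreover have "\<nu>\<^sup>2 < p * (\<mu> * \<kappa>)"
  proof -
    \<comment> \<open>Here \<sigma> = (N - 4 - \<beta>) / 2 and \<sigma> + 2 + \<beta> = (N +
      \<beta>) / 2, while (4 + \<alpha> + \<beta> p) / (p - 1) = l + \<beta> identifies p \<mu>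
      \<kappa> with \<open>ff\<close>; the bound on N by \<open>N_crit\<close> enters only through
      this comparison.\<close>
    have "\<nu>\<^sup>2 = FF \<beta> (real N)"
      unfolding \<nu>_def \<sigma>_def FF_def N by (simp add: power2_eq_square field_simps)
    moreover have "p * (\<mu> * \<kappa>) = ff \<alpha> \<beta> p (real N)"
      unfolding \<mu>_def \<kappa>_def ff_def g l_def[symmetric] N by (simp add: algebra_simps)
    ultimately show ?thesis using ffFF by simp
  qed
  ultimately have "AE x in lebesgue. v x = 0"
    using stable_solution_eq_0[OF Vm V0 st Vloc eq assms(6) \<sigma>_def \<mu>_def \<kappa>_def \<nu>_def] by blast
  moreover have "AE x in lebesgue. x \<noteq> (0::real ^ 'n)" by (simp add: AE_not_in[of "{0}", simplified])
  ultimately show ?thesis by eventually_elim (simp add: v_def)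
qed

end
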